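(* Let $(X,\sigma_X)$, $(Y,\sigma_Y)$ be topologically mixing one-sided shifts of finite type and $\pi:(X,\sigma_X)\to(Y,\sigma_Y)$ a (one-block) factor map. Let $\alpha>0$. For all $n\in\mathbb N$ define $\phi_n:Y\to\mathbb R$ by $\phi_n(y)=\log\big(|\pi^{-1}[y_1\cdots y_n]|^{1/(\alpha+1)}\big)$, and let $\Phi=\{\phi_n\}_{n=1}^\infty$. Then, for each $\alpha>0$, there is a unique equilibrium state for $\Phi$. The unique measure is Gibbs (for $\Phi$) and mixing.
   Context: A factor map $\pi$ between one-sided subshifts is a continuous surjection with $\pi\circ\sigma_X=\sigma_Y\circ\pi$; it is one-block if the $i$-th coordinate of $\pi(x)$ depends only on $x_i$. $|\pi^{-1}[y_1\cdots y_n]|$ is the number of words $x_1\cdots x_n$ of length $n$ occurring in $X$ that map to $y_1\cdots y_n$. $M(Y,\sigma_Y)$ is the set of $\sigma_Y$-invariant Borel probability measures and $h_\mu$ is entropy. The sequence $\Phi$ is subadditive ($\phi_{n+m}\le\phi_n+\phi_m\circ\sigma_Y^n$). An equilibrium state for $\Phi$ is a $\mu\in M(Y,\sigma_Y)$ attaining $\sup_{\nu\in M(Y,\sigma_Y)}\{h_\nu(\sigma_Y)+\lim_{n\to\infty}\frac1n\int\phi_n\,d\nu\}$. A Borel probability measure $\mu$ on $Y$ is a Gibbs measure for $\Phi$ if there are $C>0$ and $P\in\mathbb R$ with $\frac1C<\mu([y_1\cdots y_n])/e^{-nP+\phi_n(y)}<C$ for all $y\in Y$, $n\in\mathbb N$.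 *)

theory Defs
  imports "HOL-Probability.Probability"
begin

section \<open>One-sided subshifts\<close>

text \<open>
  Points of a one-sided subshift over a finite alphabet \<open>'a\<close> are functions \<open>nat \<Rightarrow> 'a\<close>, indexed
  from \<open>0\<close>: the coordinate written $x_i$ ($i \ge 1$) in the literature is \<open>x (i - 1)\<close>.
\<close>

definition shift_map :: "(nat \<Rightarrow> 'a) \<Rightarrow> nat \<Rightarrow> 'a" where
  "shift_map x = (\<lambda>n. x (Suc n))"

definition block :: "(nat \<Rightarrow> 'a) \<Rightarrow> nat \<Rightarrow> nat \<Rightarrow> 'a list" where
  "block x i n = map (\<lambda>j. x (i + j)) [0..<n]"

definition occurs_in :: "'a list \<Rightarrow> (nat \<Rightarrow> 'a) \<Rightarrow> bool" where
  "occurs_in w x \<longleftrightarrow> (\<exists>i. block x i (length w) = w)"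

definition cylinder :: "(nat \<Rightarrow> 'a) set \<Rightarrow> 'a list \<Rightarrow> (nat \<Rightarrow> 'a) set" where
  "cylinder X w = {x \<in> X. block x 0 (length w) = w}"

definition subshift_topology :: "(nat \<Rightarrow> 'a) set \<Rightarrow> (nat \<Rightarrow> 'a) topology" where
  "subshift_topology X = subtopology (product_topology (\<lambda>_. discrete_topology UNIV) UNIV) X"

text \<open>Subshifts are nonempty by convention (the empty one carries no probability measure).\<close>

definition subshift :: "(nat \<Rightarrow> 'a::finite) set \<Rightarrow> bool" where
  "subshift X \<longleftrightarrow>
     X \<noteq> {} \<and> closedin (product_topology (\<lambda>_. discrete_topology UNIV) UNIV) X \<and> shift_map ` X \<subseteq> X"

definition shift_of_finite_type :: "(nat \<Rightarrow> 'a::finite) set \<Rightarrow> bool" where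
  "shift_of_finite_type X \<longleftrightarrow>
     subshift X \<and> (\<exists>F. finite F \<and> X = {x. \<forall>w\<in>F. \<not> occurs_in w x})"

definition topologically_mixing :: "(nat \<Rightarrow> 'a) set \<Rightarrow> bool" where
  "topologically_mixing X \<longleftrightarrow>
     (\<forall>U V. openin (subshift_topology X) U \<and> U \<noteq> {} \<and> openin (subshift_topology X) V \<and> V \<noteq> {} \<longrightarrow>
        (\<exists>N. \<forall>n\<ge>N. U \<inter> (shift_map ^^ n) -` V \<noteq> {}))"

definition factor_map ::
  "(nat \<Rightarrow> 'a) set \<Rightarrow> (nat \<Rightarrow> 'b) set \<Rightarrow> ((nat \<Rightarrow> 'a) \<Rightarrow> (nat \<Rightarrow> 'b)) \<Rightarrow> bool" where
  "factor_map X Y \<pi> \<longleftrightarrow>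
     continuous_map (subshift_topology X) (subshift_topology Y) \<pi> \<and> \<pi> ` X = Y \<and>
     (\<forall>x\<in>X. \<pi> (shift_map x) = shift_map (\<pi> x))"

definition one_block :: "(nat \<Rightarrow> 'a) set \<Rightarrow> ((nat \<Rightarrow> 'a) \<Rightarrow> (nat \<Rightarrow> 'b)) \<Rightarrow> bool" where
  "one_block X \<pi> \<longleftrightarrow> (\<forall>i. \<forall>x\<in>X. \<forall>x'\<in>X. x i = x' i \<longrightarrow> \<pi> x i = \<pi> x' i)"

text \<open>
  The words occurring in \<open>X\<close> that a one-block factor map \<open>\<pi>\<close> sends to the word \<open>v\<close>.  For such \<open>\<pi>\<close>
  the image of a word does not depend on the point and the position at which the word occurs.
\<close>

definition word_preimages ::
  "(nat \<Rightarrow> 'a) set \<Rightarrow> ((nat \<Rightarrow> 'a) \<Rightarrow> (nat \<Rightarrow> 'b)) \<Rightarrow> 'b list \<Rightarrow> 'a list set" where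
  "word_preimages X \<pi> v =
     {w. \<exists>x\<in>X. \<exists>i. w = block x i (length v) \<and> block (\<pi> x) i (length v) = v}"


section \<open>Measure-preserving maps\<close>

definition measure_preserving :: "'a measure \<Rightarrow> ('a \<Rightarrow> 'a) \<Rightarrow> bool" where
  "measure_preserving M T \<longleftrightarrow> T \<in> measurable M M \<and> distr M M T = M"

definition mixing :: "'a measure \<Rightarrow> ('a \<Rightarrow> 'a) \<Rightarrow> bool" where
  "mixing M T \<longleftrightarrow> measure_preserving M T \<and>
     (\<forall>A\<in>sets M. \<forall>B\<in>sets M.
        (\<lambda>n. measure M (A \<inter> (T ^^ n) -` B)) \<longlonglongrightarrow> measure M A * measure M B)"

subsection \<open>Kolmogorov--Sinai entropy\<close>

definition finite_partition :: "'a measure \<Rightarrow> 'a set set \<Rightarrow> bool" where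
  "finite_partition M P \<longleftrightarrow> finite P \<and> P \<subseteq> sets M \<and> partition_on (space M) P"

definition partition_entropy :: "'a measure \<Rightarrow> 'a set set \<Rightarrow> real" where
  "partition_entropy M P = - (\<Sum>A\<in>P. measure M A * ln (measure M A))"

text \<open>The join $\bigvee_{i<n} T^{-i} P$.\<close>

definition iterated_join :: "'a measure \<Rightarrow> ('a \<Rightarrow> 'a) \<Rightarrow> 'a set set \<Rightarrow> nat \<Rightarrow> 'a set set" where
  "iterated_join M T P n =
     {space M \<inter> (\<Inter>i<n. (T ^^ i) -` f i) |f. \<forall>i<n. f i \<in> P} - {{}}"

definition entropy_wrt :: "'a measure \<Rightarrow> ('a \<Rightarrow> 'a) \<Rightarrow> 'a set set \<Rightarrow> real" where
  "entropy_wrt M T P = lim (\<lambda>n. partition_entropy M (iterated_join M T P n) / real n)"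

definition KS_entropy :: "'a measure \<Rightarrow> ('a \<Rightarrow> 'a) \<Rightarrow> ereal" where
  "KS_entropy M T = (SUP P\<in>{P. finite_partition M P}. ereal (entropy_wrt M T P))"


section \<open>Equilibrium states and Gibbs measures for sequences of functions\<close>

definition borel_prob_measures :: "(nat \<Rightarrow> 'a) set \<Rightarrow> (nat \<Rightarrow> 'a) measure set" where
  "borel_prob_measures Y =
     {\<mu>. prob_space \<mu> \<and> space \<mu> = Y \<and> sets \<mu> = sigma_sets Y {U. openin (subshift_topology Y) U}}"

definition invariant_measures :: "(nat \<Rightarrow> 'a) set \<Rightarrow> (nat \<Rightarrow> 'a) measure set" where
  "invariant_measures Y = {\<mu> \<in> borel_prob_measures Y. measure_preserving \<mu> shift_map}"

text \<open>
  For a subadditive sequence the limit below exists in the extended reals, possibly \<open>-\<infinity>\<close>.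
\<close>

definition free_energy ::
  "(nat \<Rightarrow> (nat \<Rightarrow> 'a) \<Rightarrow> real) \<Rightarrow> (nat \<Rightarrow> 'a) measure \<Rightarrow> ereal" where
  "free_energy \<phi> \<mu> = KS_entropy \<mu> shift_map + lim (\<lambda>n. ereal ((1 / real n) * (\<integral>y. \<phi> n y \<partial>\<mu>)))"

definition equilibrium_state ::
  "(nat \<Rightarrow> 'a) set \<Rightarrow> (nat \<Rightarrow> (nat \<Rightarrow> 'a) \<Rightarrow> real) \<Rightarrow> (nat \<Rightarrow> 'a) measure \<Rightarrow> bool" where
  "equilibrium_state Y \<phi> \<mu> \<longleftrightarrow>
     \<mu> \<in> invariant_measures Y \<and>
     free_energy \<phi> \<mu> = (SUP \<nu>\<in>invariant_measures Y. free_energy \<phi> \<nu>)"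

definition gibbs_measure ::
  "(nat \<Rightarrow> 'a) set \<Rightarrow> (nat \<Rightarrow> (nat \<Rightarrow> 'a) \<Rightarrow> real) \<Rightarrow> (nat \<Rightarrow> 'a) measure \<Rightarrow> bool" where
  "gibbs_measure Y \<phi> \<mu> \<longleftrightarrow>
     \<mu> \<in> borel_prob_measures Y \<and>
     (\<exists>C>0. \<exists>P::real. \<forall>y\<in>Y. \<forall>n\<ge>1.
        1 / C < measure \<mu> (cylinder Y (block y 0 n)) / exp (- real n * P + \<phi> n y) \<and>
        measure \<mu> (cylinder Y (block y 0 n)) / exp (- real n * P + \<phi> n y) < C)"

end

theory Submission
  imports Defs
begin

text \<open>
  Write \<open>\<psi>(w)\<close> for the number of preimages of the word \<open>w\<close>, raised to the power \<open>s = 1 / (\<alpha> + 1)\<close>.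
  It is submultiplicative, and since \<open>X\<close> is a mixing shift of finite type and \<open>t\<^sup>s\<close> is subadditive
  for \<open>s \<le> 1\<close>, there is a gap length \<open>p\<close> with \<open>\<psi>(u) \<psi>(v) \<le> \<Sum> \<psi>(u w v)\<close>, the sum running over
  the words \<open>w\<close> of length \<open>p\<close>.  Hence the partition functions \<open>Z\<^sub>n\<close> equal \<open>e\<^bsup>nP\<^esup>\<close> up to a constant,
  and a limit point of position-averaged normalised weights is an invariant Gibbs measure \<open>\<mu>\<close>.

  Comparing with \<open>\<mu>\<close>, the free energy of an invariant \<open>\<nu>\<close> is at most \<open>P\<close>, and in the case of equality
  subadditivity of block entropy and of the integrals of \<open>\<phi>\<^sub>n\<close> bounds the relative entropy of \<open>\<nu>\<close>
  with respect to \<open>\<mu>\<close> on words of length \<open>n\<close> uniformly in \<open>n\<close>, so \<open>\<nu>\<close> is absolutely continuous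
  with respect to \<open>\<mu>\<close>.

  Finally, \<open>\<mu>(A \<inter> \<sigma>\<^sup>-\<^sup>n B) \<ge> c \<mu>(A) \<mu>(B) - \<epsilon>\<close> for large \<open>n\<close>, uniformly in \<open>B\<close>.  As in the lower
  function theorem of Lasota and Yorke this forces the transfer operator of \<open>\<mu>\<close> to contract every
  density of mean zero to \<open>0\<close> in \<open>L\<^sup>1\<close>, which gives mixing and \<open>\<nu> = \<mu>\<close>.
\<close>

section \<open>Entropy of simple functions\<close>

text \<open>For a single gap word \<open>w\<close> the value \<psi>(u w v) may be far below
  \<psi>(u) \<psi>(v), or zero, since the words of X joining preimages of \<open>u\<close> and
  \<open>v\<close> may have other images. So \<Phi> is subadditive but need not be almost additive,
  and only sums over gap words are bounded below. They yield \<mu>(A \<inter> \<sigma>^-n B) \<ge> c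
  \<mu>(A) \<mu>(B) with some c > 0 that has no reason to be 1; this is not yet mixing, and a
  contraction argument has to amplify it. Uniqueness does not pass through ergodic components. Block
  entropies and energies are subadditive in n, so their rates are infima: an equilibrium state
  satisfies n P \<le> H_n + E_n for every n without error term, and the lower Gibbs bound of \<mu>
  turns this into bounded relative entropy. Absolute continuity is then enough, because the
  correlations of an invariant density do not change with time. Entropy is a supremum over all
  finite partitions, so the first-symbol partition has to be shown to attain it.\<close>

lemma fekete:
  fixes a :: "nat \<Rightarrow> real"
  assumes sub: "\<And>m n. a (m + n) \<le> a m + a n" and bd: "\<And>n. n \<ge> 1 \<Longrightarrow> b \<le> a n / real n"
  obtains L where "(\<lambda>n. a n / real n) \<longlonglongrightarrow> L" "\<And>n. real n * L \<le> a n"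
proof -
  define S where "S = (\<lambda>n. a n / real n) ` {1..}"
  define L where "L = Inf S"
  have bdd: "bdd_below S" using bd by (auto simp: S_def bdd_below_def)
  have ne: "S \<noteq> {}" by (auto simp: S_def)
  have L_le: "L \<le> a n / real n" if "n \<ge> 1" for n
    unfolding L_def by (rule cInf_lower[OF _ bdd]) (use that in \<open>auto simp: S_def\<close>)
  have a0: "a 0 \<ge> 0" using sub[of 0 0] by simp
  have mult: "a (q * m + r) \<le> real q * a m + a r" for q m r
  proof (induction q)
    case (Suc q)
    then show ?case using sub[of m "q * m + r"] by (simp add: algebra_simps)
  qed simp
  have "(\<lambda>n. a n / real n) \<longlonglongrightarrow> L"
  proof (rule LIMSEQ_I)
    fix e :: real assume "e > 0"
    have "Inf S < L + e / 2" using \<open>e > 0\<close> by (simp add: L_def)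
    then obtain m where m: "m \<ge> 1" "a m / real m < L + e / 2"
      using cInf_lessD[OF ne] by (force simp: S_def)
    define x where "x = a m / real m"
    \<comment> \<open>The cost of the incomplete last block: \<open>K\<close> dominates a r - r x
      for every remainder r < m, independently of n.\<close>
    define K where "K = (\<Sum>r<m. \<bar>a r\<bar>) + real m * \<bar>x\<bar>"
    obtain N where N: "real N > K / (e / 2)" using reals_Archimedean2 by blast
    have "norm (a n / real n - L) < e" if n: "n \<ge> max 1 N" for n
    proof -
      define q r where "q = n div m" and "r = n mod m"
      have nqr: "n = q * m + r" and r: "r < m" using m by (auto simp: q_def r_def)
      have "a r \<le> (\<Sum>r<m. \<bar>a r\<bar>)"
        using member_le_sum[of r "{..<m}" "\<lambda>r. \<bar>a r\<bar>"] r by simp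
      moreover have "real q * a m = real n * x - real r * x"
        using m by (simp add: x_def nqr field_simps)
      moreover have "- (real r * x) \<le> real m * \<bar>x\<bar>"
      proof -
        have "- (real r * x) \<le> real r * \<bar>x\<bar>" using abs_ge_minus_self[of "real r * x"] by (simp add: abs_mult)
        also have "\<dots> \<le> real m * \<bar>x\<bar>" using r by (intro mult_right_mono) auto
        finally show ?thesis .
      qed
      ultimately have "a n \<le> real n * x + K"
        using mult[of q m r] unfolding K_def nqr[symmetric] by linarith
      moreover have "K < e / 2 * real n"
      proof -
        have "K < e / 2 * real N" using N \<open>e > 0\<close> by (simp add: field_simps)
        also have "\<dots> \<le> e / 2 * real n" using n \<open>e > 0\<close> by (intro mult_left_mono) auto
        finally show ?thesis .
      qed
      moreover have "real n * x \<le> real n * (L + e / 2)" using m by (intro mult_left_mono) (auto simp: x_def)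
      ultimately have "a n < real n * (L + e)" by (simp add: algebra_simps)
      then have "a n / real n < L + e" using n by (simp add: field_simps)
      then show ?thesis using L_le[of n] n by auto
    qed
    then show "\<exists>N. \<forall>n\<ge>N. norm (a n / real n - L) < e" by blast
  qed
  moreover have "real n * L \<le> a n" for n
    using L_le[of n] a0 by (cases "n = 0") (auto simp: field_simps)
  ultimately show thesis by (rule that)
qed

section \<open>The function - x ln x and strong subadditivity for finite arrays\<close>

definition eta :: "real \<Rightarrow> real" where "eta x = - (x * ln x)"

lemma eta_0 [simp]: "eta 0 = 0" by (simp add: eta_def)

lemma eta_nonneg: "0 \<le> x \<Longrightarrow> x \<le> 1 \<Longrightarrow> 0 \<le> eta x"
  by (cases "x = 0") (auto simp: eta_def mult_le_0_iff)

text \<open>Only the point 0 needs care: \<open>ln\<close> is unbounded there, but x ln x tends to 0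
  from the right, and nonnegativity of \<open>f\<close> keeps the approach on that side.\<close>

lemma eta_tendsto:
  assumes "(f \<longlongrightarrow> x) F" "x \<ge> 0" "\<And>i. f i \<ge> 0"
  shows "((\<lambda>i. eta (f i)) \<longlongrightarrow> eta x) F"
proof (cases "x = 0")
  case False
  then show ?thesis using assms unfolding eta_def by (intro tendsto_intros) auto
next
  case True
  have "((\<lambda>x::real. x * ln x) \<longlongrightarrow> 0) (at_right 0)" by real_asymp
  then have "((\<lambda>x::real. - (x * ln x)) \<longlongrightarrow> 0) (at_right 0)"
    using tendsto_minus by fastforce
  then have "(eta \<longlongrightarrow> eta 0) (at 0 within {0..})"
    unfolding eta_def[abs_def] by (simp add: at_within_Ici_at_right)
  then have "continuous (at 0 within {0..}) eta" by (simp add: continuous_within)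
  from continuous_within_tendsto_compose'[OF this, of f F] show ?thesis
    using True assms by simp
qed

text \<open>Each atom is at most the total, so replacing every \<open>ln (p i)\<close> by the
  logarithm of the total can only raise the sum of p ln p. Hence merging atoms never increases
  entropy.\<close>

lemma eta_sum_le:
  assumes "finite S" "\<And>i. i \<in> S \<Longrightarrow> 0 \<le> p i"
  shows "eta (sum p S) \<le> (\<Sum>i\<in>S. eta (p i))"
proof -
  have "p i * ln (p i) \<le> p i * ln (sum p S)" if "i \<in> S" for i
  proof (cases "p i = 0")
    case False
    then have "p i > 0" using assms(2)[OF that] by simp
    moreover have "p i \<le> sum p S" by (rule member_le_sum) (use that assms in auto)
    ultimately show ?thesis by (intro mult_left_mono) auto
  qed simp
  then have "(\<Sum>i\<in>S. p i * ln (p i)) \<le> (\<Sum>i\<in>S. p i * ln (sum p S))" by (rule sum_mono)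
  then show ?thesis by (simp add: eta_def sum_negf sum_distrib_right)
qed

text \<open>Strong subadditivity H(a,b,c) + H(c) \<le> H(a,c) + H(b,c). For fixed z it says that the
  relative entropy of p with respect to pac pbc / pc, an array of the same total mass, is
  nonnegative; the pointwise source is ln t \<le> t - 1.\<close>

lemma eta_ssa:
  fixes p :: "'a \<Rightarrow> 'b \<Rightarrow> 'c \<Rightarrow> real"
  assumes fin: "finite A" "finite B" "finite C" and p: "\<And>x y z. 0 \<le> p x y z"
  defines "pac \<equiv> \<lambda>x z. \<Sum>y\<in>B. p x y z"
    and "pbc \<equiv> \<lambda>y z. \<Sum>x\<in>A. p x y z"
    and "pc \<equiv> \<lambda>z. \<Sum>x\<in>A. \<Sum>y\<in>B. p x y z"
  shows "(\<Sum>z\<in>C. \<Sum>x\<in>A. \<Sum>y\<in>B. eta (p x y z)) + (\<Sum>z\<in>C. eta (pc z))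
    \<le> (\<Sum>z\<in>C. \<Sum>x\<in>A. eta (pac x z)) + (\<Sum>z\<in>C. \<Sum>y\<in>B. eta (pbc y z))"
proof -
  have "(\<Sum>x\<in>A. \<Sum>y\<in>B. eta (p x y z)) + eta (pc z)
      \<le> (\<Sum>x\<in>A. eta (pac x z)) + (\<Sum>y\<in>B. eta (pbc y z))" for z
  proof -
    have nn: "0 \<le> pac x z" "0 \<le> pbc y z" "0 \<le> pc z" for x y
      by (auto simp: pac_def pbc_def pc_def intro!: sum_nonneg p)
    have key: "p x y z - pac x z * pbc y z / pc z \<le>
        p x y z * ln (p x y z) + p x y z * ln (pc z) - p x y z * ln (pac x z) - p x y z * ln (pbc y z)"
      if xy: "x \<in> A" "y \<in> B" for x y
    proof (cases "p x y z = 0")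
      case True
      then show ?thesis using nn by simp
    next
      case False
      then have pos: "p x y z > 0" using p[of x y z] by linarith
      have "p x y z \<le> pac x z" unfolding pac_def using xy by (intro member_le_sum fin p)
      moreover have "p x y z \<le> pbc y z" unfolding pbc_def using xy
        by (intro member_le_sum[where f = "\<lambda>x. p x y z"] fin p)
      moreover have "pac x z \<le> pc z" unfolding pc_def pac_def using xy
        by (intro member_le_sum[where f = "\<lambda>x. \<Sum>y\<in>B. p x y z"] fin sum_nonneg p)
      ultimately have pos': "pac x z > 0" "pbc y z > 0" "pc z > 0" using pos by linarith+
      have "ln (pac x z * pbc y z / (pc z * p x y z)) \<le> pac x z * pbc y z / (pc z * p x y z) - 1"
        using pos pos' by (intro ln_le_minus_one) auto
      then have "p x y z * (ln (pac x z) + ln (pbc y z) - ln (pc z) - ln (p x y z))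
          \<le> p x y z * (pac x z * pbc y z / (pc z * p x y z) - 1)"
        using pos pos' by (intro mult_left_mono) (auto simp: ln_mult ln_div)
      also have "\<dots> = pac x z * pbc y z / pc z - p x y z"
        using pos by (simp add: field_simps)
      finally show ?thesis by (simp add: algebra_simps)
    qed
    have sumB: "(\<Sum>y\<in>B. pbc y z) = pc z" unfolding pbc_def pc_def by (rule sum.swap)
    \<comment> \<open>This covers pc z = 0 as well, since division by 0 gives 0.\<close>
    have "0 = pc z - pc z * pc z / pc z" by simp
    also have "\<dots> = (\<Sum>x\<in>A. \<Sum>y\<in>B. p x y z - pac x z * pbc y z / pc z)"
    proof -
      have "(\<Sum>x\<in>A. \<Sum>y\<in>B. pac x z * pbc y z / pc z) = (\<Sum>x\<in>A. pac x z) * (\<Sum>y\<in>B. pbc y z) / pc z"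
        by (simp add: sum_product sum_divide_distrib)
      also have "(\<Sum>x\<in>A. pac x z) = pc z" by (simp add: pac_def pc_def)
      moreover have "(\<Sum>x\<in>A. \<Sum>y\<in>B. p x y z) = pc z" by (simp add: pc_def)
      ultimately show ?thesis unfolding sumB by (simp add: sum_subtractf)
    qed
    also have "\<dots> \<le> (\<Sum>x\<in>A. \<Sum>y\<in>B. p x y z * ln (p x y z) + p x y z * ln (pc z)
        - p x y z * ln (pac x z) - p x y z * ln (pbc y z))"
      by (intro sum_mono key)
    also have "\<dots> = - (\<Sum>x\<in>A. \<Sum>y\<in>B. eta (p x y z)) + pc z * ln (pc z)
        - (\<Sum>x\<in>A. pac x z * ln (pac x z)) - (\<Sum>x\<in>A. \<Sum>y\<in>B. p x y z * ln (pbc y z))"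
      by (simp add: sum_subtractf sum.distrib eta_def sum_negf sum_distrib_right pac_def pc_def)
    also have "(\<Sum>x\<in>A. \<Sum>y\<in>B. p x y z * ln (pbc y z)) = (\<Sum>y\<in>B. pbc y z * ln (pbc y z))"
      by (subst sum.swap) (simp add: pbc_def sum_distrib_right)
    finally show ?thesis by (simp add: eta_def sum_negf)
  qed
  then have "(\<Sum>z\<in>C. (\<Sum>x\<in>A. \<Sum>y\<in>B. eta (p x y z)) + eta (pc z))
    \<le> (\<Sum>z\<in>C. (\<Sum>x\<in>A. eta (pac x z)) + (\<Sum>y\<in>B. eta (pbc y z)))" by (rule sum_mono)
  then show ?thesis by (simp add: sum.distrib)
qed

section \<open>Entropy of finite-valued maps on a probability space\<close>

definition law :: "'a measure \<Rightarrow> ('a \<Rightarrow> 'b) \<Rightarrow> 'b \<Rightarrow> real" where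
  "law M f v = measure M (f -` {v} \<inter> space M)"

text \<open>Partitions are represented by labelling maps: a join becomes a tuple of labels, a
  coarser partition a function of the label, and every entropy a finite sum.\<close>

definition ent :: "'a measure \<Rightarrow> ('a \<Rightarrow> 'b) \<Rightarrow> real" where
  "ent M f = (\<Sum>v\<in>f ` space M. eta (law M f v))"

lemma law_nonneg [simp]: "0 \<le> law M f v" by (simp add: law_def)

lemma law_outside: "v \<notin> f ` space M \<Longrightarrow> law M f v = 0"
proof -
  assume "v \<notin> f ` space M"
  then have "f -` {v} \<inter> space M = {}" by auto
  then show ?thesis by (simp add: law_def)
qed

lemma ent_superset:
  assumes "finite S" "f ` space M \<subseteq> S"
  shows "ent M f = (\<Sum>v\<in>S. eta (law M f v))"
  unfolding ent_def by (rule sum.mono_neutral_left) (use assms law_outside in fastforce)+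

context prob_space
begin

lemma law_le_1: "law M f v \<le> 1" by (simp add: law_def)

lemma ent_nonneg: "0 \<le> ent M f"
  unfolding ent_def by (intro sum_nonneg eta_nonneg law_nonneg law_le_1)

lemma law_compose:
  assumes f: "simple_function M f" and S: "finite S" "f ` space M \<subseteq> S"
    and g: "\<And>x. x \<in> space M \<Longrightarrow> g x = j (f x)"
  shows "law M g v = (\<Sum>u | u \<in> S \<and> j u = v. law M f u)"
proof -
  have "g -` {v} \<inter> space M = (\<Union>u\<in>{u\<in>S. j u = v}. f -` {u} \<inter> space M)"
    using S g by auto
  then have "law M g v = measure M (\<Union>u\<in>{u\<in>S. j u = v}. f -` {u} \<inter> space M)"
    by (simp add: law_def)
  also have "\<dots> = (\<Sum>u\<in>{u\<in>S. j u = v}. measure M (f -` {u} \<inter> space M))"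
    using S f by (intro finite_measure_finite_Union) (auto simp: disjoint_family_on_def simple_functionD)
  finally show ?thesis by (simp add: law_def)
qed

lemma ent_factor:
  assumes f: "simple_function M f" and g: "\<And>x. x \<in> space M \<Longrightarrow> g x = j (f x)"
  shows "ent M g \<le> ent M f"
proof -
  define S where "S = f ` space M"
  have S: "finite S" "f ` space M \<subseteq> S" using f by (auto simp: S_def simple_functionD)
  have "ent M g = (\<Sum>v\<in>j ` S. eta (law M g v))"
    by (rule ent_superset) (use S g in \<open>auto simp: S_def\<close>)
  also have "\<dots> \<le> (\<Sum>v\<in>j ` S. \<Sum>u | u \<in> S \<and> j u = v. eta (law M f u))"
    by (intro sum_mono, subst law_compose[where j = j and f = f, OF f S g]) (auto intro!: eta_sum_le S)
  also have "\<dots> = (\<Sum>u\<in>S. eta (law M f u))"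
    by (rule sum.image_gen[symmetric, OF S(1)])
  finally show ?thesis by (simp add: ent_def S_def)
qed

lemma ent_ssa:
  assumes a: "simple_function M a" and b: "simple_function M b" and c: "simple_function M c"
  shows "ent M (\<lambda>x. (a x, b x, c x)) + ent M c \<le> ent M (\<lambda>x. (a x, c x)) + ent M (\<lambda>x. (b x, c x))"
proof -
  define A B C where "A = a ` space M" and "B = b ` space M" and "C = c ` space M"
  have fin: "finite A" "finite B" "finite C"
    using a b c by (auto simp: A_def B_def C_def simple_functionD)
  define abc where "abc = (\<lambda>x. (a x, b x, c x))"
  have abc: "simple_function M abc" unfolding abc_def using a b c by (intro simple_function_Pair)
  have S: "finite (A \<times> B \<times> C)" "abc ` space M \<subseteq> A \<times> B \<times> C"
    using fin by (auto simp: abc_def A_def B_def C_def)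
  define p where "p x y z = law M abc (x, y, z)" for x y z
  have lac: "law M (\<lambda>x. (a x, c x)) (x, z) = (\<Sum>y\<in>B. p x y z)" if "x \<in> A" "z \<in> C" for x z
  proof -
    have "law M (\<lambda>x. (a x, c x)) (x, z) =
        (\<Sum>u | u \<in> A \<times> B \<times> C \<and> (\<lambda>(x, y, z). (x, z)) u = (x, z). law M abc u)"
      by (rule law_compose[OF abc S]) (simp add: abc_def)
    also have "\<dots> = (\<Sum>y\<in>B. p x y z)" unfolding p_def
      by (rule sum.reindex_bij_witness[where i = "\<lambda>y. (x, y, z)" and j = "\<lambda>(x, y, z). y"]) (use that in auto)
    finally show ?thesis .
  qed
  have lbc: "law M (\<lambda>x. (b x, c x)) (y, z) = (\<Sum>x\<in>A. p x y z)" if "y \<in> B" "z \<in> C" for y z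
  proof -
    have "law M (\<lambda>x. (b x, c x)) (y, z) =
        (\<Sum>u | u \<in> A \<times> B \<times> C \<and> (\<lambda>(x, y, z). (y, z)) u = (y, z). law M abc u)"
      by (rule law_compose[OF abc S]) (simp add: abc_def)
    also have "\<dots> = (\<Sum>x\<in>A. p x y z)" unfolding p_def
      by (rule sum.reindex_bij_witness[where i = "\<lambda>x. (x, y, z)" and j = "\<lambda>(x, y, z). x"]) (use that in auto)
    finally show ?thesis .
  qed
  have lc: "law M c z = (\<Sum>x\<in>A. \<Sum>y\<in>B. p x y z)" if "z \<in> C" for z
  proof -
    have "law M c z = (\<Sum>u | u \<in> A \<times> B \<times> C \<and> (\<lambda>(x, y, z). z) u = z. law M abc u)"
      by (rule law_compose[OF abc S]) (simp add: abc_def)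
    also have "\<dots> = (\<Sum>(x, y)\<in>A \<times> B. p x y z)" unfolding p_def
      by (rule sum.reindex_bij_witness[where i = "\<lambda>(x, y). (x, y, z)" and j = "\<lambda>(x, y, z). (x, y)"])
        (use that in auto)
    finally show ?thesis by (simp add: sum.cartesian_product)
  qed
  have "ent M abc = (\<Sum>u\<in>A \<times> B \<times> C. eta (law M abc u))" by (rule ent_superset[OF S])
  also have "\<dots> = (\<Sum>(z, x, y)\<in>C \<times> A \<times> B. eta (p x y z))" unfolding p_def
    by (rule sum.reindex_bij_witness[where i = "\<lambda>(z, x, y). (x, y, z)" and j = "\<lambda>(x, y, z). (z, x, y)"]) auto
  finally have 1: "ent M abc = (\<Sum>z\<in>C. \<Sum>x\<in>A. \<Sum>y\<in>B. eta (p x y z))"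
    by (simp add: sum.cartesian_product)
  have "ent M (\<lambda>x. (a x, c x)) = (\<Sum>u\<in>A \<times> C. eta (law M (\<lambda>x. (a x, c x)) u))"
    by (rule ent_superset) (use fin in \<open>auto simp: A_def C_def\<close>)
  also have "\<dots> = (\<Sum>x\<in>A. \<Sum>z\<in>C. eta (\<Sum>y\<in>B. p x y z))"
    by (simp add: sum.cartesian_product' lac cong: sum.cong)
  also have "\<dots> = (\<Sum>z\<in>C. \<Sum>x\<in>A. eta (\<Sum>y\<in>B. p x y z))" by (rule sum.swap)
  finally have 2: "ent M (\<lambda>x. (a x, c x)) = \<dots>" .
  have "ent M (\<lambda>x. (b x, c x)) = (\<Sum>u\<in>B \<times> C. eta (law M (\<lambda>x. (b x, c x)) u))"
    by (rule ent_superset) (use fin in \<open>auto simp: B_def C_def\<close>)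
  also have "\<dots> = (\<Sum>y\<in>B. \<Sum>z\<in>C. eta (\<Sum>x\<in>A. p x y z))"
    by (simp add: sum.cartesian_product' lbc cong: sum.cong)
  also have "\<dots> = (\<Sum>z\<in>C. \<Sum>y\<in>B. eta (\<Sum>x\<in>A. p x y z))" by (rule sum.swap)
  finally have 3: "ent M (\<lambda>x. (b x, c x)) = \<dots>" .
  have "ent M c = (\<Sum>z\<in>C. eta (law M c z))" by (simp add: ent_def C_def)
  also have "\<dots> = (\<Sum>z\<in>C. eta (\<Sum>x\<in>A. \<Sum>y\<in>B. p x y z))"
    by (intro sum.cong) (auto simp: lc)
  finally have 4: "ent M c = \<dots>" .
  show ?thesis
    using eta_ssa[OF fin, of p] unfolding abc_def[symmetric] 1 2 3 4 by (simp add: p_def)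
qed

text \<open>Strong subadditivity with the constant \<open>()\<close> as common component, which
  contributes no entropy.\<close>

lemma ent_subadd:
  assumes a: "simple_function M a" and b: "simple_function M b"
  shows "ent M (\<lambda>x. (a x, b x)) \<le> ent M a + ent M b"
proof -
  have "ent M (\<lambda>x. (a x, b x)) \<le> ent M (\<lambda>x. (a x, b x, ()))"
    by (rule ent_factor[where j = "\<lambda>(x, y, z). (x, y)"]) (use a b in \<open>auto intro!: simple_function_Pair\<close>)
  also have "\<dots> \<le> ent M (\<lambda>x. (a x, ())) + ent M (\<lambda>x. (b x, ()))"
    using ent_ssa[OF a b, of "\<lambda>_. ()"] ent_nonneg[of "\<lambda>_. ()"] by simp
  also have "ent M (\<lambda>x. (a x, ())) \<le> ent M a" by (rule ent_factor[OF a, of _ "\<lambda>x. (x, ())"]) simp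
  also have "ent M (\<lambda>x. (b x, ())) \<le> ent M b" by (rule ent_factor[OF b, of _ "\<lambda>x. (x, ())"]) simp
  finally show ?thesis by simp
qed

text \<open>Both sides are conditional entropies of \<open>f\<close>. Appending \<open>g\<close> to
  \<open>c\<close> adds no information, so strong subadditivity with \<open>g\<close> as common
  component shows that the finer condition leaves less uncertainty.\<close>

lemma cond_ent_factor:
  assumes f: "simple_function M f" and c: "simple_function M c"
    and g: "\<And>x. x \<in> space M \<Longrightarrow> g x = j (c x)"
  shows "ent M (\<lambda>x. (f x, c x)) - ent M c \<le> ent M (\<lambda>x. (f x, g x)) - ent M g"
proof -
  have gs: "simple_function M g"
    using simple_function_compose1[OF c, of j] g simple_function_cong by (metis (no_types, lifting))
  have "ent M (\<lambda>x. (f x, c x)) \<le> ent M (\<lambda>x. (f x, c x, g x))"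
    by (rule ent_factor[where j = "\<lambda>(x, y, z). (x, y)"]) (use f c gs in \<open>auto intro!: simple_function_Pair\<close>)
  moreover have "ent M (\<lambda>x. (c x, g x)) \<le> ent M c"
    by (rule ent_factor[OF c, where j = "\<lambda>x. (x, j x)"]) (simp add: g)
  ultimately show ?thesis using ent_ssa[OF f c gs] by linarith
qed

lemma law_close:
  assumes a: "simple_function M a" and b: "simple_function M b" and E: "E \<in> events"
    and *: "\<And>x. x \<in> space M - E \<Longrightarrow> a x = u \<longleftrightarrow> b x = w"
  shows "\<bar>law M a u - law M b w\<bar> \<le> prob E"
proof -
  have m: "a -` {u} \<inter> space M \<in> events" "b -` {w} \<inter> space M \<in> events"
    using a b simple_functionD by blast+
  have "prob (a -` {u} \<inter> space M) \<le> prob (b -` {w} \<inter> space M \<union> E)"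
    using m E * by (intro finite_measure_mono) auto
  also have "\<dots> \<le> prob (b -` {w} \<inter> space M) + prob E"
    using m E by (intro measure_Un_le) auto
  finally have 1: "law M a u - law M b w \<le> prob E" by (simp add: law_def)
  have "prob (b -` {w} \<inter> space M) \<le> prob (a -` {u} \<inter> space M \<union> E)"
    using m E * by (intro finite_measure_mono) auto
  also have "\<dots> \<le> prob (a -` {u} \<inter> space M) + prob E"
    using m E by (intro measure_Un_le) auto
  finally show ?thesis using 1 by (simp add: law_def abs_le_iff)
qed

text \<open>The conditional entropy of \<open>f\<close> given \<open>g n\<close> depends
  continuously on finitely many probabilities. In the limit the joint law lives on the diagonal,
  where joint and marginal entropy coincide.\<close>

lemma cond_ent_tendsto_0:
  assumes f: "simple_function M f" and g: "\<And>n::nat. simple_function M (g n)"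
    and V: "finite V" "f ` space M \<subseteq> V" "\<And>n. g n ` space M \<subseteq> V"
    and lim: "(\<lambda>n. prob {x \<in> space M. f x \<noteq> g n x}) \<longlonglongrightarrow> 0"
  shows "(\<lambda>n. ent M (\<lambda>x. (f x, g n x)) - ent M (g n)) \<longlonglongrightarrow> 0"
proof -
  have pair: "simple_function M (\<lambda>x. (f x, g n x))" for n using f g by (rule simple_function_Pair)
  have ne: "{x \<in> space M. f x \<noteq> g n x} \<in> events" for n
  proof -
    have "{x \<in> space M. f x \<noteq> g n x} = (\<lambda>x. (f x, g n x)) -` {(u, v). u \<noteq> v} \<inter> space M" by auto
    then show ?thesis using simple_functionD(2)[OF pair, of n "{(u, v). u \<noteq> v}"] by argo
  qed
  have lg: "(\<lambda>n. law M (g n) v) \<longlonglongrightarrow> law M f v" for v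
    by (rule Lim_null_comparison[OF _ lim, THEN Lim_null[THEN iffD2]])
      (use law_close[OF g f ne] in auto)
  have lp: "(\<lambda>n. law M (\<lambda>x. (f x, g n x)) (u, v)) \<longlonglongrightarrow> (if u = v then law M f v else 0)" for u v
  proof (cases "u = v")
    case True
    show ?thesis
      by (rule Lim_null_comparison[OF _ lim, THEN Lim_null[THEN iffD2]])
        (use law_close[OF pair f ne, where u = "(u, v)" and w = v] True in auto)
  next
    case False
    then have "law M (\<lambda>x. (f x, g n x)) (u, v) \<le> prob {x \<in> space M. f x \<noteq> g n x}" for n
      unfolding law_def using ne[of n] by (intro finite_measure_mono) auto
    then have "(\<lambda>n. law M (\<lambda>x. (f x, g n x)) (u, v)) \<longlonglongrightarrow> 0"
      by (intro Lim_null_comparison[OF _ lim]) auto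
    then show ?thesis using False by simp
  qed
  have "(\<lambda>n. (\<Sum>u\<in>V. \<Sum>v\<in>V. eta (law M (\<lambda>x. (f x, g n x)) (u, v))) - (\<Sum>v\<in>V. eta (law M (g n) v)))
    \<longlonglongrightarrow> (\<Sum>u\<in>V. \<Sum>v\<in>V. eta (if u = v then law M f v else 0)) - (\<Sum>v\<in>V. eta (law M f v))"
    by (intro tendsto_diff tendsto_sum eta_tendsto lg lp) auto
  also have "(\<Sum>u\<in>V. \<Sum>v\<in>V. eta (if u = v then law M f v else 0)) = (\<Sum>v\<in>V. eta (law M f v))"
    using V(1) by (simp add: if_distrib[of eta] sum.delta cong: if_cong)
  finally have "(\<lambda>n. (\<Sum>u\<in>V. \<Sum>v\<in>V. eta (law M (\<lambda>x. (f x, g n x)) (u, v)))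
      - (\<Sum>v\<in>V. eta (law M (g n) v))) \<longlonglongrightarrow> 0"
    by simp
  moreover have "ent M (\<lambda>x. (f x, g n x)) = (\<Sum>u\<in>V. \<Sum>v\<in>V. eta (law M (\<lambda>x. (f x, g n x)) (u, v)))" for n
    using V by (subst ent_superset[of "V \<times> V"]) (auto simp: sum.cartesian_product' image_subset_iff)
  moreover have "ent M (g n) = (\<Sum>v\<in>V. eta (law M (g n) v))" for n
    using V by (intro ent_superset) auto
  ultimately show ?thesis by simp
qed

end

section \<open>The Kolmogorov--Sinai theorem\<close>

lemma measurable_funpow [measurable (raw)]:
  "T \<in> measurable M M \<Longrightarrow> T ^^ n \<in> measurable M M"
  by (induction n) (auto simp: id_def intro: measurable_comp)

locale prob_preserving = prob_space M for M :: "'a measure" +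
  fixes T :: "'a \<Rightarrow> 'a"
  assumes pres: "measure_preserving M T"
begin

lemma T_meas [measurable]: "T \<in> measurable M M"
  using pres by (simp add: measure_preserving_def)

lemma Tn_meas [measurable]: "T ^^ n \<in> measurable M M"
  by (rule measurable_funpow) (rule T_meas)

lemma Tn_space: "x \<in> space M \<Longrightarrow> (T ^^ n) x \<in> space M"
  using measurable_space[OF Tn_meas] .

lemma distr_Tn: "distr M M (T ^^ n) = M"
proof (induction n)
  case (Suc n)
  have "distr M M (T ^^ Suc n) = distr (distr M M (T ^^ n)) M T"
    by (subst distr_distr) (auto simp: comp_def)
  then show ?case using Suc pres by (simp add: measure_preserving_def comp_def)
qed (simp add: id_def distr_id)

lemma prob_Tn:
  assumes "B \<in> events"
  shows "prob ((T ^^ n) -` B \<inter> space M) = prob B"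
  using measure_distr[OF Tn_meas assms, of n] by (simp add: distr_Tn)

end

section \<open>Itineraries and finite partitions\<close>

definition itin :: "('a \<Rightarrow> 'a) \<Rightarrow> ('a \<Rightarrow> 'b) \<Rightarrow> nat \<Rightarrow> 'a \<Rightarrow> 'b list" where
  "itin T f n x = map (\<lambda>i. f ((T ^^ i) x)) [0..<n]"

lemma itin_eq_iff: "itin T f n x = itin T f n y \<longleftrightarrow> (\<forall>i<n. f ((T ^^ i) x) = f ((T ^^ i) y))"
  by (auto simp: itin_def)

lemma itin_0: "itin T f 0 x = []"
  by (simp add: itin_def)

lemma itin_add: "itin T f (m + n) x = itin T f m x @ itin T f n ((T ^^ m) x)"
  by (auto simp: itin_def nth_append funpow_add add.commute[of m] intro!: nth_equalityI)
    (metis comp_apply funpow_add le_add_diff_inverse2 not_less)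

lemma itin_take: "m \<le> n \<Longrightarrow> take m (itin T f n x) = itin T f m x"
  by (auto simp: itin_def intro!: nth_equalityI)

text \<open>Indexing over the image excludes empty fibres. This keeps the labelling of atoms
  injective and matches the removal of the empty set in \<open>iterated_join\<close>.\<close>

definition fibers :: "'a measure \<Rightarrow> ('a \<Rightarrow> 'b) \<Rightarrow> 'a set set" where
  "fibers M f = (\<lambda>v. f -` {v} \<inter> space M) ` f ` space M"

lemma partition_entropy_fibers: "partition_entropy M (fibers M f) = ent M f"
proof -
  have inj: "inj_on (\<lambda>v. f -` {v} \<inter> space M) (f ` space M)"
    by (rule inj_onI) auto
  show ?thesis
    unfolding partition_entropy_def fibers_def ent_def law_def
    by (subst sum.reindex[OF inj]) (simp add: eta_def sum_negf)
qed

lemma finite_partition_fibers: "simple_function M f \<Longrightarrow> finite_partition M (fibers M f)"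
  unfolding finite_partition_def fibers_def partition_on_def disjoint_def
  by (auto simp: simple_functionD)

text \<open>Each point is labelled with the atom that contains it, so labels of type
  \<open>'a set\<close> reach every finite partition.\<close>

lemma finite_partition_imp_fibers:
  assumes "finite_partition M P"
  obtains f :: "'a \<Rightarrow> 'a set" where "simple_function M f" "P = fibers M f"
proof -
  define f where "f x = (THE A. A \<in> P \<and> x \<in> A)" for x
  have P: "finite P" "P \<subseteq> sets M" "partition_on (space M) P"
    using assms by (auto simp: finite_partition_def)
  have f_eq: "f x = A" if "A \<in> P" "x \<in> A" for x A
    unfolding f_def using that partition_onD2[OF P(3)]
    by (intro the_equality) (auto simp: disjoint_def)
  have sp: "space M = \<Union>P" using partition_onD1[OF P(3)] by simp
  have fib: "f -` {A} \<inter> space M = A" if "A \<in> P" for A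
    using f_eq that sp by auto
  have im: "f ` space M = P"
  proof
    show "f ` space M \<subseteq> P" using f_eq sp by auto
    show "P \<subseteq> f ` space M"
    proof
      fix A assume A: "A \<in> P"
      then obtain x where "x \<in> A" using partition_onD3[OF P(3)] by fastforce
      then show "A \<in> f ` space M" using f_eq A sp by blast
    qed
  qed
  have "simple_function M f" unfolding simple_function_def using im P fib by auto
  moreover have "P = fibers M f" unfolding fibers_def im using fib by auto
  ultimately show thesis by (rule that)
qed

context prob_preserving
begin

lemma simple_Tn: "simple_function M f \<Longrightarrow> simple_function M (\<lambda>x. f ((T ^^ n) x))"
proof -
  assume f: "simple_function M f"
  have "finite ((\<lambda>x. f ((T ^^ n) x)) ` space M)"
    by (rule finite_subset[OF _ simple_functionD(1)[OF f]]) (auto simp: Tn_space)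
  moreover have "(\<lambda>x. f ((T ^^ n) x)) -` {v} \<inter> space M \<in> events" for v
  proof -
    have "(\<lambda>x. f ((T ^^ n) x)) -` {v} \<inter> space M = (T ^^ n) -` (f -` {v} \<inter> space M) \<inter> space M"
      by (auto simp: Tn_space)
    also have "\<dots> \<in> events" by (rule measurable_sets[OF Tn_meas]) (rule simple_functionD(2)[OF f])
    finally show ?thesis .
  qed
  ultimately show ?thesis by (simp add: simple_function_def)
qed

lemma simple_itin: "simple_function M f \<Longrightarrow> simple_function M (itin T f n)"
proof (induction n)
  case (Suc n)
  have "simple_function M (\<lambda>x. (\<lambda>(u, v). u @ [v]) (itin T f n x, f ((T ^^ n) x)))"
    using Suc by (intro simple_function_compose1[where g = "\<lambda>(u, v). u @ [v]"] simple_function_Pair simple_Tn)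
  then show ?case by (simp add: itin_def)
next
  case 0
  have "itin T f 0 = (\<lambda>_. [])" by (auto simp: itin_0)
  then show ?case by simp
qed

lemma ent_Tn:
  assumes f: "simple_function M f"
  shows "ent M (\<lambda>x. f ((T ^^ n) x)) = ent M f"
proof -
  have "law M (\<lambda>x. f ((T ^^ n) x)) v = law M f v" for v
  proof -
    have "(\<lambda>x. f ((T ^^ n) x)) -` {v} \<inter> space M = (T ^^ n) -` (f -` {v} \<inter> space M) \<inter> space M"
      by (auto simp: Tn_space)
    then show ?thesis unfolding law_def using prob_Tn[OF simple_functionD(2)[OF f]] by simp
  qed
  then show ?thesis
    using ent_superset[of "f ` space M" "\<lambda>x. f ((T ^^ n) x)" M] f
    by (simp add: ent_def simple_functionD Tn_space image_subset_iff)
qed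

lemma ent_itin_subadd:
  assumes f: "simple_function M f"
  shows "ent M (itin T f (m + n)) \<le> ent M (itin T f m) + ent M (itin T f n)"
proof -
  have "ent M (itin T f (m + n)) \<le> ent M (\<lambda>x. (itin T f m x, itin T f n ((T ^^ m) x)))"
    by (rule ent_factor[where j = "\<lambda>(u, v). u @ v"])
      (use f in \<open>auto simp: itin_add intro!: simple_function_Pair simple_Tn simple_itin\<close>)
  also have "\<dots> \<le> ent M (itin T f m) + ent M (\<lambda>x. itin T f n ((T ^^ m) x))"
    using f by (intro ent_subadd simple_Tn simple_itin)
  finally show ?thesis using f by (simp add: ent_Tn simple_itin)
qed

definition entropy_rate :: "('a \<Rightarrow> 'b) \<Rightarrow> real" where
  "entropy_rate f = lim (\<lambda>n. ent M (itin T f n) / real n)"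

lemma entropy_rate:
  assumes f: "simple_function M f"
  shows entropy_rate_tendsto: "(\<lambda>n. ent M (itin T f n) / real n) \<longlonglongrightarrow> entropy_rate f"
    and entropy_rate_le: "real n * entropy_rate f \<le> ent M (itin T f n)"
proof -
  obtain L where L: "(\<lambda>n. ent M (itin T f n) / real n) \<longlonglongrightarrow> L" "\<And>n. real n * L \<le> ent M (itin T f n)"
  proof (rule fekete[of "\<lambda>n. ent M (itin T f n)" 0])
    show "0 \<le> ent M (itin T f n) / real n" for n by (intro divide_nonneg_nonneg ent_nonneg) simp
  qed (use ent_itin_subadd[OF f] in auto)
  then have "entropy_rate f = L" unfolding entropy_rate_def by (intro limI)
  then show "(\<lambda>n. ent M (itin T f n) / real n) \<longlonglongrightarrow> entropy_rate f"
    "real n * entropy_rate f \<le> ent M (itin T f n)" using L by auto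
qed

lemma iterated_join_fibers: "iterated_join M T (fibers M f) n = fibers M (itin T f n)"
proof (intro equalityI subsetI)
  fix A assume "A \<in> iterated_join M T (fibers M f) n"
  then obtain F x where F: "A = space M \<inter> (\<Inter>i<n. (T ^^ i) -` F i)" "\<forall>i<n. F i \<in> fibers M f" and x: "x \<in> A"
    by (auto simp: iterated_join_def)
  have *: "F i = f -` {f ((T ^^ i) x)} \<inter> space M" if i: "i < n" for i
  proof -
    obtain v where v: "F i = f -` {v} \<inter> space M" using F(2) i unfolding fibers_def by blast
    moreover have "(T ^^ i) x \<in> F i" using x i F(1) by auto
    ultimately show ?thesis by auto
  qed
  have "A = itin T f n -` {itin T f n x} \<inter> space M"
    unfolding F(1) by (auto simp: itin_eq_iff * Tn_space)
  then show "A \<in> fibers M (itin T f n)" using x F(1) by (auto simp: fibers_def)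
next
  fix A assume "A \<in> fibers M (itin T f n)"
  then obtain x where x: "x \<in> space M" "A = itin T f n -` {itin T f n x} \<inter> space M"
    by (auto simp: fibers_def)
  define F where "F i = f -` {f ((T ^^ i) x)} \<inter> space M" for i
  have "A = space M \<inter> (\<Inter>i<n. (T ^^ i) -` F i)"
    unfolding x(2) by (auto simp: itin_eq_iff F_def Tn_space)
  moreover have "\<forall>i<n. F i \<in> fibers M f" by (auto simp: fibers_def F_def x Tn_space)
  moreover have "A \<noteq> {}" using x by auto
  ultimately show "A \<in> iterated_join M T (fibers M f) n" unfolding iterated_join_def by blast
qed

lemma entropy_wrt_fibers: "entropy_wrt M T (fibers M f) = entropy_rate f"
  by (simp add: entropy_wrt_def entropy_rate_def iterated_join_fibers partition_entropy_fibers)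

text \<open>At each step the joint name gains at most H(f | c) beyond the gain of the
  \<open>c\<close>-name. The earlier \<open>f\<close>-symbols do not become less certain when the
  new \<open>c\<close>-symbol is known; the new \<open>f\<close>-symbol is conditioned on the past
  and on the simultaneous \<open>c\<close>-symbol, and forgetting the past only raises its
  conditional entropy.\<close>

lemma ent_itin_cond:
  assumes f: "simple_function M f" and c: "simple_function M c"
  shows "ent M (\<lambda>x. (itin T f n x, itin T c n x)) \<le>
    ent M (itin T c n) + real n * (ent M (\<lambda>x. (f x, c x)) - ent M c)"
proof (induction n)
  case 0
  have "ent M (\<lambda>x. (itin T f 0 x, itin T c 0 x)) \<le> ent M (itin T c 0)"
    by (rule ent_factor[where j = "\<lambda>x. ([], x)"]) (use c in \<open>auto simp: itin_0 intro!: simple_itin\<close>)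
  then show ?case by simp
next
  case (Suc n)
  define d where "d = ent M (\<lambda>x. (f x, c x)) - ent M c"
  let ?F = "\<lambda>x. f ((T ^^ n) x)" and ?C = "\<lambda>x. c ((T ^^ n) x)"
  let ?P = "itin T f n" and ?Q = "itin T c n"
  note s = simple_itin[OF f, of n] simple_itin[OF c, of n] simple_Tn[OF f, of n] simple_Tn[OF c, of n]
  have FC: "ent M (\<lambda>x. (?F x, ?C x)) = ent M (\<lambda>x. (f x, c x))"
    using ent_Tn[OF simple_function_Pair[OF f c], of n] by simp
  have snoc: "itin T g (Suc n) x = itin T g n x @ [g ((T ^^ n) x)]" for g :: "'a \<Rightarrow> 'z" and x
    by (simp add: itin_def)
  have Q: "ent M (\<lambda>x. (?C x, ?Q x)) \<le> ent M (itin T c (Suc n))"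
    by (rule ent_factor[OF simple_itin[OF c], where j = "\<lambda>w. (last w, butlast w)"]) (simp add: snoc)
  have "ent M (\<lambda>x. (?P x, ?C x, ?Q x)) + ent M ?Q \<le> ent M (\<lambda>x. (?P x, ?Q x)) + ent M (\<lambda>x. (?C x, ?Q x))"
    by (rule ent_ssa[OF s(1,4,2)])
  then have 1: "ent M (\<lambda>x. (?P x, ?C x, ?Q x)) \<le> ent M (itin T c (Suc n)) + real n * d"
    using Suc Q by (simp add: d_def)
  have "ent M (\<lambda>x. (?F x, (?P x, ?Q x), ?C x)) + ent M ?C \<le>
      ent M (\<lambda>x. (?F x, ?C x)) + ent M (\<lambda>x. ((?P x, ?Q x), ?C x))"
    using s by (intro ent_ssa simple_function_Pair)
  moreover have "ent M (\<lambda>x. ((?P x, ?Q x), ?C x)) \<le> ent M (\<lambda>x. (?P x, ?C x, ?Q x))"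
    by (rule ent_factor[where j = "\<lambda>(p, c, q). ((p, q), c)"]) (use s in \<open>auto intro!: simple_function_Pair\<close>)
  moreover have "ent M (\<lambda>x. (itin T f (Suc n) x, itin T c (Suc n) x)) \<le> ent M (\<lambda>x. (?F x, (?P x, ?Q x), ?C x))"
    by (rule ent_factor[where j = "\<lambda>(u, (p, q), v). (p @ [u], q @ [v])"])
      (use s in \<open>auto simp: snoc intro!: simple_function_Pair\<close>)
  ultimately show ?case using 1 FC ent_Tn[OF c, of n] by (simp add: d_def algebra_simps)
qed

lemma entropy_rate_cond:
  assumes f: "simple_function M f" and c: "simple_function M c"
  shows "entropy_rate f \<le> entropy_rate c + (ent M (\<lambda>x. (f x, c x)) - ent M c)"
proof (rule LIMSEQ_le[OF entropy_rate_tendsto[OF f]])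
  define d where "d = ent M (\<lambda>x. (f x, c x)) - ent M c"
  show "(\<lambda>n. ent M (itin T c n) / real n + (ent M (\<lambda>x. (f x, c x)) - ent M c))
      \<longlonglongrightarrow> entropy_rate c + (ent M (\<lambda>x. (f x, c x)) - ent M c)"
    by (intro tendsto_add entropy_rate_tendsto[OF c] tendsto_const)
  have "ent M (itin T f n) / real n \<le> ent M (itin T c n) / real n + d" if "n \<ge> 1" for n
  proof -
    have "ent M (itin T f n) \<le> ent M (\<lambda>x. (itin T f n x, itin T c n x))"
      by (rule ent_factor[where j = fst]) (use f c in \<open>auto intro!: simple_function_Pair simple_itin\<close>)
    then have "ent M (itin T f n) \<le> ent M (itin T c n) + real n * d"
      using ent_itin_cond[OF f c, of n] by (simp add: d_def)
    then show ?thesis using that by (simp add: field_simps)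
  qed
  then show "\<exists>N. \<forall>n\<ge>N. ent M (itin T f n) / real n \<le>
      ent M (itin T c n) / real n + (ent M (\<lambda>x. (f x, c x)) - ent M c)"
    by (auto simp: d_def)
qed

text \<open>The n-name of k-names can be read off from the \<open>c\<close>-name of length n + k, so
  the surplus entropy is bounded in n and disappears after division.\<close>

lemma entropy_rate_itin:
  assumes c: "simple_function M c"
  shows "entropy_rate (itin T c k) \<le> entropy_rate c"
proof (rule LIMSEQ_le[OF entropy_rate_tendsto[OF simple_itin[OF c]]])
  have "(\<lambda>n. ent M (itin T c n) / real n + ent M (itin T c k) / real n) \<longlonglongrightarrow> entropy_rate c + 0"
    by (intro tendsto_add entropy_rate_tendsto[OF c] lim_const_over_n)
  then show "(\<lambda>n. ent M (itin T c n) / real n + ent M (itin T c k) / real n) \<longlonglongrightarrow> entropy_rate c"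
    by simp
  have "ent M (itin T (itin T c k) n) \<le> ent M (itin T c n) + ent M (itin T c k)" for n
  proof -
    have "ent M (itin T (itin T c k) n) \<le> ent M (itin T c (n + k))"
    proof (rule ent_factor[OF simple_itin[OF c], where j = "\<lambda>w. map (\<lambda>i. take k (drop i w)) [0..<n]"])
      fix x
      have "itin T c k ((T ^^ i) x) = take k (drop i (itin T c (n + k) x))" if "i < n" for i
      proof -
        have "itin T c (n + k) x = itin T c i x @ itin T c k ((T ^^ i) x) @ itin T c (n - i) ((T ^^ (i + k)) x)"
          using itin_add[of T c "i + k" "n - i" x] itin_add[of T c i k x] that by (simp add: add.commute)
        moreover have "length (itin T c i x) = i" "length (itin T c k ((T ^^ i) x)) = k"
          by (simp_all add: itin_def)
        ultimately show ?thesis by simp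
      qed
      then show "itin T (itin T c k) n x = map (\<lambda>i. take k (drop i (itin T c (n + k) x))) [0..<n]"
        by (subst itin_def) auto
    qed
    then show ?thesis using ent_itin_subadd[OF c, of n k] by linarith
  qed
  then show "\<exists>N. \<forall>n\<ge>N. ent M (itin T (itin T c k) n) / real n
      \<le> ent M (itin T c n) / real n + ent M (itin T c k) / real n"
    by (auto simp: add_divide_distrib[symmetric] divide_right_mono)
qed

text \<open>The generator condition is approximate: every event is close to one decided by a finite
  \<open>c\<close>-name. A finite-valued f is then close to a function g of a long name, and h(f)
  \<le> h(c) + H(f | g), where the last term can be made arbitrarily small.\<close>

theorem KS_entropy_generator:
  assumes c: "simple_function M c"
    and gen: "\<And>A e. A \<in> events \<Longrightarrow> e > 0 \<Longrightarrow>
      \<exists>k S. prob ((A - {x \<in> space M. itin T c k x \<in> S}) \<union> ({x \<in> space M. itin T c k x \<in> S} - A)) < e"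
  shows "KS_entropy M T = ereal (entropy_rate c)"
proof (rule antisym)
  show "ereal (entropy_rate c) \<le> KS_entropy M T"
    unfolding KS_entropy_def using finite_partition_fibers[OF c] entropy_wrt_fibers[of c]
    by (metis (mono_tags, lifting) SUP_upper mem_Collect_eq)
next
  have "entropy_rate f \<le> entropy_rate c" if f: "simple_function M f" for f :: "'a \<Rightarrow> 'a set"
  proof -
    define V where "V = f ` space M"
    have V: "finite V" "V \<noteq> {}" using f not_empty by (auto simp: V_def simple_functionD)
    have "\<exists>k j. (\<forall>w. j w \<in> V) \<and> prob {x \<in> space M. f x \<noteq> j (itin T c k x)} < e" if "e > 0" for e :: real
    proof -
      define r where "r = e / real (card V)"
      have "r > 0" using that V by (simp add: r_def card_gt_0_iff)
      let ?D = "\<lambda>k S. {x \<in> space M. itin T c k x \<in> S}"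
      let ?A = "\<lambda>v. f -` {v} \<inter> space M"
      have "\<forall>v. \<exists>k S. prob ((?A v - ?D k S) \<union> (?D k S - ?A v)) < r"
        by (intro allI gen simple_functionD(2)[OF f] \<open>r > 0\<close>)
      from choice[OF this] obtain k where "\<forall>v. \<exists>S. prob ((?A v - ?D (k v) S) \<union> (?D (k v) S - ?A v)) < r" ..
      from choice[OF this] obtain S where kS: "\<And>v. prob ((?A v - ?D (k v) (S v)) \<union> (?D (k v) (S v) - ?A v)) < r"
        by blast
      \<comment> \<open>The approximating names have different lengths; testing a prefix of the name
        of length \<open>K\<close> treats them all at once.\<close>
      define K where "K = Max (k ` V)"
      have K: "k v \<le> K" if "v \<in> V" for v using that V by (simp add: K_def)
      define S' where "S' v = {w. take (k v) w \<in> S v}" for v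
      have D': "?D K (S' v) = ?D (k v) (S v)" if "v \<in> V" for v
        using itin_take[OF K[OF that], of T c] by (simp add: S'_def)
      \<comment> \<open>The approximating sets may overlap or miss a name. Any claimed value is
        taken, with a default from \<open>V\<close>, so that \<open>j\<close> always maps into the
        finite set \<open>V\<close>.\<close>
      define j where "j w = (if \<exists>v\<in>V. w \<in> S' v then SOME v. v \<in> V \<and> w \<in> S' v else SOME v. v \<in> V)" for w
      have j: "j w \<in> V" for w
      proof (cases "\<exists>v\<in>V. w \<in> S' v")
        case True
        then have "\<exists>v. v \<in> V \<and> w \<in> S' v" by blast
        from someI_ex[OF this] True show ?thesis by (simp add: j_def)
      next
        case False
        then show ?thesis using V(2) by (simp add: j_def some_in_eq)
      qed
      define E where "E v = (?A v - ?D (k v) (S v)) \<union> (?D (k v) (S v) - ?A v)" for v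
      have Em: "E v \<in> events" for v
      proof -
        have "?D (k v) (S v) = itin T c (k v) -` S v \<inter> space M" by auto
        then show ?thesis
          unfolding E_def using simple_functionD(2)[OF f] simple_functionD(2)[OF simple_itin[OF c]] by auto
      qed
      \<comment> \<open>Off the error sets exactly one label claims the name, namely
        \<open>f x\<close>, and the arbitrary choice in \<open>j\<close> is forced.\<close>
      have "{x \<in> space M. f x \<noteq> j (itin T c K x)} \<subseteq> (\<Union>v\<in>V. E v)"
      proof (rule subsetI, rule ccontr)
        fix x assume x: "x \<in> {x \<in> space M. f x \<noteq> j (itin T c K x)}" and nE: "x \<notin> (\<Union>v\<in>V. E v)"
        have eq: "itin T c K x \<in> S' v \<longleftrightarrow> f x = v" if "v \<in> V" for v
        proof -
          have "x \<in> ?D K (S' v) \<longleftrightarrow> x \<in> ?A v" using nE that x unfolding E_def D'[OF that] by blast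
          then show ?thesis using x by auto
        qed
        have "f x \<in> V" using x by (auto simp: V_def)
        then have "j (itin T c K x) = (SOME v. v \<in> V \<and> itin T c K x \<in> S' v)"
          using eq by (auto simp: j_def)
        also have "\<dots> = f x" using eq \<open>f x \<in> V\<close> by (intro some_equality) auto
        finally show False using x by simp
      qed
      then have "prob {x \<in> space M. f x \<noteq> j (itin T c K x)} \<le> prob (\<Union>v\<in>V. E v)"
        using V Em by (intro finite_measure_mono) auto
      also have "\<dots> \<le> (\<Sum>v\<in>V. prob (E v))"
        using V Em by (intro finite_measure_subadditive_finite) auto
      also have "\<dots> < (\<Sum>v\<in>V. r)" using V kS by (intro sum_strict_mono) (auto simp: E_def)
      also have "\<dots> = e" using V by (simp add: r_def)
      finally show ?thesis using j by blast
    qed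
    then have "\<forall>n. \<exists>k j. (\<forall>w. j w \<in> V) \<and>
        prob {x \<in> space M. f x \<noteq> j (itin T c k x)} < inverse (real (Suc n))"
      by simp
    from choice[OF this] obtain k where "\<forall>n. \<exists>j. (\<forall>w. j w \<in> V) \<and>
        prob {x \<in> space M. f x \<noteq> j (itin T c (k n) x)} < inverse (real (Suc n))" ..
    from choice[OF this] obtain j where kj: "\<And>n w. j n w \<in> V"
      "\<And>n. prob {x \<in> space M. f x \<noteq> j n (itin T c (k n) x)} < inverse (real (Suc n))"
      by blast
    define g where "g n x = j n (itin T c (k n) x)" for n x
    have gs: "simple_function M (g n)" for n
      unfolding g_def by (rule simple_function_compose1[OF simple_itin[OF c]])
    have "norm (prob {x \<in> space M. f x \<noteq> g n x}) \<le> inverse (real (Suc n))" for n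
      using kj(2)[of n] by (simp add: g_def)
    then have "(\<lambda>n. prob {x \<in> space M. f x \<noteq> g n x}) \<longlonglongrightarrow> 0"
      by (intro Lim_null_comparison[OF _ LIMSEQ_inverse_real_of_nat] always_eventually allI)
    then have "(\<lambda>n. ent M (\<lambda>x. (f x, g n x)) - ent M (g n)) \<longlonglongrightarrow> 0"
      by (intro cond_ent_tendsto_0[OF f gs V(1)]) (auto simp: V_def[symmetric] g_def kj(1))
    then have "(\<lambda>n. entropy_rate c + (ent M (\<lambda>x. (f x, g n x)) - ent M (g n))) \<longlonglongrightarrow> entropy_rate c + 0"
      by (intro tendsto_intros)
    \<comment> \<open>The whole name of length \<open>k n\<close> is at least as informative as
      \<open>g n\<close>, and the process of such names has rate at most that of
      \<open>c\<close>.\<close>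
    moreover have "entropy_rate f \<le> entropy_rate c + (ent M (\<lambda>x. (f x, g n x)) - ent M (g n))" for n
      using entropy_rate_cond[OF f simple_itin[OF c, of "k n"]] entropy_rate_itin[OF c, of "k n"]
        cond_ent_factor[OF f simple_itin[OF c, of "k n"], of "g n" "j n"]
      by (simp add: g_def)
    ultimately show ?thesis by (intro LIMSEQ_le_const) auto
  qed
  then show "KS_entropy M T \<le> ereal (entropy_rate c)"
    unfolding KS_entropy_def
    by (intro SUP_least) (metis ereal_less_eq(3) entropy_wrt_fibers finite_partition_imp_fibers mem_Collect_eq)
qed

end

section \<open>Mixing from a lower bound\<close>

text \<open>The threshold \<open>N\<close> depends on A and e but not on B. This uniformity allows B
  to be replaced by its complement, or to be chosen after n.\<close>

locale lower_bound_mixing = prob_preserving +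
  fixes c :: real
  assumes c_pos: "c > 0"
    and lower: "\<And>A e. A \<in> sets M \<Longrightarrow> e > 0 \<Longrightarrow>
      \<exists>N. \<forall>n\<ge>N. \<forall>B\<in>sets M. c * prob A * prob B - e \<le> prob (A \<inter> (T ^^ n) -` B)"
begin

text \<open>The mass that the n-th image of the density f under the transfer operator gives to B.
  Working with these numbers avoids the operator itself.\<close>

definition corr :: "('a \<Rightarrow> real) \<Rightarrow> nat \<Rightarrow> 'a set \<Rightarrow> real" where
  "corr f n B = (\<integral>x. f x * indicator B ((T ^^ n) x) \<partial>M)"

lemma corr_integrable:
  fixes f :: "'a \<Rightarrow> real"
  assumes "integrable M f" "B \<in> sets M"
  shows "integrable M (\<lambda>x. f x * indicator B ((T ^^ n) x))"
proof -
  have [measurable]: "B \<in> sets M" "f \<in> borel_measurable M" using assms by auto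
  show ?thesis
    by (rule Bochner_Integration.integrable_bound[OF assms(1)])
      (measurable, auto simp: indicator_def)
qed

lemma corr_mono:
  assumes "integrable M f" "integrable M g" "B \<in> sets M" "\<And>x. x \<in> space M \<Longrightarrow> f x \<le> g x"
  shows "corr f n B \<le> corr g n B"
  unfolding corr_def
  by (intro integral_mono corr_integrable assms) (auto simp: indicator_def assms)

lemma corr_add:
  assumes "integrable M f" "integrable M g" "B \<in> sets M"
  shows "corr (\<lambda>x. f x + g x) n B = corr f n B + corr g n B"
  using corr_integrable[OF assms(1,3)] corr_integrable[OF assms(2,3)]
  by (simp add: corr_def algebra_simps)

lemma corr_diff:
  assumes "integrable M f" "integrable M g" "B \<in> sets M"
  shows "corr (\<lambda>x. f x - g x) n B = corr f n B - corr g n B"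
  using corr_integrable[OF assms(1,3)] corr_integrable[OF assms(2,3)]
  by (simp add: corr_def algebra_simps)

lemma corr_compl:
  assumes "integrable M f" "B \<in> sets M"
  shows "corr f n (space M - B) = integral\<^sup>L M f - corr f n B"
proof -
  have "corr f n (space M - B) = (\<integral>x. f x - f x * indicator B ((T ^^ n) x) \<partial>M)"
    unfolding corr_def
    by (intro Bochner_Integration.integral_cong)
      (auto simp: indicator_def dest: measurable_space[OF Tn_meas])
  then show ?thesis
    using corr_integrable[OF assms] assms by (simp add: corr_def)
qed

lemma corr_indicator:
  assumes "A \<in> sets M"
  shows "corr (indicator A) n B = prob (A \<inter> (T ^^ n) -` B)"
proof -
  have "corr (indicator A) n B = (\<integral>x. indicator (A \<inter> (T ^^ n) -` B) x \<partial>M)"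
    unfolding corr_def by (intro Bochner_Integration.integral_cong) (auto simp: indicator_def)
  also have "\<dots> = prob ((A \<inter> (T ^^ n) -` B) \<inter> space M)" by simp
  also have "(A \<inter> (T ^^ n) -` B) \<inter> space M = A \<inter> (T ^^ n) -` B"
    using sets.sets_into_space[OF assms] by auto
  finally show ?thesis .
qed

lemma corr_const:
  assumes "B \<in> sets M"
  shows "corr (\<lambda>_. k) n B = k * prob B"
proof -
  have *: "prob (space M \<inter> (T ^^ n) -` B) = prob B" using prob_Tn[OF assms] by (simp add: Int_commute)
  have "corr (\<lambda>_. k) n B = k * (\<integral>x. indicator B ((T ^^ n) x) \<partial>M)"
    by (simp add: corr_def)
  also have "(\<integral>x. indicator B ((T ^^ n) x) \<partial>M) = corr (indicator (space M)) n B"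
    unfolding corr_def by (intro Bochner_Integration.integral_cong) auto
  finally show ?thesis using * by (simp add: corr_indicator)
qed

text \<open>The additional iterates only replace B by a preimage, so a bound that is uniform in the
  test set at time n holds at all later times.\<close>

lemma corr_later:
  assumes "B \<in> sets M"
  obtains B' where "B' \<in> sets M" "corr f (n + k) B = corr f n B'"
proof
  show "(T ^^ k) -` B \<inter> space M \<in> sets M" using assms by measurable
  show "corr f (n + k) B = corr f n ((T ^^ k) -` B \<inter> space M)"
    unfolding corr_def
    by (intro Bochner_Integration.integral_cong)
      (auto simp: indicator_def add.commute[of n] funpow_add dest: measurable_space[OF Tn_meas[of n]])
qed

text \<open>The bound passes from indicators to densities because it is linear and stable under
  monotone limits; uniformity in B survives since \<open>prob B\<close> is at most 1.\<close>

lemma corr_lower: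
  assumes "f \<in> borel_measurable M" "\<And>x. 0 \<le> f x" "integrable M f" "e > 0"
  shows "\<exists>N. \<forall>n\<ge>N. \<forall>B\<in>sets M. c * integral\<^sup>L M f * prob B - e \<le> corr f n B"
  using assms
proof (induction arbitrary: e rule: borel_measurable_induct_real)
  case (set A)
  then show ?case using lower[of A e] by (simp add: corr_indicator)
next
  case (mult u a)
  show ?case
  proof (cases "a = 0")
    case True
    then show ?thesis using \<open>e > 0\<close> by (auto simp: corr_def)
  next
    case False
    with mult have "a > 0" by simp
    then have "integrable M u" using mult.prems by simp
    with mult.IH[of "e / a"] \<open>a > 0\<close> \<open>e > 0\<close>
    obtain N where N: "\<And>n B. n \<ge> N \<Longrightarrow> B \<in> sets M \<Longrightarrow>
        c * integral\<^sup>L M u * prob B - e / a \<le> corr u n B"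
      by auto
    have "c * integral\<^sup>L M (\<lambda>x. a * u x) * prob B - e \<le> corr (\<lambda>x. a * u x) n B"
      if "n \<ge> N" "B \<in> sets M" for n B
    proof -
      have "a * (c * integral\<^sup>L M u * prob B - e / a) \<le> a * corr u n B"
        using N[OF that] \<open>a > 0\<close> by (intro mult_left_mono) auto
      then show ?thesis
        using \<open>a > 0\<close> by (simp add: corr_def algebra_simps)
    qed
    then show ?thesis by blast
  qed
next
  case (add u v)
  have iu: "integrable M u" and iv: "integrable M v"
    by (rule Bochner_Integration.integrable_bound[OF add.prems(1)]; use add.hyps in auto)+
  have "e / 2 > 0" using \<open>e > 0\<close> by simp
  obtain N1 where N1: "\<And>n B. n \<ge> N1 \<Longrightarrow> B \<in> sets M \<Longrightarrow>
        c * integral\<^sup>L M u * prob B - e / 2 \<le> corr u n B"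
    using add.IH(1)[OF iu \<open>e / 2 > 0\<close>] by blast
  obtain N2 where N2: "\<And>n B. n \<ge> N2 \<Longrightarrow> B \<in> sets M \<Longrightarrow>
        c * integral\<^sup>L M v * prob B - e / 2 \<le> corr v n B"
    using add.IH(2)[OF iv \<open>e / 2 > 0\<close>] by blast
  have "c * integral\<^sup>L M (\<lambda>x. v x + u x) * prob B - e \<le> corr (\<lambda>x. v x + u x) n B"
    if "n \<ge> max N1 N2" "B \<in> sets M" for n B
    using N1[of n B] N2[of n B] that iu iv by (simp add: corr_add algebra_simps)
  then show ?case by blast
next
  case (seq U)
  have le: "U i x \<le> f x" if "x \<in> space M" for i x
    using that seq.hyps(3,4) by (metis (no_types, lifting) LIMSEQ_le_const2 incseq_def le_fun_def linorder_le_cases lim_mono incseq_le)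
  have iU: "integrable M (U i)" for i
    by (rule Bochner_Integration.integrable_bound[OF seq.prems(1)])
      (use seq.hyps le in \<open>auto intro!: AE_I2 order_trans[OF _ abs_ge_self]\<close>)
  have "(\<lambda>i. integral\<^sup>L M (U i)) \<longlonglongrightarrow> integral\<^sup>L M f"
    by (rule integral_dominated_convergence[where w = f])
      (use seq.hyps seq.prems le in auto)
  then have "(\<lambda>i. c * integral\<^sup>L M (U i)) \<longlonglongrightarrow> c * integral\<^sup>L M f"
    by (intro tendsto_intros)
  then have "\<forall>\<^sub>F i in sequentially. c * integral\<^sup>L M f - e / 2 < c * integral\<^sup>L M (U i)"
    by (rule order_tendstoD) (use \<open>e > 0\<close> in auto)
  then obtain i where i: "c * integral\<^sup>L M f - e / 2 < c * integral\<^sup>L M (U i)"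
    using eventually_happens by force
  obtain N where N: "\<And>n B. n \<ge> N \<Longrightarrow> B \<in> sets M \<Longrightarrow>
        c * integral\<^sup>L M (U i) * prob B - e / 2 \<le> corr (U i) n B"
    using seq.IH[OF iU, of "e / 2" i] \<open>e > 0\<close> by (meson half_gt_zero)
  have "c * integral\<^sup>L M f * prob B - e \<le> corr f n B"
    if "n \<ge> N" "B \<in> sets M" for n B
  proof -
    have "(c * integral\<^sup>L M f - c * integral\<^sup>L M (U i)) * prob B \<le> e / 2 * 1"
      using i \<open>e > 0\<close> by (intro mult_mono) auto
    moreover have "corr (U i) n B \<le> corr f n B"
      using that iU seq.prems le by (intro corr_mono) auto
    ultimately show ?thesis using N[OF that] by (simp add: algebra_simps)
  qed
  then show ?case by blast
qed

lemma c_le_1: "c \<le> 1"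
proof (rule ccontr)
  assume "\<not> c \<le> 1"
  then obtain N where "\<forall>n\<ge>N. \<forall>B\<in>sets M.
      c * prob (space M) * prob B - (c - 1) / 2 \<le> prob (space M \<inter> (T ^^ n) -` B)"
    using lower[of "space M" "(c - 1) / 2"] by auto
  then have "c - (c - 1) / 2 \<le> prob (space M \<inter> (T ^^ N) -` space M)"
    by (metis order_refl sets.top prob_space mult.right_neutral)
  also have "\<dots> \<le> 1" by simp
  finally show False using \<open>\<not> c \<le> 1\<close> by (simp add: field_simps)
qed

text \<open>The conditional expectation on \<open>T\<^sup>-\<^sup>n\<close> of the sigma-algebra plays the role of the transfer
  operator: its positive and negative part have the same mass, and the lower bound makes their images
  overlap by a fixed proportion.\<close>

lemma corr_contract:
  assumes f: "integrable M f" "integral\<^sup>L M f = 0"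
    and r: "\<And>B. B \<in> sets M \<Longrightarrow> \<bar>corr f n B\<bar> \<le> r" and "e > 0"
  shows "\<exists>n'. \<forall>B\<in>sets M. \<bar>corr f n' B\<bar> \<le> (1 - c) * r + e"
proof -
  define F where "F = vimage_algebra (space M) (T ^^ n) M"
  have setsF: "A \<in> sets F \<longleftrightarrow> (\<exists>B\<in>sets M. A = (T ^^ n) -` B \<inter> space M)" for A
    unfolding F_def by (subst sets_vimage_algebra2) (use measurable_space[OF Tn_meas] in auto)
  have "subalgebra M F"
    unfolding subalgebra_def using setsF Tn_meas measurable_sets by (auto simp: F_def)
  then interpret F: finite_measure_subalgebra M F
    by unfold_locales
  \<comment> \<open>From time n on, \<open>g\<close> has the same correlations as \<open>f\<close>,
    but it factors through the n-th iterate, so the set where it is positive is a preimage.\<close>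
  define g where "g = real_cond_exp M F f"
  have gF [measurable]: "g \<in> borel_measurable F" by (simp add: g_def)
  have gi: "integrable M g" "integral\<^sup>L M g = 0"
    using F.real_cond_exp_int[OF f(1)] f(2) by (simp_all add: g_def)
  have corr_g: "corr g (n + k) B = corr f (n + k) B" if B: "B \<in> sets M" for k B
  proof -
    have "(\<lambda>x. indicator B ((T ^^ (n + k)) x) :: real) \<in> borel_measurable F"
    proof -
      have [measurable]: "T ^^ n \<in> measurable F M"
        unfolding F_def by (rule measurable_vimage_algebra1) (use measurable_space[OF Tn_meas] in auto)
      have "T ^^ k \<circ> T ^^ n \<in> measurable F M" by measurable
      then show ?thesis using B by (simp add: add.commute[of n] funpow_add) measurable
    qed
    then show ?thesis
      using F.real_cond_exp_intg(2)[of "\<lambda>x. indicator B ((T ^^ (n + k)) x)" f]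
        corr_integrable[OF f(1) B, of "n + k"] f(1)
      by (simp add: corr_def g_def mult.commute)
  qed
  define gp gm where "gp = (\<lambda>x. max (g x) 0)" and "gm = (\<lambda>x. max (- g x) 0)"
  have ip: "integrable M gp" "integrable M gm" using gi by (auto simp: gp_def gm_def)
  have g_eq: "g = (\<lambda>x. gp x - gm x)" by (auto simp: gp_def gm_def)
  define m where "m = integral\<^sup>L M gp"
  have m: "integral\<^sup>L M gm = m"
    using gi ip Bochner_Integration.integral_diff[OF ip] by (simp add: m_def g_eq[symmetric])
  have m0: "m \<ge> 0" unfolding m_def gp_def by (rule Bochner_Integration.integral_nonneg) auto
  \<comment> \<open>\<open>B0\<close> is the test set that detects the positive part: its
    correlation at time n is the whole mass \<open>m\<close>, hence \<open>m\<close> is at most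
    \<open>r\<close>.\<close>
  have "{x \<in> space F. 0 < g x} \<in> sets F" by measurable
  then obtain B0 where B0: "B0 \<in> sets M" "{x \<in> space M. 0 < g x} = (T ^^ n) -` B0 \<inter> space M"
    using setsF by (auto simp: F_def)
  have "m = corr g (n + 0) B0"
    unfolding m_def corr_def gp_def
  proof (rule Bochner_Integration.integral_cong[OF refl])
    fix x assume "x \<in> space M"
    then have "0 < g x \<longleftrightarrow> (T ^^ n) x \<in> B0" using B0(2) by blast
    then show "max (g x) 0 = g x * indicator B0 ((T ^^ (n + 0)) x)" by (auto simp: indicator_def)
  qed
  also have "\<dots> \<le> r" using corr_g[OF B0(1), of 0] r[OF B0(1)] by simp
  finally have "m \<le> r" .
  have "gp \<in> borel_measurable M" "gm \<in> borel_measurable M" "0 \<le> gp x" "0 \<le> gm x" "e / 2 > 0" for x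
    using ip \<open>e > 0\<close> by (auto simp: gp_def gm_def)
  note lower' = corr_lower[OF this(1,3) ip(1) this(5)] corr_lower[OF this(2,4) ip(2) this(5)]
  obtain N1 where N1: "\<And>n B. n \<ge> N1 \<Longrightarrow> B \<in> sets M \<Longrightarrow> c * m * prob B - e / 2 \<le> corr gp n B"
    using lower'(1) unfolding m_def by blast
  obtain N2 where N2: "\<And>n B. n \<ge> N2 \<Longrightarrow> B \<in> sets M \<Longrightarrow> c * m * prob B - e / 2 \<le> corr gm n B"
    using lower'(2) unfolding m by blast
  note N = N1 N2
  define n' where "n' = n + (N1 + N2)"
  have "\<bar>corr f n' B\<bar> \<le> (1 - c) * r + e" if B: "B \<in> sets M" for B
  proof -
    have eq: "corr f n' B = corr gp n' B - corr gm n' B"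
      using corr_g[OF B, of "N1 + N2"] corr_diff[OF ip B] by (simp add: n'_def g_eq[symmetric])
    have B': "space M - B \<in> sets M" using B by auto
    \<comment> \<open>Testing on B and on its complement confines the correlations of
      \<open>gp\<close> and \<open>gm\<close> to the same interval, from c m prob B - e/2 to m - c m
      (1 - prob B) + e/2. Its length is (1 - c) m + e, which bounds their difference.\<close>
    have "c * m * (1 - prob B) - e / 2 \<le> m - corr gp n' B" "c * m * prob B - e / 2 \<le> corr gp n' B"
      using N(1)[OF _ B', of n'] N(1)[OF _ B, of n'] corr_compl[OF ip(1) B] prob_compl[OF B]
      by (auto simp: n'_def m_def)
    moreover have "c * m * (1 - prob B) - e / 2 \<le> m - corr gm n' B"
      "c * m * prob B - e / 2 \<le> corr gm n' B"
      using N(2)[OF _ B', of n'] N(2)[OF _ B, of n'] corr_compl[OF ip(2) B] prob_compl[OF B] m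
      by (auto simp: n'_def)
    ultimately have "\<bar>corr f n' B\<bar> \<le> (1 - c) * m + e"
      unfolding eq by (simp add: algebra_simps abs_le_iff)
    also have "\<dots> \<le> (1 - c) * r + e"
      using \<open>m \<le> r\<close> c_le_1 by (intro add_right_mono mult_left_mono) auto
    finally show ?thesis .
  qed
  then show ?thesis by blast
qed

text \<open>\<open>S\<close> collects the bounds that hold at some time uniformly in B. Contraction
  sends r in \<open>S\<close> to (1 - c) r + e, so a positive infimum could be undercut.\<close>

lemma corr_tendsto_0:
  assumes f: "integrable M f" "integral\<^sup>L M f = 0" and "e > 0"
  shows "\<exists>N. \<forall>n\<ge>N. \<forall>B\<in>sets M. \<bar>corr f n B\<bar> \<le> e"
proof -
  define S where "S = {r. \<exists>n. \<forall>B\<in>sets M. \<bar>corr f n B\<bar> \<le> r}"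
  have ge: "r \<ge> 0" if "r \<in> S" for r
    using that unfolding S_def by (force intro: order_trans[OF abs_ge_zero])
  then have bdd: "bdd_below S" by (auto simp: bdd_below_def)
  have "\<bar>corr f 0 B\<bar> \<le> (\<integral>x. \<bar>f x\<bar> \<partial>M)" if "B \<in> sets M" for B
    unfolding corr_def
    by (rule order_trans[OF integral_abs_bound], intro integral_mono integrable_abs corr_integrable that f)
      (auto simp: indicator_def)
  then have ne: "S \<noteq> {}" unfolding S_def by blast
  have "Inf S \<le> 0"
  proof (rule ccontr)
    assume "\<not> Inf S \<le> 0"
    then have pos: "Inf S > 0" by simp
    \<comment> \<open>The slack \<open>d\<close> is spent once in the choice of \<open>r\<close> and
      once as error of the contraction; 2 d is half of the gain c Inf S.\<close>
    define d where "d = c * Inf S / 4"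
    have "d > 0" using pos c_pos by (simp add: d_def)
    then obtain r where r: "r \<in> S" "r < Inf S + d"
      using cInf_lessD[OF ne, of "Inf S + d"] by auto
    then obtain n where n: "\<forall>B\<in>sets M. \<bar>corr f n B\<bar> \<le> r" by (auto simp: S_def)
    have "(1 - c) * r + d \<in> S"
      using corr_contract[OF f _ \<open>d > 0\<close>, of n r] n by (auto simp: S_def)
    then have "Inf S \<le> (1 - c) * r + d" by (rule cInf_lower[OF _ bdd])
    also have "\<dots> \<le> (1 - c) * (Inf S + d) + d"
      using c_le_1 r by (intro add_right_mono mult_left_mono) auto
    also have "\<dots> \<le> Inf S - c * Inf S + 2 * d"
      using c_pos \<open>d > 0\<close> by (simp add: algebra_simps)
    also have "\<dots> < Inf S" using pos c_pos by (simp add: d_def)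
    finally show False by simp
  qed
  then obtain r where r: "r \<in> S" "r < e"
    using cInf_lessD[OF ne, of e] \<open>e > 0\<close> by auto
  then obtain n where n: "\<forall>B\<in>sets M. \<bar>corr f n B\<bar> \<le> r" by (auto simp: S_def)
  have "\<bar>corr f k B\<bar> \<le> e" if k: "k \<ge> n" and B: "B \<in> sets M" for k B
  proof -
    obtain B' where "B' \<in> sets M" "corr f (n + (k - n)) B = corr f n B'"
      using corr_later[OF B] by metis
    then show ?thesis using n r k by force
  qed
  then show ?thesis by blast
qed

lemma corr_tendsto:
  assumes f: "integrable M f" and B: "B \<in> sets M"
  shows "(\<lambda>n. corr f n B) \<longlonglongrightarrow> integral\<^sup>L M f * prob B"
proof -
  define g where "g = (\<lambda>x. f x - integral\<^sup>L M f)"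
  have g: "integrable M g" "integral\<^sup>L M g = 0" using f by (auto simp: g_def prob_space)
  have *: "corr g n B = corr f n B - integral\<^sup>L M f * prob B" for n
    unfolding g_def using f B by (subst corr_diff) (auto simp: corr_const)
  show ?thesis
  proof (rule LIMSEQ_I)
    fix e :: real assume "e > 0"
    then obtain N where N: "\<forall>n\<ge>N. \<forall>B\<in>sets M. \<bar>corr g n B\<bar> \<le> e / 2"
      using corr_tendsto_0[OF g, of "e / 2"] by auto
    show "\<exists>N. \<forall>n\<ge>N. norm (corr f n B - integral\<^sup>L M f * prob B) < e"
    proof (intro exI[of _ N] allI impI)
      fix n assume "n \<ge> N"
      with N B have "\<bar>corr g n B\<bar> \<le> e / 2" by blast
      then show "norm (corr f n B - integral\<^sup>L M f * prob B) < e"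
        using * \<open>e > 0\<close> by simp
    qed
  qed
qed

theorem mixing: "mixing M T"
  unfolding mixing_def
proof (intro conjI ballI pres)
  fix A B assume AB: "A \<in> sets M" "B \<in> sets M"
  show "(\<lambda>n. prob (A \<inter> (T ^^ n) -` B)) \<longlonglongrightarrow> prob A * prob B"
    using corr_tendsto[of "indicator A" B] AB sets.sets_into_space[OF AB(1)]
    by (simp add: corr_indicator Int_absorb2 less_top[symmetric])
qed

text \<open>For the density f of N, the correlation with B at time n is the N-measure of the n-th
  preimage of B. It is constantly N(B) by invariance, and it tends to M(B).\<close>

theorem absolutely_continuous_invariant_eq:
  assumes N: "prob_space N" "sets N = sets M" "absolutely_continuous M N" "measure_preserving N T"
  shows "N = M"
proof -
  interpret N: prob_space N by fact
  have sp: "space N = space M" using N(2) by (rule sets_eq_imp_space_eq)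
  obtain f where f: "f \<in> borel_measurable M" "AE x in M. RN_deriv M N x = ennreal (f x)"
      "AE x in N. 0 < f x" "\<And>x. 0 \<le> f x"
    using real_RN_deriv[OF N.finite_measure_axioms N(3,2)] by blast
  have N_eq: "N = density M (\<lambda>x. ennreal (f x))"
    using density_RN_deriv[OF N(3,2)] f(1,2) density_cong[of "RN_deriv M N" M "\<lambda>x. ennreal (f x)"] by auto
  have meas: "emeasure N A = (\<integral>\<^sup>+x. ennreal (f x * indicator A x) \<partial>M)" if "A \<in> sets M" for A
    unfolding N_eq using f(1,4) that
    by (subst emeasure_density) (auto intro!: nn_integral_cong simp: indicator_def)
  have "(\<integral>\<^sup>+x. ennreal (f x) \<partial>M) = 1"
    using meas[of "space M"] N.emeasure_space_1 sp
    by (auto cong: nn_integral_cong_simp simp: indicator_def)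
  then have fi: "integrable M f" "integral\<^sup>L M f = 1"
    using f(1,4) by (auto intro!: integrableI_nonneg integral_eq_nn_integral[THEN trans] simp: enn2real_def[symmetric])
  have T: "T \<in> measurable N N" "distr N N T = N" using N(4) by (auto simp: measure_preserving_def)
  have inv: "N.prob ((T ^^ n) -` B \<inter> space M) = N.prob B" if "B \<in> sets M" for n B
  proof (induction n)
    case 0
    then show ?case using sets.sets_into_space[OF that] by (auto simp: Int_absorb2)
  next
    case (Suc n)
    have *: "(T ^^ n) -` B \<inter> space M \<in> sets N"
      using measurable_sets[OF Tn_meas that] N(2) by simp
    have "N.prob ((T ^^ n) -` B \<inter> space M) = measure (distr N N T) ((T ^^ n) -` B \<inter> space M)"
      by (simp add: T)
    also have "\<dots> = N.prob (T -` ((T ^^ n) -` B \<inter> space M) \<inter> space M)"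
      using measure_distr[OF T(1) *] sp by simp
    also have "T -` ((T ^^ n) -` B \<inter> space M) \<inter> space M = (T ^^ Suc n) -` B \<inter> space M"
      using measurable_space[OF T_meas] by (auto simp: funpow_Suc_right simp del: funpow.simps)
    finally show ?case using Suc by (simp add: comp_def)
  qed
  show ?thesis
  proof (rule measure_eqI[OF N(2)])
    fix B assume B: "B \<in> sets N"
    then have B': "B \<in> sets M" using N(2) by simp
    have "corr f n B = N.prob B" for n
    proof -
      have "corr f n B = (\<integral>x. f x * indicator ((T ^^ n) -` B \<inter> space M) x \<partial>M)"
        unfolding corr_def by (intro Bochner_Integration.integral_cong) (auto simp: indicator_def)
      also have "\<dots> = N.prob ((T ^^ n) -` B \<inter> space M)"
        using meas[of "(T ^^ n) -` B \<inter> space M"] f B'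
        by (simp add: measure_def integral_eq_nn_integral)
      finally show ?thesis using inv[OF B'] by simp
    qed
    then have "(\<lambda>n. N.prob B) \<longlonglongrightarrow> prob B"
      using corr_tendsto[OF fi(1) B'] fi(2) by simp
    then have "N.prob B = prob B" by (simp add: LIMSEQ_const_iff)
    then show "emeasure N B = emeasure M B"
      by (simp add: emeasure_eq_measure N.emeasure_eq_measure)
  qed
qed

end

section \<open>Cylinders\<close>

text \<open>One set approximates in both measures at once, as is required when a null set of one
  measure is tested with the other. The induction controls the sum of the two distances.\<close>

lemma approx_by_generating_algebra:
  assumes M: "finite_measure M" "sets M = sigma_sets \<Omega> G"
    and N: "finite_measure N" "sets N = sigma_sets \<Omega> G"
    and G: "algebra \<Omega> G" and A: "A \<in> sigma_sets \<Omega> G" and "e > 0"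
  shows "\<exists>B\<in>G. measure M ((A - B) \<union> (B - A)) < e \<and> measure N ((A - B) \<union> (B - A)) < e"
proof -
  interpret M: finite_measure M by fact
  interpret N: finite_measure N by fact
  interpret G: algebra \<Omega> G by fact
  define d where "d A B = measure M ((A - B) \<union> (B - A)) + measure N ((A - B) \<union> (B - A))" for A B
  have NM: "sets N = sets M" using M N by simp
  have G_sets: "B \<in> sets M" if "B \<in> G" for B using that by (simp add: M(2) sigma_sets.Basic)
  have "\<exists>B\<in>G. d A B < e"
    using A \<open>e > 0\<close>
  proof (induction arbitrary: e rule: sigma_sets.induct)
    case (Basic a)
    then show ?case by (intro bexI[of _ a]) (auto simp: d_def)
  next
    case Empty
    then show ?case by (intro bexI[of _ "{}"]) (auto simp: d_def)
  next
    case (Compl a)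
    then obtain B where B: "B \<in> G" "d a B < e" by blast
    have "a \<subseteq> \<Omega>" using Compl.hyps sigma_sets_into_sp[OF G.space_closed] by blast
    moreover have "B \<subseteq> \<Omega>" using B(1) G.sets_into_space by blast
    ultimately have "((\<Omega> - a) - (\<Omega> - B)) \<union> ((\<Omega> - B) - (\<Omega> - a)) = (a - B) \<union> (B - a)" by blast
    then show ?case using B by (intro bexI[of _ "\<Omega> - B"]) (auto simp: d_def)
  next
    case (Union a)
    define U where "U n = (\<Union>i<n. a i)" for n :: nat
    have a: "a i \<in> sets M" for i using Union.hyps by (simp add: M(2))
    have U: "range U \<subseteq> sets M" "incseq U" "(\<Union>n. U n) = (\<Union>i. a i)"
      using a by (auto simp: U_def incseq_def) (meson lessThan_iff less_le_trans)
    have "(\<lambda>n. measure M (U n) + measure N (U n)) \<longlonglongrightarrow> measure M (\<Union>n. U n) + measure N (\<Union>n. U n)"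
      using U NM by (intro tendsto_add M.finite_Lim_measure_incseq N.finite_Lim_measure_incseq) auto
    from order_tendstoD(1)[OF this, of "measure M (\<Union>n. U n) + measure N (\<Union>n. U n) - e / 2"] \<open>e > 0\<close>
    obtain n where n: "measure M (\<Union>n. U n) + measure N (\<Union>n. U n) - e / 2 < measure M (U n) + measure N (U n)"
      by (auto simp: eventually_sequentially)
    define R where "R = (\<Union>i. a i) - U n"
    have R: "measure M R + measure N R < e / 2"
      using n U a NM unfolding R_def U(3)
      by (subst M.finite_measure_Diff, auto simp: U_def subset_eq)
        (subst N.finite_measure_Diff, auto simp: U_def subset_eq)
    \<comment> \<open>Half of \<open>e\<close> is spent on the tail \<open>R\<close>, the other half
      is shared by the first n sets; n + 1 keeps the quotient meaningful for n = 0.\<close>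
    define r where "r = e / (2 * (real n + 1))"
    have "r > 0" using \<open>e > 0\<close> by (simp add: r_def)
    from Union.IH[OF this] obtain B where B: "\<And>i. B i \<in> G" "\<And>i. d (a i) (B i) < r" by metis
    define D where "D i = (a i - B i) \<union> (B i - a i)" for i
    have D: "D i \<in> sets M" for i using a B(1) G_sets by (auto simp: D_def)
    have RU: "R \<in> sets M" "(\<Union>i<n. D i) \<in> sets M" using a U D by (auto simp: R_def)
    have BG: "(\<Union>i<n. B i) \<in> G" using B(1) by (intro G.finite_UN) auto
    let ?S = "((\<Union>i. a i) - (\<Union>i<n. B i)) \<union> ((\<Union>i<n. B i) - (\<Union>i. a i))"
    have sub: "?S \<subseteq> R \<union> (\<Union>i<n. D i)" by (auto simp: R_def D_def U_def)
    have "measure M ?S \<le> measure M (R \<union> (\<Union>i<n. D i))"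
      using RU by (intro M.finite_measure_mono sub) auto
    also have "\<dots> \<le> measure M R + measure M (\<Union>i<n. D i)"
      using RU by (intro measure_Un_le) auto
    also have "measure M (\<Union>i<n. D i) \<le> (\<Sum>i<n. measure M (D i))"
      using D by (intro M.finite_measure_subadditive_finite) auto
    finally have 1: "measure M ?S \<le> measure M R + (\<Sum>i<n. measure M (D i))" by simp
    have "measure N ?S \<le> measure N (R \<union> (\<Union>i<n. D i))"
      using RU NM by (intro N.finite_measure_mono sub) auto
    also have "\<dots> \<le> measure N R + measure N (\<Union>i<n. D i)"
      using RU NM by (intro measure_Un_le) auto
    also have "measure N (\<Union>i<n. D i) \<le> (\<Sum>i<n. measure N (D i))"
      using D NM by (intro N.finite_measure_subadditive_finite) auto
    finally have "d (\<Union>i. a i) (\<Union>i<n. B i) \<le> measure M R + measure N R + (\<Sum>i<n. d (a i) (B i))"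
      using 1 by (simp add: d_def sum.distrib D_def)
    also have "(\<Sum>i<n. d (a i) (B i)) \<le> real n * r"
      using B(2) sum_mono[of "{..<n}" "\<lambda>i. d (a i) (B i)" "\<lambda>_. r"] by (simp add: less_imp_le)
    also have "real n * r \<le> e / 2" using \<open>e > 0\<close> by (simp add: r_def field_simps)
    finally have "d (\<Union>i. a i) (\<Union>i<n. B i) < e" using R by linarith
    then show ?case using BG by blast
  qed
  then obtain B where B: "B \<in> G" "d A B < e" by blast
  have "0 \<le> measure M ((A - B) \<union> (B - A))" "0 \<le> measure N ((A - B) \<union> (B - A))" by simp_all
  then have "measure M ((A - B) \<union> (B - A)) < e \<and> measure N ((A - B) \<union> (B - A)) < e"
    using B(2) unfolding d_def by linarith
  then show ?thesis using B(1) by blast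
qed

section \<open>Words, blocks and cylinder sets\<close>

definition words :: "nat \<Rightarrow> 'b list set" where "words n = {w. length w = n}"

lemma finite_words [simp]: "finite (words n :: 'b::finite list set)"
  using finite_lists_length_eq[of "UNIV :: 'b set" n] by (simp add: words_def)

lemma words_0 [simp]: "words 0 = {[]}"
  by (auto simp: words_def)

lemma sum_words_add:
  fixes f :: "'b::finite list \<Rightarrow> 'c::comm_monoid_add"
  shows "(\<Sum>w\<in>words (m + n). f w) = (\<Sum>u\<in>words m. \<Sum>v\<in>words n. f (u @ v))"
proof -
  have "(\<Sum>w\<in>words (m + n). f w) = (\<Sum>(u, v)\<in>words m \<times> words n. f (u @ v))"
    by (rule sum.reindex_bij_witness[where i = "\<lambda>(u, v). u @ v" and j = "\<lambda>w. (take m w, drop m w)"])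
      (auto simp: words_def)
  then show ?thesis by (simp add: sum.cartesian_product)
qed

lemma sum_words_1:
  fixes f :: "'b::finite list \<Rightarrow> 'c::comm_monoid_add"
  shows "(\<Sum>w\<in>words 1. f w) = (\<Sum>a\<in>UNIV. f [a])"
  by (rule sum.reindex_bij_witness[where i = "\<lambda>a. [a]" and j = hd])
    (auto simp: words_def length_Suc_conv)

lemma length_block [simp]: "length (block x i n) = n"
  by (simp add: block_def)

lemma block_in_words [simp]: "block x i n \<in> words n"
  by (simp add: words_def)

lemma block_0 [simp]: "block x i 0 = []"
  by (simp add: block_def)

lemma block_add: "block x i (m + n) = block x i m @ block x (i + m) n"
  by (auto simp: block_def nth_append intro!: nth_equalityI)

lemma take_block: "m \<le> n \<Longrightarrow> take m (block x i n) = block x i m"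
  by (auto simp: block_def intro!: nth_equalityI)

lemma shift_funpow: "(shift_map ^^ k) x = (\<lambda>n. x (k + n))"
  by (induction k arbitrary: x) (auto simp: shift_map_def)

lemma block_shift: "block ((shift_map ^^ k) x) i n = block x (k + i) n"
  by (simp add: block_def shift_funpow add.assoc)

lemma block_shift1: "block (shift_map x) i n = block x (Suc i) n"
  by (simp add: block_def shift_map_def)

lemma block_Suc: "block x i (Suc n) = x i # block x (Suc i) n"
  using block_add[of x i 1 n] by (simp add: block_def)

lemma block_eq_iff: "block x i n = block y j n \<longleftrightarrow> (\<forall>k<n. x (i + k) = y (j + k))"
  by (auto simp: block_def)

lemma cylinder_iff: "y \<in> cylinder Y w \<longleftrightarrow> y \<in> Y \<and> block y 0 (length w) = w"
  by (auto simp: cylinder_def)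

lemma cylinder_Nil [simp]: "cylinder Y [] = Y"
  by (auto simp: cylinder_def)

text \<open>Over a finite alphabet these are the finite unions of cylinders. Encoded by a length and
  a set of admissible initial blocks, two of them are brought to a common length by testing
  prefixes.\<close>

definition cyl_alg :: "(nat \<Rightarrow> 'b) set \<Rightarrow> (nat \<Rightarrow> 'b) set set" where
  "cyl_alg Y = {{y \<in> Y. block y 0 n \<in> S} | n S. True}"

lemma cyl_algI: "{y \<in> Y. block y 0 n \<in> S} \<in> cyl_alg Y"
  by (auto simp: cyl_alg_def)

lemma cylinder_in_cyl_alg: "cylinder Y w \<in> cyl_alg Y"
  using cyl_algI[of Y "length w" "{w}"] by (simp add: cylinder_def)

lemma cyl_alg_raise:
  assumes "A = {y \<in> Y. block y 0 n \<in> S}" "n \<le> N"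
  shows "A = {y \<in> Y. block y 0 N \<in> {w. take n w \<in> S}}"
  using assms by (auto simp: take_block)

lemma algebra_cyl_alg: "algebra Y (cyl_alg Y)"
  unfolding algebra_iff_Un
proof (intro conjI ballI)
  show "cyl_alg Y \<subseteq> Pow Y" by (auto simp: cyl_alg_def)
  show "{} \<in> cyl_alg Y" using cyl_algI[of Y 0 "{}"] by simp
next
  fix A assume "A \<in> cyl_alg Y"
  then obtain n S where "A = {y \<in> Y. block y 0 n \<in> S}" by (auto simp: cyl_alg_def)
  then have "Y - A = {y \<in> Y. block y 0 n \<in> - S}" by auto
  then show "Y - A \<in> cyl_alg Y" by (simp only: cyl_algI)
next
  fix A B assume "A \<in> cyl_alg Y" "B \<in> cyl_alg Y"
  then obtain n S n' S' where *: "A = {y \<in> Y. block y 0 n \<in> S}" "B = {y \<in> Y. block y 0 n' \<in> S'}"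
    by (auto simp: cyl_alg_def)
  have "A \<union> B = {y \<in> Y. block y 0 (max n n') \<in> {w. take n w \<in> S} \<union> {w. take n' w \<in> S'}}"
    using cyl_alg_raise[OF *(1), of "max n n'"] cyl_alg_raise[OF *(2), of "max n n'"] by auto
  then show "A \<union> B \<in> cyl_alg Y" by (simp only: cyl_algI)
qed

section \<open>Topology and Borel sets of a subshift\<close>

abbreviation full_topology :: "(nat \<Rightarrow> 'b) topology" where
  "full_topology \<equiv> product_topology (\<lambda>_. discrete_topology UNIV) UNIV"

lemma openin_cyl_alg: "A \<in> cyl_alg Y \<Longrightarrow> openin (subshift_topology Y) A"
proof -
  assume "A \<in> cyl_alg Y"
  then obtain n S where A: "A = {y \<in> Y. block y 0 n \<in> S}" by (auto simp: cyl_alg_def)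
  have "openin full_topology {y. block y 0 n \<in> S}"
    unfolding openin_product_topology_alt
  proof (intro ballI)
    fix x assume x: "x \<in> {y. block y 0 n \<in> S}"
    let ?U = "\<lambda>i. if i < n then {x i} else UNIV"
    have "finite {i \<in> UNIV. ?U i \<noteq> topspace (discrete_topology UNIV)}"
      by (rule finite_subset[of _ "{..<n}"]) auto
    moreover have "Pi\<^sub>E UNIV ?U \<subseteq> {y. block y 0 n \<in> S}"
    proof
      fix y assume "y \<in> Pi\<^sub>E UNIV ?U"
      then have "y i = x i" if "i < n" for i using that by (auto simp: PiE_def Pi_def split: if_splits)
      then have "block y 0 n = block x 0 n" by (simp add: block_eq_iff)
      then show "y \<in> {y. block y 0 n \<in> S}" using x by simp
    qed
    ultimately show "\<exists>U. finite {i \<in> UNIV. U i \<noteq> topspace (discrete_topology UNIV)} \<and>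
        (\<forall>i\<in>UNIV. openin (discrete_topology UNIV) (U i)) \<and> x \<in> Pi\<^sub>E UNIV U \<and> Pi\<^sub>E UNIV U \<subseteq> {y. block y 0 n \<in> S}"
      by (intro exI[of _ ?U]) auto
  qed
  then show ?thesis unfolding subshift_topology_def openin_subtopology A by blast
qed

lemma open_contains_cylinder:
  assumes U: "openin (subshift_topology Y) U" and x: "x \<in> U"
  shows "\<exists>n. cylinder Y (block x 0 n) \<subseteq> U"
proof -
  obtain V where V: "openin full_topology V" "U = V \<inter> Y"
    using U unfolding subshift_topology_def openin_subtopology by blast
  then obtain W where W: "finite {i \<in> UNIV. W i \<noteq> topspace (discrete_topology UNIV)}"
    "x \<in> Pi\<^sub>E UNIV W" "Pi\<^sub>E UNIV W \<subseteq> V"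
    using x unfolding openin_product_topology_alt by fast
  then obtain n where n: "\<And>i. W i \<noteq> UNIV \<Longrightarrow> i < n"
    by (auto simp: finite_nat_set_iff_bounded)
  have "y \<in> V" if "block y 0 n = block x 0 n" for y
  proof -
    have "y i \<in> W i" for i
      using that n[of i] W(2) by (cases "W i = UNIV") (auto simp: block_eq_iff PiE_def Pi_def)
    then show ?thesis using W(3) by (auto simp: PiE_def Pi_def)
  qed
  then show ?thesis unfolding V(2) by (intro exI[of _ n]) (auto simp: cylinder_iff)
qed

text \<open>An open set is the union of the cylinders it contains, and over a finite alphabet there
  are only countably many words.\<close>

lemma borel_eq_cyl_alg:
  fixes Y :: "(nat \<Rightarrow> 'b::finite) set"
  shows "sigma_sets Y {U. openin (subshift_topology Y) U} = sigma_sets Y (cyl_alg Y)"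
proof (rule sigma_sets_eqI)
  fix U assume "U \<in> {U. openin (subshift_topology Y) U}"
  then have U: "openin (subshift_topology Y) U" by simp
  have "U \<subseteq> Y" using openin_subset[OF U] by (simp add: subshift_topology_def)
  then have "U = \<Union>(cylinder Y ` {w. cylinder Y w \<subseteq> U})"
    using open_contains_cylinder[OF U] by (fastforce simp: cylinder_iff)
  moreover have "\<Union>(cylinder Y ` {w. cylinder Y w \<subseteq> U}) \<in> sigma_sets Y (cyl_alg Y)"
    by (intro sigma_sets_UNION) (auto intro!: sigma_sets.Basic cylinder_in_cyl_alg)
  ultimately show "U \<in> sigma_sets Y (cyl_alg Y)" by simp
next
  fix A assume "A \<in> cyl_alg Y"
  then show "A \<in> sigma_sets Y {U. openin (subshift_topology Y) U}"
    by (auto intro: sigma_sets.Basic openin_cyl_alg)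
qed

lemma borel_prob_measures_iff:
  fixes Y :: "(nat \<Rightarrow> 'b::finite) set"
  shows "\<mu> \<in> borel_prob_measures Y \<longleftrightarrow> prob_space \<mu> \<and> space \<mu> = Y \<and> sets \<mu> = sigma_sets Y (cyl_alg Y)"
  by (simp add: borel_prob_measures_def borel_eq_cyl_alg)

text \<open>Members of the algebra are closed as well as open, and Y is compact. Countable
  additivity of the measures built from cylinder weights rests on this.\<close>

lemma cyl_alg_nested:
  fixes Y :: "(nat \<Rightarrow> 'b::finite) set"
  assumes Y: "closedin full_topology Y" and A: "\<And>i::nat. A i \<in> cyl_alg Y" "decseq A" "\<And>i. A i \<noteq> {}"
  shows "(\<Inter>i. A i) \<noteq> {}"
proof (rule compact_space_imp_nest[OF _ _ A(3,2)])
  have "compact_space (full_topology :: (nat \<Rightarrow> 'b) topology)"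
    by (simp add: compact_space_product_topology compact_space_discrete_topology)
  then show "compact_space (subshift_topology Y)"
    unfolding subshift_topology_def
    by (intro compact_space_subtopology closedin_compact_space Y)
  fix i
  interpret algebra Y "cyl_alg Y" by (rule algebra_cyl_alg)
  have "A i \<subseteq> Y" using A(1) sets_into_space by blast
  then show "closedin (subshift_topology Y) (A i)"
    using openin_cyl_alg[of "Y - A i" Y] A(1)[of i]
    unfolding closedin_def by (auto simp: subshift_topology_def)
qed

section \<open>Measures and their values on cylinders\<close>

lemma measure_block_in:
  fixes Y :: "(nat \<Rightarrow> 'b::finite) set"
  assumes "\<mu> \<in> borel_prob_measures Y"
  shows "measure \<mu> {y \<in> Y. block y 0 n \<in> S} = (\<Sum>w\<in>words n \<inter> S. measure \<mu> (cylinder Y w))"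
proof -
  interpret prob_space \<mu> using assms by (simp add: borel_prob_measures_iff)
  have "{y \<in> Y. block y 0 n \<in> S} = (\<Union>w\<in>words n \<inter> S. cylinder Y w)"
    by (auto simp: cylinder_iff words_def)
  moreover have "cylinder Y w \<in> sets \<mu>" for w
    using assms by (auto simp: borel_prob_measures_iff intro: sigma_sets.Basic cylinder_in_cyl_alg)
  moreover have "disjoint_family_on (cylinder Y) (words n \<inter> S)"
    by (auto simp: disjoint_family_on_def cylinder_iff words_def)
  ultimately show ?thesis
    using finite_measure_finite_Union[of "words n \<inter> S" "cylinder Y"] by auto
qed

lemma cyl_alg_measure_eqI:
  fixes Y :: "(nat \<Rightarrow> 'b::finite) set"
  assumes "\<mu> \<in> borel_prob_measures Y" "\<nu> \<in> borel_prob_measures Y"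
    and eq: "\<And>w. measure \<mu> (cylinder Y w) = measure \<nu> (cylinder Y w)"
  shows "\<mu> = \<nu>"
proof -
  interpret M: prob_space \<mu> using assms by (simp add: borel_prob_measures_iff)
  interpret N: prob_space \<nu> using assms by (simp add: borel_prob_measures_iff)
  interpret algebra Y "cyl_alg Y" by (rule algebra_cyl_alg)
  show ?thesis
  proof (rule measure_eqI_generator_eq[where E = "cyl_alg Y" and \<Omega> = Y and A = "\<lambda>_. Y"])
    show "Int_stable (cyl_alg Y)" by (auto simp: Int_stable_def)
    fix A assume "A \<in> cyl_alg Y"
    then obtain n S where "A = {y \<in> Y. block y 0 n \<in> S}" by (auto simp: cyl_alg_def)
    then show "emeasure \<mu> A = emeasure \<nu> A"
      using assms by (simp add: M.emeasure_eq_measure N.emeasure_eq_measure measure_block_in)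
  qed (use assms space_closed top in \<open>auto simp: borel_prob_measures_iff\<close>)
qed

text \<open>Kolmogorov extension for weights supported on the language of \<open>Y\<close>.
  Additivity on the algebra is finite combinatorics; continuity at the empty set is automatic,
  because by compactness a decreasing sequence with empty intersection is eventually empty.\<close>

lemma cylinder_measure_exists:
  fixes Y :: "(nat \<Rightarrow> 'b::finite) set" and m :: "'b list \<Rightarrow> real"
  assumes Y: "closedin full_topology Y" and m0: "\<And>w. m w \<ge> 0" and m1: "m [] = 1"
    and m_snoc: "\<And>w. (\<Sum>a\<in>UNIV. m (w @ [a])) = m w"
    and m_supp: "\<And>w. cylinder Y w = {} \<Longrightarrow> m w = 0"
  obtains \<mu> where "\<mu> \<in> borel_prob_measures Y" "\<And>w. measure \<mu> (cylinder Y w) = m w"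
proof -
  interpret algebra Y "cyl_alg Y" by (rule algebra_cyl_alg)
  \<comment> \<open>The mass of A seen at word length n. Once n reaches a length that decides A, a
    cylinder of that length meeting A lies inside A, and \<open>m_snoc\<close> keeps the value
    constant from there on.\<close>
  define F where "F n A = (\<Sum>w | w \<in> words n \<and> cylinder Y w \<inter> A \<noteq> {}. m w)" for n A
  have F_eq: "F n A = (\<Sum>w\<in>words n. if cylinder Y w \<inter> A \<noteq> {} then m w else 0)" for n A
    by (simp add: F_def sum.If_cases Int_def)
  have F_step: "F (Suc n) A = F n A" if A: "A = {y \<in> Y. block y 0 k \<in> S}" and "k \<le> n" for n k S A
  proof -
    have sub: "cylinder Y (w @ [a]) \<subseteq> cylinder Y w" for w a
    proof
      fix y assume y: "y \<in> cylinder Y (w @ [a])"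
      have "block y 0 (length w) = take (length w) (block y 0 (length (w @ [a])))" by (simp add: take_block)
      then show "y \<in> cylinder Y w" using y by (simp add: cylinder_iff)
    qed
    have "(\<Sum>a\<in>UNIV. if cylinder Y (w @ [a]) \<inter> A \<noteq> {} then m (w @ [a]) else 0)
        = (if cylinder Y w \<inter> A \<noteq> {} then m w else 0)" if w: "w \<in> words n" for w
    proof (cases "cylinder Y w \<inter> A = {}")
      case True
      then have "cylinder Y (w @ [a]) \<inter> A = {}" for a using sub by blast
      then show ?thesis using True by simp
    next
      case False
      then obtain y where y: "y \<in> cylinder Y w" "y \<in> A" by blast
      have "cylinder Y w \<subseteq> A"
      proof
        fix z assume z: "z \<in> cylinder Y w"
        have "block z 0 n = block y 0 n" using y z w by (auto simp: cylinder_iff words_def)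
        then have "block z 0 k = block y 0 k" using \<open>k \<le> n\<close> by (metis take_block)
        then show "z \<in> A" using y z by (auto simp: A cylinder_iff)
      qed
      then have "cylinder Y (w @ [a]) \<inter> A = cylinder Y (w @ [a])" for a using sub by blast
      then have "(\<Sum>a\<in>UNIV. if cylinder Y (w @ [a]) \<inter> A \<noteq> {} then m (w @ [a]) else 0) = (\<Sum>a\<in>UNIV. m (w @ [a]))"
        by (intro sum.cong) (auto simp: m_supp)
      then show ?thesis using False m_snoc by simp
    qed
    then have "(\<Sum>w\<in>words n. \<Sum>a\<in>UNIV. if cylinder Y (w @ [a]) \<inter> A \<noteq> {} then m (w @ [a]) else 0) = F n A"
      unfolding F_eq by (rule sum.cong[OF refl])
    moreover have "F (n + 1) A = (\<Sum>w\<in>words n. \<Sum>a\<in>UNIV. if cylinder Y (w @ [a]) \<inter> A \<noteq> {} then m (w @ [a]) else 0)"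
      unfolding F_eq sum_words_add sum_words_1 by (rule refl)
    ultimately show ?thesis by simp
  qed
  have F_const: "F n A = F k A" if A: "A = {y \<in> Y. block y 0 k \<in> S}" and "k \<le> n" for n k S A
  proof -
    have "F (k + j) A = F k A" for j by (induction j) (simp_all add: F_step[OF A])
    from this[of "n - k"] show ?thesis using \<open>k \<le> n\<close> by simp
  qed
  \<comment> \<open>The limit of an eventually constant sequence: a value that does not depend on
    the chosen representation of A.\<close>
  define f where "f A = lim (\<lambda>n. F n A)" for A
  have f_eq: "f A = F n A" if A: "A = {y \<in> Y. block y 0 k \<in> S}" and "k \<le> n" for A n k S
  proof -
    have "F i A = F n A" if "i \<ge> k" for i
      using F_const[OF A that] F_const[OF A \<open>k \<le> n\<close>] by simp
    then have "\<forall>\<^sub>F i in sequentially. F i A = F n A"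
      unfolding eventually_sequentially by blast
    then show ?thesis unfolding f_def by (intro limI tendsto_eventually)
  qed
  have F0: "F n A \<ge> 0" for n A unfolding F_def by (intro sum_nonneg m0)
  have f0: "f A \<ge> 0" if A: "A \<in> cyl_alg Y" for A
  proof -
    obtain n S where "A = {y \<in> Y. block y 0 n \<in> S}" using A by (auto simp: cyl_alg_def)
    from f_eq[OF this order_refl] F0 show ?thesis by simp
  qed
  have "f {} = F 0 {}" by (rule f_eq[where k = 0 and S = "{}"]) auto
  then have f_empty: "f {} = 0" by (simp add: F_def)
  have f_add: "f (A \<union> B) = f A + f B" if AB: "A \<in> cyl_alg Y" "B \<in> cyl_alg Y" "A \<inter> B = {}" for A B
  proof -
    obtain n S n' S' where *: "A = {y \<in> Y. block y 0 n \<in> S}" "B = {y \<in> Y. block y 0 n' \<in> S'}"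
      using AB by (auto simp: cyl_alg_def)
    define N where "N = max n n'"
    have A: "A = {y \<in> Y. block y 0 N \<in> {w. take n w \<in> S}}"
      using cyl_alg_raise[OF *(1), of N] by (simp add: N_def)
    have B: "B = {y \<in> Y. block y 0 N \<in> {w. take n' w \<in> S'}}"
      using cyl_alg_raise[OF *(2), of N] by (simp add: N_def)
    have U: "A \<union> B = {y \<in> Y. block y 0 N \<in> {w. take n w \<in> S} \<union> {w. take n' w \<in> S'}}"
      using A B by auto
    have eq: "{w. w \<in> words N \<and> cylinder Y w \<inter> (A \<union> B) \<noteq> {}} =
        {w. w \<in> words N \<and> cylinder Y w \<inter> A \<noteq> {}} \<union> {w. w \<in> words N \<and> cylinder Y w \<inter> B \<noteq> {}}" by auto
    have dj: "{w. w \<in> words N \<and> cylinder Y w \<inter> A \<noteq> {}} \<inter> {w. w \<in> words N \<and> cylinder Y w \<inter> B \<noteq> {}} = {}"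
    proof (rule ccontr)
      assume "\<not> ?thesis"
      then obtain w x y where w: "w \<in> words N" and x: "x \<in> cylinder Y w" "x \<in> A"
        and y: "y \<in> cylinder Y w" "y \<in> B" by blast
      have "block x 0 N = block y 0 N" using w x y by (auto simp: cylinder_iff words_def)
      moreover have "x \<in> Y" using x by (simp add: cylinder_iff)
      ultimately have "x \<in> B" using B y by auto
      then show False using x AB(3) by blast
    qed
    have "F N (A \<union> B) = F N A + F N B"
      unfolding F_def eq by (rule sum.union_disjoint[OF _ _ dj]) (rule finite_subset[OF _ finite_words[of N]], blast)+
    then show ?thesis
      unfolding f_eq[OF A order_refl] f_eq[OF B order_refl] f_eq[OF U order_refl] .
  qed
  have "\<exists>\<mu>. (\<forall>s\<in>cyl_alg Y. \<mu> s = ennreal (f s)) \<and> measure_space Y (sigma_sets Y (cyl_alg Y)) \<mu>"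
  proof (rule caratheodory_empty_continuous)
    show "positive (cyl_alg Y) (\<lambda>A. ennreal (f A))" by (simp add: positive_def f_empty)
    show "additive (cyl_alg Y) (\<lambda>A. ennreal (f A))"
      by (auto simp: additive_def f_add f0 ennreal_plus[symmetric] simp del: ennreal_plus)
    fix A :: "nat \<Rightarrow> _" assume A: "range A \<subseteq> cyl_alg Y" "decseq A" "(\<Inter>i. A i) = {}"
    then obtain i where i: "A i = {}" using cyl_alg_nested[OF Y, of A] by blast
    then have "A n = {}" if "n \<ge> i" for n using A(2) that by (auto simp: decseq_def)
    then have "\<forall>\<^sub>F n in sequentially. ennreal (f (A n)) = 0"
      unfolding eventually_sequentially using f_empty by (intro exI[of _ i]) simp
    then show "(\<lambda>i. ennreal (f (A i))) \<longlonglongrightarrow> 0" by (rule tendsto_eventually)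
  qed simp
  then obtain \<mu>' where \<mu>': "\<And>s. s \<in> cyl_alg Y \<Longrightarrow> \<mu>' s = ennreal (f s)"
    "measure_space Y (sigma_sets Y (cyl_alg Y)) \<mu>'" by blast
  define \<mu> where "\<mu> = measure_of Y (sigma_sets Y (cyl_alg Y)) \<mu>'"
  have sets: "sets \<mu> = sigma_sets Y (cyl_alg Y)" "space \<mu> = Y"
    unfolding \<mu>_def using space_closed sigma_sets_into_sp[OF space_closed]
    by (auto simp: sets_measure_of_conv space_measure_of_conv sigma_sets_sigma_sets_eq)
  have em: "emeasure \<mu> A = ennreal (f A)" if "A \<in> cyl_alg Y" for A
    using \<mu>' that sigma_sets.Basic[OF that, of Y] unfolding \<mu>_def measure_space_def
    by (subst emeasure_measure_of_sigma) auto
  have fc: "f (cylinder Y w) = m w" for w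
  proof -
    have "{u. u \<in> words (length w) \<and> cylinder Y u \<inter> cylinder Y w \<noteq> {}} = (if cylinder Y w = {} then {} else {w})"
      by (auto simp: words_def cylinder_iff)
    then show ?thesis
      using f_eq[of "cylinder Y w" "length w" "{w}" "length w"] m_supp
      by (auto simp: F_def cylinder_def)
  qed
  have "emeasure \<mu> (space \<mu>) = 1"
    using em[OF cylinder_in_cyl_alg[of Y "[]"]] fc[of "[]"] sets m1 by simp
  then have "prob_space \<mu>" by (rule prob_spaceI)
  then have "\<mu> \<in> borel_prob_measures Y" using sets by (simp add: borel_prob_measures_iff)
  moreover have "measure \<mu> (cylinder Y w) = m w" for w
    using em[OF cylinder_in_cyl_alg[of Y w]] fc[of w] m0[of w] by (simp add: measure_def)
  ultimately show thesis by (rule that)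
qed

locale shift_space =
  fixes Y :: "(nat \<Rightarrow> 'b::finite) set"
  assumes subshift: "subshift Y"
begin

lemma shift_in: "y \<in> Y \<Longrightarrow> shift_map y \<in> Y"
  using subshift by (auto simp: subshift_def)

lemma funpow_shift_in: "y \<in> Y \<Longrightarrow> (shift_map ^^ k) y \<in> Y"
  by (induction k) (auto intro: shift_in)

lemma shift_vimage_cylinder: "shift_map -` cylinder Y w \<inter> Y = {y \<in> Y. block y 0 (Suc (length w)) \<in> {u. tl u = w}}"
proof -
  have "block (shift_map y) 0 (length w) = tl (block y 0 (Suc (length w)))" for y :: "nat \<Rightarrow> 'b"
    by (simp add: block_Suc block_shift1)
  then show ?thesis by (auto simp: cylinder_iff shift_in)
qed

lemma shift_measurable:
  assumes "\<mu> \<in> borel_prob_measures Y"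
  shows "shift_map \<in> measurable \<mu> \<mu>"
proof (rule measurable_sigma_sets)
  show "sets \<mu> = sigma_sets Y (cyl_alg Y)" "shift_map \<in> space \<mu> \<rightarrow> Y" "cyl_alg Y \<subseteq> Pow Y"
    using assms algebra.axioms(1)[OF algebra_cyl_alg] by (auto simp: borel_prob_measures_iff shift_in cyl_alg_def)
  fix A assume "A \<in> cyl_alg Y"
  then obtain n S where A: "A = {y \<in> Y. block y 0 n \<in> S}" by (auto simp: cyl_alg_def)
  have "block (shift_map y) 0 n = tl (block y 0 (Suc n))" for y :: "nat \<Rightarrow> 'b"
    by (simp add: block_Suc block_shift1)
  then have "shift_map -` A \<inter> Y = {y \<in> Y. block y 0 (Suc n) \<in> {u. tl u \<in> S}}"
    by (auto simp: A shift_in)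
  then show "shift_map -` A \<inter> space \<mu> \<in> sets \<mu>"
    using assms cyl_algI[of Y "Suc n" "{u. tl u \<in> S}"] by (auto simp: borel_prob_measures_iff intro: sigma_sets.Basic)
qed

lemma shift_vimage_measure:
  assumes "\<mu> \<in> borel_prob_measures Y"
  shows "measure \<mu> (shift_map -` cylinder Y w \<inter> Y) = (\<Sum>a\<in>UNIV. measure \<mu> (cylinder Y (a # w)))"
proof -
  have "(\<Sum>u\<in>words (Suc (length w)) \<inter> {u. tl u = w}. measure \<mu> (cylinder Y u)) = (\<Sum>a\<in>UNIV. measure \<mu> (cylinder Y (a # w)))"
    by (rule sum.reindex_bij_witness[where i = "\<lambda>a. a # w" and j = hd])
      (auto simp: words_def length_Suc_conv)
  then show ?thesis unfolding shift_vimage_cylinder measure_block_in[OF assms] .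
qed

lemma measure_preservingI:
  assumes \<mu>: "\<mu> \<in> borel_prob_measures Y"
    and inv: "\<And>w. (\<Sum>a\<in>UNIV. measure \<mu> (cylinder Y (a # w))) = measure \<mu> (cylinder Y w)"
  shows "measure_preserving \<mu> shift_map"
proof -
  note sm = shift_measurable[OF \<mu>]
  interpret prob_space \<mu> using \<mu> by (simp add: borel_prob_measures_iff)
  have sp: "space \<mu> = Y" using \<mu> by (simp add: borel_prob_measures_iff)
  have "distr \<mu> \<mu> shift_map \<in> borel_prob_measures Y"
    using \<mu> prob_space_distr[OF sm] by (simp add: borel_prob_measures_iff)
  moreover have "measure (distr \<mu> \<mu> shift_map) (cylinder Y w) = measure \<mu> (cylinder Y w)" for w
  proof -
    have "cylinder Y w \<in> sets \<mu>"
      using \<mu> by (auto simp: borel_prob_measures_iff intro: sigma_sets.Basic cylinder_in_cyl_alg)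
    then show ?thesis
      using measure_distr[OF sm, of "cylinder Y w"] shift_vimage_measure[OF \<mu>, of w] inv sp by simp
  qed
  ultimately have "distr \<mu> \<mu> shift_map = \<mu>" using \<mu> by (intro cyl_alg_measure_eqI) auto
  then show ?thesis using sm by (simp add: measure_preserving_def)
qed

end

section \<open>Gibbs weights\<close>

text \<open>A cube with countably many coordinates is compact and metrizable, hence sequentially
  compact; this replaces an explicit diagonal argument.\<close>

lemma countable_convergent_subsequence:
  fixes f :: "nat \<Rightarrow> 'c::countable \<Rightarrow> real"
  assumes "\<And>n x. f n x \<in> {0..1}"
  obtains r l where "strict_mono (r :: nat \<Rightarrow> nat)" "\<And>x. (\<lambda>n. f (r n) x) \<longlonglongrightarrow> l x"
proof -
  define K where "K = (Pi\<^sub>E UNIV (\<lambda>_. {0..1}) :: ('c \<Rightarrow> real) set)"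
  have "compactin (product_topology (\<lambda>_. euclidean) UNIV) K"
    unfolding K_def by (subst compactin_PiE) auto
  then have "compact K" by (simp add: euclidean_product_topology)
  then have "seq_compact K" by (simp add: compact_eq_seq_compact_metric)
  moreover have "\<forall>n. f n \<in> K" using assms by (simp add: K_def PiE_def Pi_def)
  ultimately obtain l r where lr: "strict_mono (r :: nat \<Rightarrow> nat)" "(f \<circ> r) \<longlonglongrightarrow> l"
    unfolding seq_compact_def by blast
  have "(\<lambda>n. f (r n) x) \<longlonglongrightarrow> l x" for x
  proof -
    have "isCont (\<lambda>g :: 'c \<Rightarrow> real. g x) l"
      using continuous_on_product_coordinates[of x] continuous_on_eq_continuous_at[OF open_UNIV] by blast
    then show ?thesis
      using isCont_tendsto_compose[OF _ lr(2), of "\<lambda>g. g x"] by (simp add: comp_def)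
  qed
  with lr(1) show thesis by (rule that)
qed

text \<open>An interface to powers of preimage counts. Nonzero weights are at least 1, so the
  logarithms of weights and partition functions are nonnegative, which provides the lower bound that
  Fekete's lemma asks for.\<close>

locale word_weight =
  fixes psi :: "'b::finite list \<Rightarrow> real" and p :: nat
  assumes psi_Nil: "psi [] = 1"
    and psi_ge_1: "\<And>w. psi w \<noteq> 0 \<Longrightarrow> psi w \<ge> 1"
    and psi_submult: "\<And>u v. psi (u @ v) \<le> psi u * psi v"
    and psi_gap: "\<And>u v. psi u * psi v \<le> (\<Sum>w\<in>words p. psi (u @ w @ v))"
    and psi_nontrivial: "\<And>n. \<exists>w\<in>words n. psi w \<noteq> 0"
begin

lemma psi_nonneg [simp]: "0 \<le> psi w"
  using psi_ge_1[of w] by (cases "psi w = 0") auto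

lemma psi_append_nonzero: "psi (u @ v) \<noteq> 0 \<Longrightarrow> psi u \<noteq> 0 \<and> psi v \<noteq> 0"
  using psi_submult[of u v] psi_ge_1[of "u @ v"] by auto

definition Z :: "nat \<Rightarrow> real" where "Z n = (\<Sum>w\<in>words n. psi w)"

lemma Z_0: "Z 0 = 1" by (simp add: Z_def psi_Nil)

lemma Z_ge_1: "Z n \<ge> 1"
proof -
  obtain w where w: "w \<in> words n" "psi w \<noteq> 0" using psi_nontrivial by blast
  then have "1 \<le> psi w" by (simp add: psi_ge_1)
  also have "\<dots> \<le> Z n" unfolding Z_def by (rule member_le_sum) (use w in auto)
  finally show ?thesis .
qed

lemma Z_submult: "Z (m + n) \<le> Z m * Z n"
  unfolding Z_def sum_words_add sum_product by (intro sum_mono psi_submult)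

text \<open>The gap inequality leads to words of length m + p + n; submultiplicativity removes the p
  extra letters again at the price of \<open>Z p\<close>.\<close>

lemma Z_supermult: "Z m * Z n \<le> Z p * Z (m + n)"
proof -
  have "Z m * Z n \<le> (\<Sum>u\<in>words m. \<Sum>v\<in>words n. \<Sum>w\<in>words p. psi (u @ w @ v))"
    unfolding Z_def sum_product by (intro sum_mono psi_gap)
  also have "\<dots> = (\<Sum>u\<in>words m. \<Sum>w\<in>words p. \<Sum>v\<in>words n. psi (u @ w @ v))"
    by (intro sum.cong sum.swap refl)
  also have "\<dots> = Z (m + (p + n))" by (simp add: Z_def sum_words_add)
  also have "\<dots> = Z (p + (m + n))" by (simp add: ac_simps)
  also have "\<dots> \<le> Z p * Z (m + n)" by (rule Z_submult)
  finally show ?thesis .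
qed

section \<open>Pressure and growth of the partition functions\<close>

definition pressure :: real where "pressure = lim (\<lambda>n. ln (Z n) / real n)"

lemma pressure: "(\<lambda>n. ln (Z n) / real n) \<longlonglongrightarrow> pressure"
  and pressure_upper: "real n * pressure \<le> ln (Z n)"
proof -
  have Z0: "0 < Z n" for n using Z_ge_1[of n] by linarith
  obtain L where L: "(\<lambda>n. ln (Z n) / real n) \<longlonglongrightarrow> L" "\<And>n. real n * L \<le> ln (Z n)"
  proof (rule fekete[of "\<lambda>n. ln (Z n)" 0])
    show "ln (Z (m + n)) \<le> ln (Z m) + ln (Z n)" for m n
    proof -
      have "ln (Z (m + n)) \<le> ln (Z m * Z n)"
        using Z_submult[of m n] Z0 by (simp add: ln_le_cancel_iff)
      also have "\<dots> = ln (Z m) + ln (Z n)" using Z0 by (simp add: ln_mult_pos)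
      finally show ?thesis .
    qed
    show "0 \<le> ln (Z n) / real n" for n using Z_ge_1 by simp
  qed auto
  then have "pressure = L" unfolding pressure_def by (intro limI)
  then show "(\<lambda>n. ln (Z n) / real n) \<longlonglongrightarrow> pressure" "real n * pressure \<le> ln (Z n)"
    using L by auto
qed

lemma pressure_nonneg: "0 \<le> pressure"
  by (rule LIMSEQ_le_const[OF pressure]) (use Z_ge_1 in auto)

definition K where "K = Z p"

lemma K_ge_1: "K \<ge> 1" by (simp add: K_def Z_ge_1)

lemma Z_lower: "exp (real n * pressure) \<le> Z n"
proof -
  have "exp (real n * pressure) \<le> exp (ln (Z n))" by (simp add: pressure_upper)
  also have "\<dots> = Z n" using Z_ge_1[of n] by simp
  finally show ?thesis .
qed

text \<open>Supermultiplicativity up to \<open>K\<close>, iterated along multiples of n, bounds (ln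
  (Z n) - ln K) / n by ln (Z (k n)) / (k n), which tends to the pressure as k grows.\<close>

lemma Z_upper: "Z n \<le> K * exp (real n * pressure)"
proof (cases "n = 0")
  case True
  then show ?thesis using Z_0 K_ge_1 by simp
next
  case False
  have Z0: "0 < Z n" for n using Z_ge_1[of n] by linarith
  have K0: "0 < K" using K_ge_1 by simp
  have step: "real k * (ln (Z n) - ln K) \<le> ln (Z (k * n))" for k
  proof (induction k)
    case (Suc k)
    have "ln (Z n) + ln (Z (k * n)) = ln (Z n * Z (k * n))" using Z0 by (simp add: ln_mult_pos)
    also have "\<dots> \<le> ln (K * Z (n + k * n))"
      using Z_supermult[of n "k * n"] Z0 K0 by (subst ln_le_cancel_iff) (auto simp: K_def)
    also have "\<dots> = ln K + ln (Z (Suc k * n))" using Z0 K0 by (simp add: ln_mult_pos)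
    finally show ?case using Suc by (simp add: algebra_simps)
  qed (simp add: Z_0)
  have "strict_mono (\<lambda>k. k * n)" using False by (simp add: strict_mono_def)
  from LIMSEQ_subseq_LIMSEQ[OF pressure this]
  have "(\<lambda>k. ln (Z (k * n)) / real (k * n)) \<longlonglongrightarrow> pressure" by (simp add: comp_def)
  moreover have "(ln (Z n) - ln K) / real n \<le> ln (Z (k * n)) / real (k * n)" if "k \<ge> 1" for k
  proof -
    have "(ln (Z n) - ln K) / real n = real k * (ln (Z n) - ln K) / real (k * n)"
      using that False by simp
    also have "\<dots> \<le> ln (Z (k * n)) / real (k * n)" by (intro divide_right_mono step) simp
    finally show ?thesis .
  qed
  ultimately have "(ln (Z n) - ln K) / real n \<le> pressure" by (intro LIMSEQ_le_const) auto
  then have "ln (Z n) \<le> ln K + real n * pressure" using False by (simp add: field_simps)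
  then have "exp (ln (Z n)) \<le> exp (ln K + real n * pressure)" by (simp only: exp_le_cancel_iff)
  then show ?thesis using Z0 K0 by (simp add: exp_add)
qed

text \<open>Two gaps around a free middle word of length n. Summing over that word gives the factor
  \<open>Z n\<close>, so every separation from 2 p on is available.\<close>

lemma psi_gap_Z:
  "psi u * psi v * Z n \<le> (\<Sum>w\<in>words (p + (n + p)). psi (u @ w @ v))"
proof -
  have "psi u * psi v * Z n = (\<Sum>w\<in>words n. psi u * (psi w * psi v))"
    by (simp add: Z_def sum_distrib_left mult_ac)
  also have "\<dots> \<le> (\<Sum>w\<in>words n. psi u * (\<Sum>x\<in>words p. psi (w @ x @ v)))"
    by (intro sum_mono mult_left_mono psi_gap) simp
  also have "\<dots> = (\<Sum>w\<in>words n. \<Sum>x\<in>words p. psi u * psi (w @ x @ v))"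
    by (simp add: sum_distrib_left)
  also have "\<dots> \<le> (\<Sum>w\<in>words n. \<Sum>x\<in>words p. \<Sum>s\<in>words p. psi (u @ s @ w @ x @ v))"
    by (intro sum_mono psi_gap)
  also have "\<dots> = (\<Sum>w\<in>words n. \<Sum>s\<in>words p. \<Sum>x\<in>words p. psi (u @ s @ w @ x @ v))"
    by (intro sum.cong sum.swap refl)
  also have "\<dots> = (\<Sum>s\<in>words p. \<Sum>w\<in>words n. \<Sum>x\<in>words p. psi (u @ s @ w @ x @ v))"
    by (rule sum.swap)
  also have "\<dots> = (\<Sum>w\<in>words (p + (n + p)). psi (u @ w @ v))"
    by (simp only: sum_words_add append_assoc)
  finally show ?thesis .
qed

section \<open>Weight of a word at a position inside long words\<close>

definition pos_weight :: "nat \<Rightarrow> nat \<Rightarrow> 'b list \<Rightarrow> real" where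
  "pos_weight N j w = (\<Sum>v\<in>words N. if take (length w) (drop j v) = w then psi v else 0) / Z N"

lemma pos_weight_nonneg: "0 \<le> pos_weight N j w"
  unfolding pos_weight_def using Z_ge_1[of N] by (intro divide_nonneg_nonneg sum_nonneg) auto

lemma pos_weight_le_1: "pos_weight N j w \<le> 1"
proof -
  have "(\<Sum>v\<in>words N. if take (length w) (drop j v) = w then psi v else 0) \<le> Z N"
    unfolding Z_def by (intro sum_mono) auto
  then show ?thesis using Z_ge_1[of N] by (simp add: pos_weight_def)
qed

lemma pos_weight_Nil: "pos_weight N j [] = 1"
  using Z_ge_1[of N] by (simp add: pos_weight_def Z_def)

lemma pos_weight_snoc:
  assumes "j + length w < N"
  shows "(\<Sum>a\<in>UNIV. pos_weight N j (w @ [a])) = pos_weight N j w"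
proof -
  have "(\<Sum>a\<in>UNIV. if take (Suc (length w)) (drop j v) = w @ [a] then psi v else 0)
      = (if take (length w) (drop j v) = w then psi v else 0)" if "v \<in> words N" for v
  proof -
    have "take (Suc (length w)) (drop j v) = take (length w) (drop j v) @ [v ! (j + length w)]"
      using assms that by (simp add: words_def take_Suc_conv_app_nth)
    then have "(take (Suc (length w)) (drop j v) = w @ [a]) \<longleftrightarrow>
        (take (length w) (drop j v) = w \<and> a = v ! (j + length w))" for a by auto
    then show ?thesis by (cases "take (length w) (drop j v) = w") (simp_all add: sum.delta)
  qed
  then have "(\<Sum>v\<in>words N. \<Sum>a\<in>UNIV. if take (Suc (length w)) (drop j v) = w @ [a] then psi v else 0)
      = (\<Sum>v\<in>words N. if take (length w) (drop j v) = w then psi v else 0)"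
    by (rule sum.cong[OF refl])
  then have "(\<Sum>a\<in>UNIV. \<Sum>v\<in>words N. if take (Suc (length w)) (drop j v) = w @ [a] then psi v else 0)
      = (\<Sum>v\<in>words N. if take (length w) (drop j v) = w then psi v else 0)"
    by (subst sum.swap)
  then show ?thesis
    by (simp add: pos_weight_def sum_divide_distrib[symmetric])
qed

lemma pos_weight_Cons:
  assumes "j + length w < N"
  shows "(\<Sum>a\<in>UNIV. pos_weight N j (a # w)) = pos_weight N (Suc j) w"
proof -
  have "(\<Sum>a\<in>UNIV. if take (Suc (length w)) (drop j v) = a # w then psi v else 0)
      = (if take (length w) (drop (Suc j) v) = w then psi v else 0)" if "v \<in> words N" for v
  proof -
    have "drop j v = v ! j # drop (Suc j) v"
      using assms that by (simp add: words_def Cons_nth_drop_Suc)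
    then have "(take (Suc (length w)) (drop j v) = a # w) \<longleftrightarrow>
        (take (length w) (drop (Suc j) v) = w \<and> a = v ! j)" for a by auto
    then show ?thesis by (cases "take (length w) (drop (Suc j) v) = w") (simp_all add: sum.delta)
  qed
  then have "(\<Sum>v\<in>words N. \<Sum>a\<in>UNIV. if take (Suc (length w)) (drop j v) = a # w then psi v else 0)
      = (\<Sum>v\<in>words N. if take (length w) (drop (Suc j) v) = w then psi v else 0)"
    by (rule sum.cong[OF refl])
  then have "(\<Sum>a\<in>UNIV. \<Sum>v\<in>words N. if take (Suc (length w)) (drop j v) = a # w then psi v else 0)
      = (\<Sum>v\<in>words N. if take (length w) (drop (Suc j) v) = w then psi v else 0)"
    by (subst sum.swap)
  then show ?thesis
    by (simp add: pos_weight_def sum_divide_distrib[symmetric])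
qed

lemma pos_weight_eq: "pos_weight (j + (length w + r)) j w = (\<Sum>u\<in>words j. \<Sum>x\<in>words r. psi (u @ w @ x)) / Z (j + (length w + r))"
proof -
  have "(\<Sum>v\<in>words (length w). \<Sum>x\<in>words r. if take (length w) (drop j (u @ v @ x)) = w then psi (u @ v @ x) else 0)
      = (\<Sum>x\<in>words r. psi (u @ w @ x))" if "u \<in> words j" for u
  proof -
    have "(\<Sum>v\<in>words (length w). \<Sum>x\<in>words r. if take (length w) (drop j (u @ v @ x)) = w then psi (u @ v @ x) else 0)
      = (\<Sum>v\<in>words (length w). if v = w then \<Sum>x\<in>words r. psi (u @ w @ x) else 0)"
      using that by (intro sum.cong) (auto simp: words_def)
    also have "\<dots> = (\<Sum>x\<in>words r. psi (u @ w @ x))"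
      by (simp add: sum.delta') (simp add: words_def)
    finally show ?thesis .
  qed
  then show ?thesis by (simp add: pos_weight_def sum_words_add)
qed

text \<open>Cutting at both ends of \<open>w\<close> leaves \<open>Z j\<close> and
  \<open>Z r\<close>, each of which costs a factor \<open>K\<close> against the exponential, whereas
  \<open>Z N\<close> is bounded below without loss; hence K^2.\<close>

lemma pos_weight_upper:
  assumes "j + length w \<le> N"
  shows "pos_weight N j w \<le> K^2 * (psi w * exp (- (real (length w) * pressure)))"
proof -
  define r where "r = N - j - length w"
  have N: "N = j + (length w + r)" using assms by (simp add: r_def)
  define P where "P = pressure"
  have "(\<Sum>u\<in>words j. \<Sum>x\<in>words r. psi (u @ w @ x)) \<le> (\<Sum>u\<in>words j. \<Sum>x\<in>words r. psi u * (psi w * psi x))"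
    by (intro sum_mono order_trans[OF psi_submult] mult_left_mono psi_submult psi_nonneg)
  also have "\<dots> = Z j * psi w * Z r"
    by (simp add: Z_def sum_distrib_left sum_distrib_right mult_ac)
  also have "\<dots> \<le> (K * exp (real j * P)) * psi w * (K * exp (real r * P))"
    unfolding P_def using Z_ge_1[of r] Z_ge_1[of j] K_ge_1
    by (intro mult_mono Z_upper) (auto intro: mult_nonneg_nonneg)
  also have "\<dots> = K^2 * psi w * (exp (real j * P) * exp (real r * P))"
    by (simp add: power2_eq_square mult_ac)
  also have "exp (real j * P) * exp (real r * P) = exp (- (real (length w) * P)) * exp (real N * P)"
    by (simp add: N mult_exp_exp algebra_simps)
  also have "K^2 * psi w * \<dots> = K^2 * (psi w * exp (- (real (length w) * P))) * exp (real N * P)"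
    by (simp only: mult_ac)
  also have "\<dots> \<le> K^2 * (psi w * exp (- (real (length w) * P))) * Z N"
    unfolding P_def by (intro mult_left_mono Z_lower) auto
  finally show ?thesis
    using Z_ge_1[of N] pos_weight_eq[of j w r] unfolding N[symmetric] P_def by (simp add: divide_le_eq)
qed

text \<open>The exponential pays for the two gaps around a word, and 1 / K for bounding
  \<open>Z N\<close> from above.\<close>

definition c0 where "c0 = exp (- (2 * real p * pressure)) / K"

lemma c0_pos: "0 < c0" using K_ge_1 by (simp add: c0_def)

lemma c0_le_1: "c0 \<le> 1"
proof -
  have "exp (- (2 * real p * pressure)) / K \<le> 1 / 1"
    using pressure_nonneg K_ge_1 by (intro frac_le) auto
  then show ?thesis by (simp add: c0_def)
qed

text \<open>A gap of p letters on each side decouples \<open>w\<close> from its surroundings, which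
  is why p letters must be available to its left and to its right.\<close>

lemma pos_weight_lower:
  assumes "j + length w + p \<le> N" "p \<le> j"
  shows "c0 * (psi w * exp (- (real (length w) * pressure))) \<le> pos_weight N j w"
proof -
  define i where "i = j - p"
  define r where "r = N - j - length w - p"
  have j: "j = i + p" using assms by (simp add: i_def)
  have N: "N = j + (length w + (p + r))" using assms by (simp add: r_def)
  define P where "P = pressure"
  have "c0 * (psi w * exp (- (real (length w) * P))) * Z N
      \<le> c0 * (psi w * exp (- (real (length w) * P))) * (K * exp (real N * P))"
    unfolding P_def using c0_pos by (intro mult_left_mono Z_upper) auto
  also have "\<dots> = psi w * (exp (- (2 * real p * P)) * (exp (- (real (length w) * P)) * exp (real N * P)))"
    using K_ge_1 by (simp add: c0_def P_def[symmetric])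
  also have "exp (- (2 * real p * P)) * (exp (- (real (length w) * P)) * exp (real N * P))
      = exp (real i * P) * exp (real r * P)"
    by (simp add: N j mult_exp_exp algebra_simps)
  also have "psi w * \<dots> = exp (real i * P) * psi w * exp (real r * P)"
    by (simp only: mult_ac)
  also have "\<dots> \<le> Z i * psi w * Z r"
    unfolding P_def by (intro mult_mono Z_lower) (use Z_ge_1[of i] in auto)
  also have "\<dots> = (\<Sum>u\<in>words i. \<Sum>x\<in>words r. psi u * (psi w * psi x))"
    by (simp add: Z_def sum_distrib_left sum_distrib_right mult_ac)
  also have "\<dots> \<le> (\<Sum>u\<in>words i. \<Sum>x\<in>words r. psi u * (\<Sum>t\<in>words p. psi (w @ t @ x)))"
    by (intro sum_mono mult_left_mono psi_gap psi_nonneg)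
  also have "\<dots> = (\<Sum>u\<in>words i. \<Sum>x\<in>words r. \<Sum>t\<in>words p. psi u * psi (w @ t @ x))"
    by (simp add: sum_distrib_left)
  also have "\<dots> \<le> (\<Sum>u\<in>words i. \<Sum>x\<in>words r. \<Sum>t\<in>words p. \<Sum>s\<in>words p. psi (u @ s @ w @ t @ x))"
    by (intro sum_mono psi_gap)
  also have "\<dots> = (\<Sum>u\<in>words i. \<Sum>s\<in>words p. \<Sum>t\<in>words p. \<Sum>x\<in>words r. psi (u @ s @ w @ t @ x))"
  proof (rule sum.cong[OF refl])
    fix u
    have "(\<Sum>x\<in>words r. \<Sum>t\<in>words p. \<Sum>s\<in>words p. psi (u @ s @ w @ t @ x))
        = (\<Sum>t\<in>words p. \<Sum>x\<in>words r. \<Sum>s\<in>words p. psi (u @ s @ w @ t @ x))" by (rule sum.swap)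
    also have "\<dots> = (\<Sum>t\<in>words p. \<Sum>s\<in>words p. \<Sum>x\<in>words r. psi (u @ s @ w @ t @ x))"
      by (intro sum.cong sum.swap refl)
    also have "\<dots> = (\<Sum>s\<in>words p. \<Sum>t\<in>words p. \<Sum>x\<in>words r. psi (u @ s @ w @ t @ x))" by (rule sum.swap)
    finally show "(\<Sum>x\<in>words r. \<Sum>t\<in>words p. \<Sum>s\<in>words p. psi (u @ s @ w @ t @ x)) = \<dots>" .
  qed
  also have "\<dots> = (\<Sum>u\<in>words j. \<Sum>x\<in>words (p + r). psi (u @ w @ x))"
    by (simp only: j sum_words_add append_assoc)
  also have "\<dots> = pos_weight N j w * Z N"
    using pos_weight_eq[of j w "p + r"] Z_ge_1[of N] unfolding N[symmetric] by simp
  finally show ?thesis using Z_ge_1[of N] by (simp add: P_def)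
qed

lemma gibbs_weights_exist:
  obtains m :: "'b list \<Rightarrow> real" where "m [] = 1"
    "\<And>w. (\<Sum>a\<in>UNIV. m (w @ [a])) = m w" "\<And>w. (\<Sum>a\<in>UNIV. m (a # w)) = m w"
    "\<And>w. c0 * (psi w * exp (- (real (length w) * pressure))) \<le> m w"
    "\<And>w. m w \<le> K^2 * (psi w * exp (- (real (length w) * pressure)))"
proof -
  \<comment> \<open>Averages over the N leading positions in words of length 2 N. Once N exceeds the
    length of \<open>w\<close>, each such position leaves room for \<open>w\<close> and one more
    letter, so consistency on the right is exact and invariance fails only by boundary
    terms.\<close>
  define f where "f N w = (\<Sum>j<N. pos_weight (2 * N) j w) / real N" for N w
  have f01: "f N w \<in> {0..1}" for N w
  proof -
    have "(\<Sum>j<N. pos_weight (2 * N) j w) \<le> (\<Sum>j<N. 1)" by (intro sum_mono pos_weight_le_1)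
    moreover have "0 \<le> (\<Sum>j<N. pos_weight (2 * N) j w)" by (intro sum_nonneg pos_weight_nonneg)
    ultimately show ?thesis by (auto simp: f_def divide_le_eq)
  qed
  obtain r m where r: "strict_mono (r :: nat \<Rightarrow> nat)" and m: "\<And>w. (\<lambda>n. f (r n) w) \<longlonglongrightarrow> m w"
    using countable_convergent_subsequence[of f] f01 by blast
  have ev: "\<forall>\<^sub>F n in sequentially. k \<le> r n" for k
    using filterlim_subseq[OF r] by (simp add: filterlim_at_top)
  have inv: "(\<lambda>n. inverse (real (r n))) \<longlonglongrightarrow> 0"
    using LIMSEQ_subseq_LIMSEQ[OF lim_inverse_n r] by (simp add: comp_def)
  show thesis
  proof (rule that)
    have "\<forall>\<^sub>F n in sequentially. f (r n) [] = 1"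
      using ev[of 1] by eventually_elim (simp add: f_def pos_weight_Nil)
    then have "(\<lambda>n. f (r n) []) \<longlonglongrightarrow> 1" by (rule tendsto_eventually)
    then show "m [] = 1" using m LIMSEQ_unique by blast
  next
    fix w
    have "\<forall>\<^sub>F n in sequentially. (\<Sum>a\<in>UNIV. f (r n) (w @ [a])) = f (r n) w"
      using ev[of "Suc (length w)"]
    proof eventually_elim
      case (elim n)
      have "(\<Sum>a\<in>UNIV. f (r n) (w @ [a])) = (\<Sum>j<r n. \<Sum>a\<in>UNIV. pos_weight (2 * r n) j (w @ [a])) / real (r n)"
        unfolding f_def by (simp add: sum_divide_distrib[symmetric] sum.swap[of _ UNIV])
      also have "\<dots> = f (r n) w"
        unfolding f_def using elim by (intro arg_cong2[where f = "(/)"] sum.cong refl pos_weight_snoc) auto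
      finally show ?case .
    qed
    moreover have "(\<lambda>n. \<Sum>a\<in>UNIV. f (r n) (w @ [a])) \<longlonglongrightarrow> (\<Sum>a\<in>UNIV. m (w @ [a]))"
      by (intro tendsto_sum m)
    ultimately have "(\<lambda>n. f (r n) w) \<longlonglongrightarrow> (\<Sum>a\<in>UNIV. m (w @ [a]))"
      by (rule Lim_transform_eventually[rotated])
    then show "(\<Sum>a\<in>UNIV. m (w @ [a])) = m w" using m LIMSEQ_unique by blast
  next
    fix w
    have "\<forall>\<^sub>F n in sequentially. norm ((\<Sum>a\<in>UNIV. f (r n) (a # w)) - f (r n) w) \<le> inverse (real (r n))"
      using ev[of "Suc (length w)"]
    proof eventually_elim
      case (elim n)
      have "(\<Sum>a\<in>UNIV. f (r n) (a # w)) = (\<Sum>j<r n. \<Sum>a\<in>UNIV. pos_weight (2 * r n) j (a # w)) / real (r n)"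
        unfolding f_def by (simp add: sum_divide_distrib[symmetric] sum.swap[of _ UNIV])
      also have "\<dots> = (\<Sum>j<r n. pos_weight (2 * r n) (Suc j) w) / real (r n)"
        using elim by (intro arg_cong2[where f = "(/)"] sum.cong refl pos_weight_Cons) auto
      finally have "(\<Sum>a\<in>UNIV. f (r n) (a # w)) - f (r n) w
          = (\<Sum>j<r n. pos_weight (2 * r n) (Suc j) w - pos_weight (2 * r n) j w) / real (r n)"
        by (simp add: f_def sum_subtractf diff_divide_distrib)
      \<comment> \<open>Prepending a letter moves the position by one, so the averaged difference
        telescopes; the two remaining terms lie in [0, 1].\<close>
      also have "\<dots> = (pos_weight (2 * r n) (r n) w - pos_weight (2 * r n) 0 w) / real (r n)"
        using sum_lessThan_telescope[of "\<lambda>j. pos_weight (2 * r n) j w" "r n"] by simp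
      finally have "norm ((\<Sum>a\<in>UNIV. f (r n) (a # w)) - f (r n) w)
          = \<bar>pos_weight (2 * r n) (r n) w - pos_weight (2 * r n) 0 w\<bar> / real (r n)" by simp
      also have "\<dots> \<le> 1 / real (r n)"
        using pos_weight_nonneg[of "2 * r n" "r n" w] pos_weight_le_1[of "2 * r n" "r n" w]
          pos_weight_nonneg[of "2 * r n" 0 w] pos_weight_le_1[of "2 * r n" 0 w]
        by (intro divide_right_mono) auto
      finally show ?case by (simp add: inverse_eq_divide)
    qed
    from Lim_null_comparison[OF this inv]
    have "(\<lambda>n. (\<Sum>a\<in>UNIV. f (r n) (a # w)) - f (r n) w) \<longlonglongrightarrow> 0" .
    moreover have "(\<lambda>n. (\<Sum>a\<in>UNIV. f (r n) (a # w)) - f (r n) w) \<longlonglongrightarrow> (\<Sum>a\<in>UNIV. m (a # w)) - m w"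
      by (intro tendsto_diff tendsto_sum m)
    ultimately have "(\<Sum>a\<in>UNIV. m (a # w)) - m w = 0" using LIMSEQ_unique by blast
    then show "(\<Sum>a\<in>UNIV. m (a # w)) = m w" by simp
  next
    fix w
    let ?b = "psi w * exp (- (real (length w) * pressure))"
    have "\<forall>\<^sub>F n in sequentially. (1 - real p * inverse (real (r n))) * (c0 * ?b) \<le> f (r n) w"
      using ev[of "Suc (length w + p)"]
    proof eventually_elim
      case (elim n)
      \<comment> \<open>Positions below p lack a full gap on the left and are dropped. They form a
        fraction of the positions that vanishes in the limit.\<close>
      have "(real (r n) - real p) * (c0 * ?b) = (\<Sum>j\<in>{p..<r n}. c0 * ?b)" using elim by (simp add: of_nat_diff)
      also have "\<dots> \<le> (\<Sum>j\<in>{p..<r n}. pos_weight (2 * r n) j w)" using elim by (intro sum_mono pos_weight_lower) auto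
      also have "\<dots> \<le> (\<Sum>j<r n. pos_weight (2 * r n) j w)" by (intro sum_mono2 pos_weight_nonneg) auto
      finally have "(real (r n) - real p) * (c0 * ?b) / real (r n) \<le> f (r n) w"
        unfolding f_def by (rule divide_right_mono) simp
      moreover have "(real (r n) - real p) * (c0 * ?b) / real (r n) = (1 - real p * inverse (real (r n))) * (c0 * ?b)"
        using elim by (simp add: field_simps)
      ultimately show ?case by simp
    qed
    moreover have "(\<lambda>n. (1 - real p * inverse (real (r n))) * (c0 * ?b)) \<longlonglongrightarrow> (1 - real p * 0) * (c0 * ?b)"
      by (intro tendsto_intros inv)
    ultimately have "(1 - real p * 0) * (c0 * ?b) \<le> m w"
      by (intro tendsto_le[OF sequentially_bot m])
    then show "c0 * ?b \<le> m w" by simp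
  next
    fix w
    let ?b = "psi w * exp (- (real (length w) * pressure))"
    have "\<forall>\<^sub>F n in sequentially. f (r n) w \<le> K^2 * ?b"
      using ev[of "Suc (length w)"]
    proof eventually_elim
      case (elim n)
      have "(\<Sum>j<r n. pos_weight (2 * r n) j w) \<le> (\<Sum>j<r n. K^2 * ?b)" using elim by (intro sum_mono pos_weight_upper) auto
      then show ?case using elim by (simp add: f_def divide_le_eq mult_ac)
    qed
    then show "m w \<le> K^2 * ?b" by (intro tendsto_upperbound[OF m]) auto
  qed
qed

end

section \<open>Invariant measures of subshifts\<close>

context shift_space
begin

lemma invariant_imp_prob_preserving: "\<nu> \<in> invariant_measures Y \<Longrightarrow> prob_preserving \<nu> shift_map"
  by (simp add: invariant_measures_def borel_prob_measures_iff prob_preserving_def prob_preserving_axioms_def)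

lemma invariant_imp_borel: "\<nu> \<in> invariant_measures Y \<Longrightarrow> \<nu> \<in> borel_prob_measures Y"
  by (simp add: invariant_measures_def)

lemma cyl_alg_sets: "\<nu> \<in> borel_prob_measures Y \<Longrightarrow> A \<in> cyl_alg Y \<Longrightarrow> A \<in> sets \<nu>"
  by (simp add: borel_prob_measures_iff sigma_sets.Basic)

lemma measure_block_if:
  assumes "\<nu> \<in> borel_prob_measures Y"
  shows "measure \<nu> {y \<in> Y. block y 0 n \<in> S} = (\<Sum>w\<in>words n. if w \<in> S then measure \<nu> (cylinder Y w) else 0)"
  by (simp add: measure_block_in[OF assms] sum.inter_restrict)

lemma measure_block_total:
  assumes "\<nu> \<in> borel_prob_measures Y"
  shows "(\<Sum>w\<in>words n. measure \<nu> (cylinder Y w)) = 1"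
proof -
  interpret prob_space \<nu> using assms by (simp add: borel_prob_measures_iff)
  show ?thesis
    using measure_block_in[OF assms, of n UNIV] prob_space assms by (simp add: borel_prob_measures_iff)
qed

lemma sum_measure_append_right:
  assumes "\<nu> \<in> borel_prob_measures Y"
  shows "(\<Sum>v\<in>words n. measure \<nu> (cylinder Y (u @ v))) = measure \<nu> (cylinder Y u)"
proof -
  have "cylinder Y u = {y \<in> Y. block y 0 (length u + n) \<in> {w. take (length u) w = u}}"
    by (auto simp: cylinder_iff take_block)
  then have "measure \<nu> (cylinder Y u) = (\<Sum>w\<in>words (length u + n). if take (length u) w = u then measure \<nu> (cylinder Y w) else 0)"
    using measure_block_if[OF assms, of "length u + n" "{w. take (length u) w = u}"] by simp
  also have "\<dots> = (\<Sum>x\<in>words (length u). \<Sum>v\<in>words n. if x = u then measure \<nu> (cylinder Y (x @ v)) else 0)"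
    unfolding sum_words_add by (intro sum.cong) (auto simp: words_def)
  also have "\<dots> = (\<Sum>x\<in>words (length u). if x = u then \<Sum>v\<in>words n. measure \<nu> (cylinder Y (u @ v)) else 0)"
    by (intro sum.cong) auto
  also have "\<dots> = (\<Sum>v\<in>words n. measure \<nu> (cylinder Y (u @ v)))"
    by (simp add: sum.delta') (simp add: words_def)
  finally show ?thesis by simp
qed

text \<open>The sum is the measure of the m-th preimage of the cylinder of \<open>v\<close>, so
  invariance of \<nu> gives the claim.\<close>

lemma sum_measure_append_left:
  assumes "\<nu> \<in> invariant_measures Y"
  shows "(\<Sum>u\<in>words m. measure \<nu> (cylinder Y (u @ v))) = measure \<nu> (cylinder Y v)"
proof -
  note \<nu> = invariant_imp_borel[OF assms]
  interpret prob_preserving \<nu> shift_map by (rule invariant_imp_prob_preserving[OF assms])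
  have sp: "space \<nu> = Y" using \<nu> by (simp add: borel_prob_measures_iff)
  have "block y 0 (m + length v) = block y 0 m @ block y m (length v)" for y :: "nat \<Rightarrow> 'b"
    using block_add[of y 0 m "length v"] by simp
  then have "(shift_map ^^ m) -` cylinder Y v \<inter> space \<nu> = {y \<in> Y. block y 0 (m + length v) \<in> {w. drop m w = v}}"
    by (auto simp: sp cylinder_iff block_shift funpow_shift_in)
  then have "measure \<nu> (cylinder Y v) = (\<Sum>w\<in>words (m + length v). if drop m w = v then measure \<nu> (cylinder Y w) else 0)"
    using measure_block_if[OF \<nu>, of "m + length v" "{w. drop m w = v}"]
      prob_Tn[OF cyl_alg_sets[OF \<nu> cylinder_in_cyl_alg], of m v] by simp
  also have "\<dots> = (\<Sum>u\<in>words m. \<Sum>x\<in>words (length v). if x = v then measure \<nu> (cylinder Y (u @ x)) else 0)"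
    unfolding sum_words_add by (intro sum.cong) (auto simp: words_def)
  also have "\<dots> = (\<Sum>u\<in>words m. measure \<nu> (cylinder Y (u @ v)))"
    by (simp add: sum.delta') (simp add: words_def)
  finally show ?thesis by simp
qed

lemma integral_block_function:
  assumes \<nu>: "\<nu> \<in> borel_prob_measures Y" and f: "\<And>y. y \<in> Y \<Longrightarrow> f y = g (block y 0 n)"
  shows "(\<integral>y. f y \<partial>\<nu>) = (\<Sum>w\<in>words n. measure \<nu> (cylinder Y w) * g w)"
proof -
  interpret prob_space \<nu> using \<nu> by (simp add: borel_prob_measures_iff)
  have sp: "space \<nu> = Y" using \<nu> by (simp add: borel_prob_measures_iff)
  have "(\<integral>y. f y \<partial>\<nu>) = (\<integral>y. (\<Sum>w\<in>words n. g w * indicator (cylinder Y w) y) \<partial>\<nu>)"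
  proof (rule Bochner_Integration.integral_cong[OF refl])
    fix y assume "y \<in> space \<nu>"
    then have y: "y \<in> Y" by (simp add: sp)
    have "(\<Sum>w\<in>words n. g w * indicator (cylinder Y w) y) = (\<Sum>w\<in>words n. if w = block y 0 n then g w else 0)"
      using y by (intro sum.cong) (auto simp: indicator_def cylinder_iff words_def)
    also have "\<dots> = g (block y 0 n)" by (simp add: sum.delta)
    finally show "f y = (\<Sum>w\<in>words n. g w * indicator (cylinder Y w) y)" using f[OF y] by simp
  qed
  also have "\<dots> = (\<Sum>w\<in>words n. g w * measure \<nu> (cylinder Y w))"
    using cyl_alg_sets[OF \<nu> cylinder_in_cyl_alg]
    by (subst Bochner_Integration.integral_sum)
      (auto intro!: integrable_mult_right integrable_real_indicator simp: less_top[symmetric] cylinder_def sp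
        intro!: sum.cong arg_cong[of _ _ "measure \<nu>"])
  finally show ?thesis by (simp add: mult.commute)
qed

lemma itin_first_symbol: "itin shift_map (\<lambda>y. y 0) n y = block y 0 n"
  by (simp add: itin_def block_def shift_funpow)

lemma simple_first_symbol:
  assumes "\<nu> \<in> borel_prob_measures Y"
  shows "simple_function \<nu> (\<lambda>y. y 0)"
proof -
  have sp: "space \<nu> = Y" using assms by (simp add: borel_prob_measures_iff)
  have "(\<lambda>y. y 0) -` {v} \<inter> space \<nu> = {y \<in> Y. block y 0 1 \<in> {[v]}}" for v
    by (auto simp: sp block_def)
  then have "(\<lambda>y. y 0) -` {v} \<inter> space \<nu> \<in> sets \<nu>" for v
    by (simp only: cyl_alg_sets[OF assms cyl_algI])
  then show ?thesis by (simp add: simple_function_def)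
qed

lemma ent_block:
  assumes "\<nu> \<in> borel_prob_measures Y"
  shows "ent \<nu> (itin shift_map (\<lambda>y. y 0) n) = (\<Sum>w\<in>words n. eta (measure \<nu> (cylinder Y w)))"
proof -
  have sp: "space \<nu> = Y" using assms by (simp add: borel_prob_measures_iff)
  have "law \<nu> (itin shift_map (\<lambda>y. y 0) n) w = measure \<nu> (cylinder Y w)" if "w \<in> words n" for w
  proof -
    have "itin shift_map (\<lambda>y. y 0) n -` {w} \<inter> space \<nu> = cylinder Y w"
      using that by (auto simp: sp itin_first_symbol cylinder_iff words_def)
    then show ?thesis by (simp add: law_def)
  qed
  then show ?thesis
    by (subst ent_superset[of "words n"]) (auto simp: itin_first_symbol)
qed

text \<open>Names under the first-symbol map are initial blocks, so the events decided by names form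
  \<open>cyl_alg\<close>, which approximates every Borel set.\<close>

lemma KS_entropy_shift:
  assumes "\<nu> \<in> invariant_measures Y"
  shows "KS_entropy \<nu> shift_map = ereal (prob_preserving.entropy_rate \<nu> shift_map (\<lambda>y. y 0))"
proof -
  note \<nu> = invariant_imp_borel[OF assms]
  interpret prob_preserving \<nu> shift_map by (rule invariant_imp_prob_preserving[OF assms])
  have sp: "space \<nu> = Y" using \<nu> by (simp add: borel_prob_measures_iff)
  show ?thesis
  proof (rule KS_entropy_generator[OF simple_first_symbol[OF \<nu>]])
    fix A and e :: real assume A: "A \<in> events" and e: "e > 0"
    have s: "sets \<nu> = sigma_sets Y (cyl_alg Y)" using \<nu> by (simp add: borel_prob_measures_iff)
    obtain B where B: "B \<in> cyl_alg Y" "prob ((A - B) \<union> (B - A)) < e"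
      using approx_by_generating_algebra[OF finite_measure_axioms s finite_measure_axioms s algebra_cyl_alg _ e]
        A s by blast
    then obtain n S where "B = {y \<in> Y. block y 0 n \<in> S}" by (auto simp: cyl_alg_def)
    then have "B = {x \<in> space \<nu>. itin shift_map (\<lambda>y. y 0) n x \<in> S}" by (simp add: sp itin_first_symbol)
    then show "\<exists>k S. prob ((A - {x \<in> space \<nu>. itin shift_map (\<lambda>y. y 0) k x \<in> S}) \<union>
        ({x \<in> space \<nu>. itin shift_map (\<lambda>y. y 0) k x \<in> S} - A)) < e"
      using B(2) by blast
  qed
qed

text \<open>The Fenchel inequality \<open>x ln (x / y) - x + y \<ge> x ln t - y (t - 1)\<close>, summed over the words in \<open>S\<close>.\<close>

lemma relative_entropy_bound:
  assumes \<nu>: "\<nu> \<in> borel_prob_measures Y" and \<mu>: "\<mu> \<in> borel_prob_measures Y" and "t \<ge> 1"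
    and ac: "\<And>w. measure \<mu> (cylinder Y w) = 0 \<Longrightarrow> measure \<nu> (cylinder Y w) = 0"
  shows "measure \<nu> {y \<in> Y. block y 0 n \<in> S} * ln t \<le>
    (\<Sum>w\<in>words n. measure \<nu> (cylinder Y w) * (ln (measure \<nu> (cylinder Y w)) - ln (measure \<mu> (cylinder Y w))))
    + (t - 1) * measure \<mu> {y \<in> Y. block y 0 n \<in> S}"
proof -
  define x y where "x w = measure \<nu> (cylinder Y w)" and "y w = measure \<mu> (cylinder Y w)" for w
  have nn: "0 \<le> x w" "0 \<le> y w" for w by (auto simp: x_def y_def)
  have key: "x w * ln s - (s - 1) * y w \<le> x w * (ln (x w) - ln (y w)) - x w + y w" if "s \<ge> 1" for w s
  proof (cases "x w = 0")
    case True
    have "0 \<le> s * y w" using that nn by simp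
    then show ?thesis using True by (simp add: algebra_simps)
  next
    case False
    then have pos: "0 < x w" "0 < y w" using nn[of w] ac[of w] by (auto simp: x_def y_def less_le)
    have "ln (s * y w / x w) \<le> s * y w / x w - 1" using pos that by (intro ln_le_minus_one) auto
    then have "x w * (ln s + ln (y w) - ln (x w)) \<le> x w * (s * y w / x w - 1)"
      using pos that by (intro mult_left_mono) (auto simp: ln_mult ln_div)
    also have "\<dots> = s * y w - x w" using pos by (simp add: field_simps)
    finally show ?thesis by (simp add: algebra_simps)
  qed
  have "measure \<nu> {y \<in> Y. block y 0 n \<in> S} * ln t - (t - 1) * measure \<mu> {y \<in> Y. block y 0 n \<in> S}
      = (\<Sum>w\<in>words n. if w \<in> S then x w * ln t - (t - 1) * y w else 0)"
    unfolding measure_block_if[OF \<nu>] measure_block_if[OF \<mu>] sum_distrib_left sum_distrib_right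
      sum_subtractf[symmetric] x_def y_def
    by (intro sum.cong) auto
  \<comment> \<open>Words in \<open>S\<close> use the parameter t; for the others, parameter 1 shows
    that the summand is nonnegative. The terms - x + y cancel in the total, as both measures have
    mass 1.\<close>
  also have "\<dots> \<le> (\<Sum>w\<in>words n. x w * (ln (x w) - ln (y w)) - x w + y w)"
    using key[OF \<open>t \<ge> 1\<close>] key[of 1] by (intro sum_mono) auto
  also have "\<dots> = (\<Sum>w\<in>words n. x w * (ln (x w) - ln (y w)))"
    using measure_block_total[OF \<nu>, of n] measure_block_total[OF \<mu>, of n]
    by (simp add: sum.distrib sum_subtractf x_def y_def)
  finally show ?thesis by (simp add: x_def y_def)
qed

text \<open>Let \<mu>(A) = 0 and a = \<nu>(A). Approximating A by cylinder sets in both measures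
  turns the entropy bound into a ln t \<le> C for every t \<ge> 1, and large t forces a = 0.\<close>

lemma bounded_relative_entropy_imp_ac:
  assumes \<nu>: "\<nu> \<in> borel_prob_measures Y" and \<mu>: "\<mu> \<in> borel_prob_measures Y"
    and ac: "\<And>w. measure \<mu> (cylinder Y w) = 0 \<Longrightarrow> measure \<nu> (cylinder Y w) = 0"
    and bd: "\<And>n. (\<Sum>w\<in>words n. measure \<nu> (cylinder Y w) *
      (ln (measure \<nu> (cylinder Y w)) - ln (measure \<mu> (cylinder Y w)))) \<le> C"
  shows "absolutely_continuous \<mu> \<nu>"
  unfolding absolutely_continuous_def
proof
  interpret M: prob_space \<mu> using \<mu> by (simp add: borel_prob_measures_iff)
  interpret N: prob_space \<nu> using \<nu> by (simp add: borel_prob_measures_iff)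
  have s: "sets \<mu> = sigma_sets Y (cyl_alg Y)" "sets \<nu> = sigma_sets Y (cyl_alg Y)"
    using \<mu> \<nu> by (auto simp: borel_prob_measures_iff)
  fix A assume "A \<in> null_sets \<mu>"
  then have A: "A \<in> sets \<mu>" "measure \<mu> A = 0" by (auto simp: null_sets_def measure_def)
  define a where "a = measure \<nu> A"
  have bound: "a * ln t \<le> C" if "t \<ge> 1" for t
  proof (rule field_le_epsilon)
    fix e :: real assume "e > 0"
    \<comment> \<open>The errors (t - 1) d, from \<mu>(B), and d ln t, from replacing A by B under
      \<nu>, fit together into d (t + ln t) = e.\<close>
    define d where "d = e / (t + ln t)"
    have "t + ln t > 0" using that by (intro add_pos_nonneg) auto
    then have "d > 0" using \<open>e > 0\<close> by (simp add: d_def)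
    then obtain B where B: "B \<in> cyl_alg Y" "measure \<mu> ((A - B) \<union> (B - A)) < d"
        "measure \<nu> ((A - B) \<union> (B - A)) < d"
      using approx_by_generating_algebra[OF M.finite_measure_axioms s(1) N.finite_measure_axioms s(2)
          algebra_cyl_alg _ \<open>d > 0\<close>] A(1) s(1) by blast
    then obtain n S where BS: "B = {y \<in> Y. block y 0 n \<in> S}" by (auto simp: cyl_alg_def)
    have Bs: "B \<in> sets \<mu>" "B \<in> sets \<nu>" "A \<in> sets \<nu>"
      using B(1) A(1) s cyl_alg_sets[OF \<mu>] cyl_alg_sets[OF \<nu>] by auto
    have "measure \<mu> B \<le> measure \<mu> (A \<union> ((A - B) \<union> (B - A)))"
      using A Bs by (intro M.finite_measure_mono) auto
    also have "\<dots> \<le> measure \<mu> A + measure \<mu> ((A - B) \<union> (B - A))"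
      using A Bs by (intro measure_Un_le) auto
    finally have 1: "measure \<mu> B \<le> d" using A(2) B(2) by simp
    have "a \<le> measure \<nu> (B \<union> ((A - B) \<union> (B - A)))"
      unfolding a_def using Bs by (intro N.finite_measure_mono) auto
    also have "\<dots> \<le> measure \<nu> B + measure \<nu> ((A - B) \<union> (B - A))"
      using Bs by (intro measure_Un_le) auto
    finally have "a \<le> measure \<nu> B + d" using B(3) by simp
    then have "a * ln t \<le> (measure \<nu> B + d) * ln t" using that by (intro mult_right_mono) auto
    also have "\<dots> \<le> C + (t - 1) * measure \<mu> B + d * ln t"
      using relative_entropy_bound[OF \<nu> \<mu> that ac, of n S] bd[of n] by (simp add: BS algebra_simps)
    also have "\<dots> \<le> C + (t - 1) * d + d * ln t"
      using 1 that \<open>d > 0\<close> by (intro add_mono mult_left_mono) auto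
    also have "\<dots> \<le> C + d * (t + ln t)" using \<open>d > 0\<close> by (simp add: algebra_simps)
    also have "d * (t + ln t) = e" using \<open>t + ln t > 0\<close> by (simp add: d_def)
    finally show "a * ln t \<le> C + e" .
  qed
  have "a \<le> 0"
  proof (rule ccontr)
    assume "\<not> a \<le> 0"
    \<comment> \<open>With this choice a ln t = |C| + 1, which exceeds C.\<close>
    define t where "t = exp ((\<bar>C\<bar> + 1) / a)"
    have "t \<ge> 1" using \<open>\<not> a \<le> 0\<close> by (simp add: t_def)
    from bound[OF this] show False using \<open>\<not> a \<le> 0\<close> by (simp add: t_def)
  qed
  then have "measure \<nu> A = 0" using measure_nonneg[of \<nu> A] by (simp add: a_def)
  then show "A \<in> null_sets \<nu>" using A(1) s by (simp add: null_sets_def N.emeasure_eq_measure)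
qed

text \<open>For sets decided by blocks, the inequality is summed over both families of words. The
  threshold k + g involves only the block length of the set approximating A, not the length needed
  for B; this makes it uniform in B.\<close>

lemma shift_lower_bound:
  assumes inv: "\<mu> \<in> invariant_measures Y" and c: "0 < c" "c \<le> 1"
    and low: "\<And>u v n. n \<ge> g \<Longrightarrow> c * measure \<mu> (cylinder Y u) * measure \<mu> (cylinder Y v)
      \<le> (\<Sum>x\<in>words n. measure \<mu> (cylinder Y (u @ x @ v)))"
  shows "lower_bound_mixing \<mu> shift_map c"
proof -
  note \<mu> = invariant_imp_borel[OF inv]
  interpret prob_preserving \<mu> shift_map by (rule invariant_imp_prob_preserving[OF inv])
  have sp: "space \<mu> = Y" and s: "sets \<mu> = sigma_sets Y (cyl_alg Y)"
    using \<mu> by (auto simp: borel_prob_measures_iff)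
  have cyl: "c * prob {y \<in> Y. block y 0 k \<in> S} * prob {y \<in> Y. block y 0 l \<in> S'} \<le>
      prob ({y \<in> Y. block y 0 k \<in> S} \<inter> (shift_map ^^ n) -` {y \<in> Y. block y 0 l \<in> S'})"
    if n: "n \<ge> k + g" for k l n S S'
  proof -
    define r where "r = n - k"
    have nr: "n = k + r" "r \<ge> g" using n by (auto simp: r_def)
    define m where "m w = prob (cylinder Y w)" for w
    have "block y 0 (k + (r + l)) = block y 0 k @ block y k r @ block y (k + r) l" for y :: "nat \<Rightarrow> 'b"
      using block_add[of y 0 k "r + l"] block_add[of y k r l] by simp
    then have eq: "{y \<in> Y. block y 0 k \<in> S} \<inter> (shift_map ^^ n) -` {y \<in> Y. block y 0 l \<in> S'}
        = {y \<in> Y. block y 0 (k + (r + l)) \<in> {w. take k w \<in> S \<and> drop n w \<in> S'}}"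
      by (auto simp: nr(1) block_shift funpow_shift_in)
    have "c * prob {y \<in> Y. block y 0 k \<in> S} * prob {y \<in> Y. block y 0 l \<in> S'}
        = (\<Sum>u\<in>words k. \<Sum>v\<in>words l. if u \<in> S \<and> v \<in> S' then c * m u * m v else 0)"
      unfolding measure_block_if[OF \<mu>] m_def[symmetric]
      by (subst mult.assoc, subst sum_product, subst sum_distrib_left) 
        (auto simp: sum_distrib_left intro!: sum.cong)
    also have "\<dots> \<le> (\<Sum>u\<in>words k. \<Sum>v\<in>words l. if u \<in> S \<and> v \<in> S' then \<Sum>x\<in>words r. m (u @ x @ v) else 0)"
      using low[OF nr(2)] by (intro sum_mono) (auto simp: m_def)
    also have "\<dots> = (\<Sum>u\<in>words k. \<Sum>v\<in>words l. \<Sum>x\<in>words r. if u \<in> S \<and> v \<in> S' then m (u @ x @ v) else 0)"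
      by (intro sum.cong) auto
    also have "\<dots> = (\<Sum>u\<in>words k. \<Sum>x\<in>words r. \<Sum>v\<in>words l. if u \<in> S \<and> v \<in> S' then m (u @ x @ v) else 0)"
      by (intro sum.cong[OF refl] sum.swap)
    also have "\<dots> = prob {y \<in> Y. block y 0 (k + (r + l)) \<in> {w. take k w \<in> S \<and> drop n w \<in> S'}}"
      unfolding measure_block_if[OF \<mu>] sum_words_add m_def
      by (intro sum.cong) (auto simp: words_def nr(1))
    finally show ?thesis unfolding eq .
  qed
  show ?thesis
  proof (unfold_locales)
    show "0 < c" by fact
    fix A and e :: real assume A: "A \<in> events" and e: "e > 0"
    \<comment> \<open>Four errors of at most e / 4 arise: two from the intersection, and two from
      the product of measures, where c \<le> 1 is used.\<close>
    have e4: "e / 4 > 0" using e by simp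
    have approx: "\<exists>k S. prob ((A - {y \<in> Y. block y 0 k \<in> S}) \<union> ({y \<in> Y. block y 0 k \<in> S} - A)) < e / 4"
      if "A \<in> events" for A
    proof -
      have "\<exists>B\<in>cyl_alg Y. prob ((A - B) \<union> (B - A)) < e / 4"
        using approx_by_generating_algebra[OF finite_measure_axioms s finite_measure_axioms s algebra_cyl_alg _ e4] that s
        by blast
      then show ?thesis by (auto simp: cyl_alg_def)
    qed
    obtain k S where kS: "prob ((A - {y \<in> Y. block y 0 k \<in> S}) \<union> ({y \<in> Y. block y 0 k \<in> S} - A)) < e / 4"
      using approx[OF A] by blast
    define A' where "A' = {y \<in> Y. block y 0 k \<in> S}"
    have A': "A' \<in> events" unfolding A'_def by (rule cyl_alg_sets[OF \<mu> cyl_algI])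
    have "c * prob A * prob B - e \<le> prob (A \<inter> (shift_map ^^ n) -` B)" if n: "n \<ge> k + g" and B: "B \<in> events" for n B
    proof -
      obtain l S' where lS: "prob ((B - {y \<in> Y. block y 0 l \<in> S'}) \<union> ({y \<in> Y. block y 0 l \<in> S'} - B)) < e / 4"
        using approx[OF B] by blast
      define B' where "B' = {y \<in> Y. block y 0 l \<in> S'}"
      have B': "B' \<in> events" unfolding B'_def by (rule cyl_alg_sets[OF \<mu> cyl_algI])
      define DA DB where "DA = (A - A') \<union> (A' - A)" and "DB = (B - B') \<union> (B' - B)"
      have D: "DA \<in> events" "DB \<in> events" "prob DA < e / 4" "prob DB < e / 4"
        using A A' B B' kS lS by (auto simp: DA_def DB_def A'_def B'_def)
      have sub: "prob E \<le> prob E' + prob F" if "E \<subseteq> E' \<union> F" "E \<in> events" "E' \<in> events" "F \<in> events" for E E' F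
        using that finite_measure_mono[of E "E' \<union> F"] measure_Un_le[of E' \<mu> F] by fastforce
      have vim: "(shift_map ^^ n) -` E \<inter> space \<mu> \<in> events" if "E \<in> events" for E
        using measurable_sets[OF Tn_meas that] .
      have AB: "A \<inter> (shift_map ^^ n) -` B \<in> events" "A' \<inter> (shift_map ^^ n) -` B' \<in> events"
        using sets.Int[OF A vim[OF B]] sets.Int[OF A' vim[OF B']] sets.sets_into_space[OF A] sets.sets_into_space[OF A']
        by (auto simp: Int_absorb2 Int_assoc[symmetric] Int_commute[of _ "space \<mu>"]) (metis Int_absorb1 Int_assoc Int_commute)+
      have 1: "prob A \<le> prob A' + e / 4" 
      proof -
        have "A \<subseteq> A' \<union> DA" by (auto simp: DA_def)
        then show ?thesis using sub[of A A' DA] A A' D by simp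
      qed
      have 2: "prob B \<le> prob B' + e / 4" 
      proof -
        have "B \<subseteq> B' \<union> DB" by (auto simp: DB_def)
        then show ?thesis using sub[of B B' DB] B B' D by simp
      qed
      have "prob (A' \<inter> (shift_map ^^ n) -` B') \<le> prob ((A \<inter> (shift_map ^^ n) -` B) \<union> DA) + prob ((shift_map ^^ n) -` DB \<inter> space \<mu>)"
        using AB D vim[OF D(2)] sets.sets_into_space[OF A'] by (intro sub) (auto simp: DA_def DB_def)
      also have "prob ((A \<inter> (shift_map ^^ n) -` B) \<union> DA) \<le> prob (A \<inter> (shift_map ^^ n) -` B) + prob DA"
        using AB D by (intro measure_Un_le) auto
      finally have 3: "prob (A' \<inter> (shift_map ^^ n) -` B') \<le> prob (A \<inter> (shift_map ^^ n) -` B) + e / 4 + e / 4"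
        using prob_Tn[OF D(2), of n] D by simp
      have "c * (prob A * prob B) \<le> c * ((prob A' + e / 4) * prob B)"
        using 1 c by (intro mult_left_mono mult_right_mono) auto
      also have "\<dots> = c * (prob A' * prob B) + c * (e / 4) * prob B" by (simp add: algebra_simps)
      finally have 4: "c * (prob A * prob B) \<le> c * (prob A' * prob B) + c * (e / 4) * prob B" .
      have "c * (prob A' * prob B) \<le> c * (prob A' * (prob B' + e / 4))"
        using 2 c by (intro mult_left_mono) auto
      also have "\<dots> = c * prob A' * prob B' + c * (e / 4) * prob A'" by (simp add: algebra_simps)
      finally have 5: "c * (prob A' * prob B) \<le> c * prob A' * prob B' + c * (e / 4) * prob A'" .
      have 6: "c * (e / 4) * prob E \<le> 1 * (e / 4) * 1" for E
        using c e by (intro mult_mono) auto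
      have 7: "c * prob A' * prob B' \<le> prob (A' \<inter> (shift_map ^^ n) -` B')"
        unfolding A'_def B'_def by (rule cyl[OF n])
      show ?thesis using 3 4 5 6[of B] 6[of A'] 7 by (simp add: mult.assoc)
    qed
    then show "\<exists>N. \<forall>n\<ge>N. \<forall>B\<in>events. c * prob A * prob B - e \<le> prob (A \<inter> (shift_map ^^ n) -` B)"
      by blast
  qed
qed

end

section \<open>The variational principle\<close>

text \<open>The weight vanishes exactly off the language of \<open>Y\<close>, so a word of weight 0
  has measure 0 and the convention ln 0 = 0 does not distort any sum.\<close>

locale weighted_shift = shift_space Y + word_weight psi p
  for Y :: "(nat \<Rightarrow> 'b::finite) set" and psi :: "'b list \<Rightarrow> real" and p :: nat +
  fixes phi :: "nat \<Rightarrow> (nat \<Rightarrow> 'b) \<Rightarrow> real"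
  assumes supp: "\<And>w. cylinder Y w = {} \<longleftrightarrow> psi w = 0"
    and phi: "\<And>n y. n \<ge> 1 \<Longrightarrow> y \<in> Y \<Longrightarrow> phi n y = ln (psi (block y 0 n))"
begin

lemma psi_block_pos: "y \<in> Y \<Longrightarrow> psi (block y 0 n) > 0"
proof -
  assume "y \<in> Y"
  then have "y \<in> cylinder Y (block y 0 n)" by (simp add: cylinder_iff)
  then have "psi (block y 0 n) \<noteq> 0" using supp by blast
  then show ?thesis using psi_nonneg[of "block y 0 n"] by linarith
qed

text \<open>The mixing constant: \<open>c0\<close> from the lower Gibbs bound of the joined words,
  the exponential from the two gaps, and K^4 from the upper Gibbs bounds K^2 of the two outer
  words.\<close>

definition gibbs_constant :: real where "gibbs_constant = c0 * exp (- (2 * real p * pressure)) / K ^ 4"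

lemma gibbs_measure_exists:
  obtains \<mu> where "\<mu> \<in> invariant_measures Y"
    "\<And>w. c0 * (psi w * exp (- (real (length w) * pressure))) \<le> measure \<mu> (cylinder Y w)"
    "\<And>w. measure \<mu> (cylinder Y w) \<le> K^2 * (psi w * exp (- (real (length w) * pressure)))"
proof -
  obtain m :: "'b list \<Rightarrow> real" where m: "m [] = 1"
    "\<And>w. (\<Sum>a\<in>UNIV. m (w @ [a])) = m w" "\<And>w. (\<Sum>a\<in>UNIV. m (a # w)) = m w"
    "\<And>w. c0 * (psi w * exp (- (real (length w) * pressure))) \<le> m w"
    "\<And>w. m w \<le> K^2 * (psi w * exp (- (real (length w) * pressure)))"
    by (rule gibbs_weights_exist) blast
  have m0: "0 \<le> m w" for w
    using m(4)[of w] c0_pos psi_nonneg[of w] by (meson exp_ge_zero less_imp_le mult_nonneg_nonneg order_trans)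
  have ms: "m w = 0" if "cylinder Y w = {}" for w
    using m(5)[of w] m0[of w] that supp by simp
  have "closedin full_topology Y" using subshift by (simp add: subshift_def)
  then obtain \<mu> where \<mu>: "\<mu> \<in> borel_prob_measures Y" "\<And>w. measure \<mu> (cylinder Y w) = m w"
    using cylinder_measure_exists[of Y m] m0 m(1,2) ms by blast
  have "measure_preserving \<mu> shift_map"
    by (rule measure_preservingI[OF \<mu>(1)]) (simp add: \<mu>(2) m(3))
  then have "\<mu> \<in> invariant_measures Y" using \<mu>(1) by (simp add: invariant_measures_def)
  then show thesis by (rule that) (use m \<mu> in auto)
qed

text \<open>For n \<ge> 1 this is the integral of \<open>phi n\<close>; as a sum over words it also
  makes sense at n = 0, so subadditivity holds for all indices.\<close>

definition energy :: "(nat \<Rightarrow> 'b) measure \<Rightarrow> nat \<Rightarrow> real" where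
  "energy \<nu> n = (\<Sum>w\<in>words n. measure \<nu> (cylinder Y w) * ln (psi w))"

text \<open>Submultiplicativity under the logarithm splits each term in two. Summing out the other
  half of the word is additivity for the prefix and invariance for the suffix.\<close>

lemma energy_subadd:
  assumes \<nu>: "\<nu> \<in> invariant_measures Y"
  shows "energy \<nu> (m + n) \<le> energy \<nu> m + energy \<nu> n"
proof -
  let ?x = "\<lambda>w. measure \<nu> (cylinder Y w)"
  have "energy \<nu> (m + n) \<le> (\<Sum>u\<in>words m. \<Sum>v\<in>words n. ?x (u @ v) * ln (psi u) + ?x (u @ v) * ln (psi v))"
    unfolding energy_def sum_words_add
  proof (intro sum_mono)
    fix u v
    show "?x (u @ v) * ln (psi (u @ v)) \<le> ?x (u @ v) * ln (psi u) + ?x (u @ v) * ln (psi v)"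
    proof (cases "psi (u @ v) = 0")
      case True
      then have "cylinder Y (u @ v) = {}" using supp by blast
      then show ?thesis by simp
    next
      case False
      with psi_append_nonzero[OF False] have pos: "psi (u @ v) > 0" "psi u > 0" "psi v > 0"
        using psi_nonneg by (auto simp: less_le)
      have "ln (psi (u @ v)) \<le> ln (psi u * psi v)"
        using psi_submult pos by simp
      also have "\<dots> = ln (psi u) + ln (psi v)" using pos by (simp add: ln_mult_pos)
      finally have "?x (u @ v) * ln (psi (u @ v)) \<le> ?x (u @ v) * (ln (psi u) + ln (psi v))"
        by (intro mult_left_mono) auto
      then show ?thesis by (simp add: algebra_simps)
    qed
  qed
  also have "\<dots> = (\<Sum>u\<in>words m. \<Sum>v\<in>words n. ?x (u @ v) * ln (psi u))
      + (\<Sum>v\<in>words n. \<Sum>u\<in>words m. ?x (u @ v) * ln (psi v))"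
    by (simp add: sum.distrib sum.swap[of _ "words n" "words m"])
  also have "\<dots> = energy \<nu> m + energy \<nu> n"
    using sum_measure_append_right[OF invariant_imp_borel[OF \<nu>]] sum_measure_append_left[OF \<nu>]
    by (simp add: sum_distrib_right[symmetric] energy_def)
  finally show ?thesis .
qed

lemma energy_nonneg: "0 \<le> energy \<nu> n"
  unfolding energy_def
proof (intro sum_nonneg)
  fix w
  show "0 \<le> measure \<nu> (cylinder Y w) * ln (psi w)"
    using psi_ge_1[of w] by (cases "psi w = 0") auto
qed

definition block_entropy :: "(nat \<Rightarrow> 'b) measure \<Rightarrow> nat \<Rightarrow> real" where
  "block_entropy \<nu> n = (\<Sum>w\<in>words n. eta (measure \<nu> (cylinder Y w)))"

text \<open>Entropy and energy rates are limits of real sequences, so the value is a real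
  \<open>F\<close>. By Fekete's lemma both limits are infima, whence the bound at every finite
  n.\<close>

lemma free_energy_eq:
  assumes \<nu>: "\<nu> \<in> invariant_measures Y"
  obtains F where "free_energy phi \<nu> = ereal F"
    "(\<lambda>n. (block_entropy \<nu> n + energy \<nu> n) / real n) \<longlonglongrightarrow> F"
    "\<And>n. real n * F \<le> block_entropy \<nu> n + energy \<nu> n"
proof -
  note \<nu>' = invariant_imp_borel[OF \<nu>]
  interpret prob_preserving \<nu> shift_map by (rule invariant_imp_prob_preserving[OF \<nu>])
  define h where "h = entropy_rate (\<lambda>y. y 0)"
  have h: "(\<lambda>n. block_entropy \<nu> n / real n) \<longlonglongrightarrow> h" "real n * h \<le> block_entropy \<nu> n" for n
    using entropy_rate[OF simple_first_symbol[OF \<nu>']]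
    by (simp_all add: h_def block_entropy_def ent_block[OF \<nu>'])
  obtain L where L: "(\<lambda>n. energy \<nu> n / real n) \<longlonglongrightarrow> L" "\<And>n. real n * L \<le> energy \<nu> n"
  proof (rule fekete[of "energy \<nu>" 0])
    show "0 \<le> energy \<nu> n / real n" for n by (intro divide_nonneg_nonneg energy_nonneg) simp
  qed (use energy_subadd[OF \<nu>] in auto)
  have "(1 / real n) * (\<integral>y. phi n y \<partial>\<nu>) = energy \<nu> n / real n" for n
  proof (cases "n = 0")
    case False
    then show ?thesis
      using integral_block_function[OF \<nu>', of "phi n" "\<lambda>w. ln (psi w)" n] phi
      by (simp add: energy_def)
  qed simp
  then have "(\<lambda>n. ereal ((1 / real n) * (\<integral>y. phi n y \<partial>\<nu>))) \<longlonglongrightarrow> ereal L" using L(1) by (simp only: tendsto_ereal)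
  then have "lim (\<lambda>n. ereal ((1 / real n) * (\<integral>y. phi n y \<partial>\<nu>))) = ereal L" by (rule limI)
  then have fe: "free_energy phi \<nu> = ereal (h + L)"
    using KS_entropy_shift[OF \<nu>] by (simp add: free_energy_def h_def)
  show thesis
  proof (rule that[OF fe])
    show "(\<lambda>n. (block_entropy \<nu> n + energy \<nu> n) / real n) \<longlonglongrightarrow> h + L"
      unfolding add_divide_distrib by (intro tendsto_add h L)
    show "real n * (h + L) \<le> block_entropy \<nu> n + energy \<nu> n" for n
      using h(2)[of n] L(2)[of n] by (simp add: algebra_simps)
  qed
qed

theorem unique_equilibrium_state:
  "(\<exists>!\<mu>. equilibrium_state Y phi \<mu>) \<and>
   (\<forall>\<mu>. equilibrium_state Y phi \<mu> \<longrightarrow> gibbs_measure Y phi \<mu> \<and> mixing \<mu> shift_map)"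
proof -
  obtain \<mu> where \<mu>: "\<mu> \<in> invariant_measures Y"
    "\<And>w. c0 * (psi w * exp (- (real (length w) * pressure))) \<le> measure \<mu> (cylinder Y w)"
    "\<And>w. measure \<mu> (cylinder Y w) \<le> K^2 * (psi w * exp (- (real (length w) * pressure)))"
    by (rule gibbs_measure_exists) blast
  note \<mu>' = invariant_imp_borel[OF \<mu>(1)]
  define m where "m w = measure \<mu> (cylinder Y w)" for w
  define b where "b w = psi w * exp (- (real (length w) * pressure))" for w
  have lo: "c0 * b w \<le> m w" and up: "m w \<le> K^2 * b w" for w
    using \<mu>(2,3)[of w] by (auto simp: m_def b_def)
  have b0: "0 \<le> b w" for w by (simp add: b_def)
  have m_pos: "m w > 0" if "psi w \<noteq> 0" for w
  proof -
    have "b w > 0" using that psi_nonneg[of w] by (simp add: b_def less_le)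
    then have "0 < c0 * b w" using c0_pos by simp
    then show ?thesis using lo[of w] by linarith
  qed
  have K0: "K > 0" using K_ge_1 by simp

  \<comment> \<open>The relative entropy of \<nu> with respect to \<mu> on words of length
    n.\<close>
  define D where "D \<nu> n = (\<Sum>w\<in>words n. measure \<nu> (cylinder Y w) * (ln (measure \<nu> (cylinder Y w)) - ln (m w)))" for \<nu> n
  have term_eq: "eta x + x * ln (psi w) = x * (ln (b w) + real n * pressure) - x * ln x"
    if "w \<in> words n" "psi w \<noteq> 0" for x w n
  proof -
    have "ln (b w) = ln (psi w) - real n * pressure"
      using that psi_nonneg[of w] by (simp add: b_def words_def ln_mult_pos less_le)
    then show ?thesis by (simp add: eta_def algebra_simps)
  qed
  have ac: "measure \<nu> (cylinder Y w) = 0" if "measure \<mu> (cylinder Y w) = 0" for \<nu> w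
    using m_pos[of w] that supp[of w] by (cases "psi w = 0") (auto simp: m_def)
  \<comment> \<open>By the lower Gibbs bound, ln (psi w) is at most ln (m w) + n P - ln c0; what is
    left of the entropy sum is minus the relative entropy.\<close>
  have upper: "block_entropy \<nu> n + energy \<nu> n \<le> real n * pressure - ln c0 - D \<nu> n"
    if \<nu>: "\<nu> \<in> invariant_measures Y" for \<nu> n
  proof -
    let ?x = "\<lambda>w. measure \<nu> (cylinder Y w)"
    have "eta (?x w) + ?x w * ln (psi w) \<le> ?x w * (real n * pressure - ln c0) - ?x w * (ln (?x w) - ln (m w))"
      if w: "w \<in> words n" for w
    proof (cases "psi w = 0")
      case True
      then have "cylinder Y w = {}" using supp by blast
      then show ?thesis by simp
    next
      case False
      then have "b w > 0" using psi_nonneg[of w] by (simp add: b_def less_le)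
      then have "ln (c0 * b w) \<le> ln (m w)" using lo[of w] c0_pos m_pos[OF False] by simp
      then have "ln (b w) \<le> ln (m w) - ln c0" using \<open>b w > 0\<close> c0_pos by (simp add: ln_mult_pos)
      then have "?x w * (ln (b w) + real n * pressure) \<le> ?x w * (ln (m w) - ln c0 + real n * pressure)"
        by (intro mult_left_mono) auto
      then show ?thesis unfolding term_eq[OF w False] by (simp add: algebra_simps)
    qed
    then have "block_entropy \<nu> n + energy \<nu> n \<le>
        (\<Sum>w\<in>words n. ?x w * (real n * pressure - ln c0) - ?x w * (ln (?x w) - ln (m w)))"
      unfolding block_entropy_def energy_def sum.distrib[symmetric] by (rule sum_mono)
    also have "\<dots> = real n * pressure - ln c0 - D \<nu> n"
      using measure_block_total[OF invariant_imp_borel[OF \<nu>], of n]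
      by (simp add: sum_subtractf D_def sum_distrib_right[symmetric])
    finally show ?thesis .
  qed
  have D_nonneg: "0 \<le> D \<nu> n" if \<nu>: "\<nu> \<in> invariant_measures Y" for \<nu> n
    using relative_entropy_bound[OF invariant_imp_borel[OF \<nu>] \<mu>', of 1 n UNIV] ac[of _ \<nu>]
    by (simp add: D_def m_def)
  \<comment> \<open>The same computation for \<mu> itself, with the upper Gibbs bound; here the
    logarithms of \<mu> cancel.\<close>
  have lower: "real n * pressure - ln (K^2) \<le> block_entropy \<mu> n + energy \<mu> n" for n
  proof -
    have "m w * (real n * pressure - ln (K^2)) \<le> eta (m w) + m w * ln (psi w)" if w: "w \<in> words n" for w
    proof (cases "psi w = 0")
      case True
      then have "cylinder Y w = {}" using supp by blast
      then show ?thesis by (simp add: m_def)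
    next
      case False
      then have "b w > 0" using psi_nonneg[of w] by (simp add: b_def less_le)
      then have "ln (m w) \<le> ln (K^2 * b w)" using up[of w] m_pos[OF False] K0 by simp
      then have "ln (m w) - ln (K^2) \<le> ln (b w)" using \<open>b w > 0\<close> K0 by (simp add: ln_mult_pos)
      then have "m w * (ln (m w) - ln (K^2) + real n * pressure) \<le> m w * (ln (b w) + real n * pressure)"
        using m_pos[OF False] by (intro mult_left_mono) auto
      then show ?thesis unfolding term_eq[OF w False] by (simp add: algebra_simps)
    qed
    then have "(\<Sum>w\<in>words n. m w * (real n * pressure - ln (K^2))) \<le> block_entropy \<mu> n + energy \<mu> n"
      unfolding block_entropy_def energy_def sum.distrib[symmetric] m_def by (rule sum_mono)
    then show ?thesis
      using measure_block_total[OF \<mu>', of n] by (simp add: sum_distrib_right[symmetric] m_def)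
  qed
  have le_P: "free_energy phi \<nu> \<le> ereal pressure" if \<nu>: "\<nu> \<in> invariant_measures Y" for \<nu>
  proof -
    obtain F where F: "free_energy phi \<nu> = ereal F"
      "(\<lambda>n. (block_entropy \<nu> n + energy \<nu> n) / real n) \<longlonglongrightarrow> F"
      using free_energy_eq[OF \<nu>] by blast
    have "(\<lambda>n. pressure + (- ln c0) / real n) \<longlonglongrightarrow> pressure + 0"
      by (intro tendsto_add tendsto_const lim_const_over_n)
    moreover have "(block_entropy \<nu> n + energy \<nu> n) / real n \<le> pressure + (- ln c0) / real n" if "n \<ge> 1" for n
    proof -
      have "pressure + (- ln c0) / real n = (real n * pressure - ln c0) / real n"
        using that by (simp add: diff_divide_distrib)
      moreover have "block_entropy \<nu> n + energy \<nu> n \<le> real n * pressure - ln c0"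
        using upper[OF \<nu>, of n] D_nonneg[OF \<nu>, of n] by linarith
      ultimately show ?thesis by (simp add: divide_right_mono)
    qed
    ultimately have "F \<le> pressure + 0" by (intro LIMSEQ_le[OF F(2)]) auto
    then show ?thesis using F(1) by simp
  qed
  have \<mu>_P: "free_energy phi \<mu> = ereal pressure"
  proof (rule antisym[OF le_P[OF \<mu>(1)]])
    obtain F where F: "free_energy phi \<mu> = ereal F"
      "(\<lambda>n. (block_entropy \<mu> n + energy \<mu> n) / real n) \<longlonglongrightarrow> F"
      using free_energy_eq[OF \<mu>(1)] by blast
    have "(\<lambda>n. pressure + (- ln (K^2)) / real n) \<longlonglongrightarrow> pressure + 0"
      by (intro tendsto_add tendsto_const lim_const_over_n)
    moreover have "pressure + (- ln (K^2)) / real n \<le> (block_entropy \<mu> n + energy \<mu> n) / real n" if "n \<ge> 1" for n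
    proof -
      have "pressure + (- ln (K^2)) / real n = (real n * pressure - ln (K^2)) / real n"
        using that by (simp add: diff_divide_distrib)
      then show ?thesis using divide_right_mono[OF lower[of n], of "real n"] by simp
    qed
    ultimately have "pressure + 0 \<le> F" by (intro LIMSEQ_le[OF _ F(2)]) auto
    then show "ereal pressure \<le> free_energy phi \<mu>" using F(1) by simp
  qed
  have SUP: "(SUP \<nu>\<in>invariant_measures Y. free_energy phi \<nu>) = ereal pressure"
    using \<mu>_P \<mu>(1) le_P by (intro antisym SUP_least) (auto intro: SUP_upper2)

  have c: "0 < gibbs_constant" "gibbs_constant \<le> 1"
  proof -
    show "0 < gibbs_constant" using c0_pos K0 by (simp add: gibbs_constant_def)
    have "1 \<le> K ^ 4" using K_ge_1 by (rule one_le_power)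
    moreover have "c0 * exp (- (2 * real p * pressure)) \<le> 1 * 1"
      using c0_le_1 c0_pos pressure_nonneg by (intro mult_mono) auto
    ultimately have "c0 * exp (- (2 * real p * pressure)) / K ^ 4 \<le> 1 / 1" by (intro frac_le) auto
    then show "gibbs_constant \<le> 1" by (simp add: gibbs_constant_def)
  qed
  have "gibbs_constant * m u * m v \<le> (\<Sum>x\<in>words n. m (u @ x @ v))" if n: "n \<ge> 2 * p" for u v n
  proof -
    define k where "k = n - 2 * p"
    have nk: "n = p + (k + p)" using n by (simp add: k_def)
    \<comment> \<open>The normalising factor of the joined words. As n = k + 2 p, the factors of
      \<open>u\<close> and \<open>v\<close> times exp (- 2 p P) equal exp (k P) times
      \<open>e\<close>, and exp (k P) is at most \<open>Z k\<close>.\<close>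
    define e where "e = exp (- ((real (length u) + real n + real (length v)) * pressure))"
    have "gibbs_constant * m u * m v \<le> gibbs_constant * (K^2 * b u) * (K^2 * b v)"
      using up c b0 by (intro mult_mono) (auto simp: m_def)
    also have "\<dots> = c0 * exp (- (2 * real p * pressure)) * (b u * b v)"
      using K0 by (simp add: gibbs_constant_def field_simps power2_eq_square eval_nat_numeral)
    also have "\<dots> = c0 * (psi u * psi v * (exp (- (2 * real p * pressure)) *
        (exp (- (real (length u) * pressure)) * exp (- (real (length v) * pressure)))))"
      by (simp add: b_def mult_ac)
    also have "exp (- (2 * real p * pressure)) *
        (exp (- (real (length u) * pressure)) * exp (- (real (length v) * pressure))) = exp (real k * pressure) * e"
      by (simp add: e_def nk mult_exp_exp algebra_simps)
    also have "c0 * (psi u * psi v * (exp (real k * pressure) * e)) \<le> c0 * (psi u * psi v * (Z k * e))"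
      using c0_pos Z_lower[of k] by (intro mult_left_mono mult_right_mono) (auto simp: e_def)
    also have "\<dots> = c0 * e * (psi u * psi v * Z k)" by (simp only: mult_ac)
    also have "\<dots> \<le> c0 * e * (\<Sum>w\<in>words n. psi (u @ w @ v))"
      using psi_gap_Z[of u v k] c0_pos unfolding nk by (intro mult_left_mono) (auto simp: e_def)
    also have "\<dots> = (\<Sum>w\<in>words n. c0 * b (u @ w @ v))"
      unfolding sum_distrib_left by (intro sum.cong) (auto simp: b_def e_def words_def algebra_simps)
    also have "\<dots> \<le> (\<Sum>w\<in>words n. m (u @ w @ v))" by (intro sum_mono lo)
    finally show ?thesis .
  qed
  then interpret lower_bound_mixing \<mu> shift_map gibbs_constant
    unfolding m_def by (intro shift_lower_bound[OF \<mu>(1) c])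

  have eq: "\<nu> = \<mu>" if "equilibrium_state Y phi \<nu>" for \<nu>
  proof -
    have \<nu>: "\<nu> \<in> invariant_measures Y" "free_energy phi \<nu> = ereal pressure"
      using that SUP by (auto simp: equilibrium_state_def)
    note \<nu>' = invariant_imp_borel[OF \<nu>(1)]
    obtain F where "free_energy phi \<nu> = ereal F" "\<And>n. real n * F \<le> block_entropy \<nu> n + energy \<nu> n"
      using free_energy_eq[OF \<nu>(1)] by blast
    then have low: "real n * pressure \<le> block_entropy \<nu> n + energy \<nu> n" for n using \<nu>(2) by simp
    \<comment> \<open>The terms n P cancel between the two bounds, which leaves one independent of
      n.\<close>
    have Dn: "D \<nu> n \<le> - ln c0" for n using upper[OF \<nu>(1), of n] low[of n] by linarith
    have "absolutely_continuous \<mu> \<nu>"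
    proof (rule bounded_relative_entropy_imp_ac[OF \<nu>' \<mu>'])
      show "measure \<nu> (cylinder Y w) = 0" if "measure \<mu> (cylinder Y w) = 0" for w
        by (rule ac[OF that])
      show "(\<Sum>w\<in>words n. measure \<nu> (cylinder Y w) *
          (ln (measure \<nu> (cylinder Y w)) - ln (measure \<mu> (cylinder Y w)))) \<le> - ln c0" for n
        using Dn[of n] by (simp add: D_def m_def)
    qed
    then show "\<nu> = \<mu>"
      using \<nu> \<mu>(1) by (intro absolutely_continuous_invariant_eq)
        (auto simp: invariant_measures_def borel_prob_measures_iff)
  qed
  have "equilibrium_state Y phi \<mu>"
    using \<mu>(1) \<mu>_P SUP by (simp add: equilibrium_state_def)
  moreover have "gibbs_measure Y phi \<mu>"
    unfolding gibbs_measure_def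
  \<comment> \<open>The constant strictly exceeds both K^2, for the upper bound, and 1 / c0, for the
    lower one.\<close>
  proof (rule conjI[OF \<mu>'], rule exI[of _ "K^2 + 1 / c0 + 1"], rule conjI, goal_cases)
    case 1
    show "0 < K^2 + 1 / c0 + 1" using c0_pos by (simp add: add_nonneg_pos)
  next
    case 2
    show ?case
    proof (rule exI[of _ pressure], intro ballI allI impI conjI)
      fix y and n :: nat assume y: "y \<in> Y" and n: "1 \<le> n"
      let ?w = "block y 0 n"
      have pos: "psi ?w > 0" by (rule psi_block_pos[OF y])
      have "exp (- real n * pressure + phi n y) = exp (- (real n * pressure)) * exp (ln (psi ?w))"
        by (simp only: phi[OF n y] exp_add mult_minus_left)
      also have "\<dots> = b ?w" using pos by (simp add: b_def)
      finally have e: "exp (- real n * pressure + phi n y) = b ?w" .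
      have bp: "b ?w > 0" using pos by (simp add: b_def)
      have "1 / (K^2 + 1 / c0 + 1) < c0"
        using c0_pos by (simp add: field_simps add_pos_nonneg)
      also have "c0 \<le> m ?w / b ?w" using lo[of ?w] bp by (simp add: le_divide_eq)
      finally show "1 / (K^2 + 1 / c0 + 1) < measure \<mu> (cylinder Y ?w) / exp (- real n * pressure + phi n y)"
        unfolding e by (simp add: m_def)
      have "m ?w / b ?w \<le> K^2" using up[of ?w] bp by (simp add: divide_le_eq)
      also have "\<dots> < K^2 + 1 / c0 + 1" using c0_pos by (simp add: add_pos_pos)
      finally show "measure \<mu> (cylinder Y ?w) / exp (- real n * pressure + phi n y) < K^2 + 1 / c0 + 1"
        unfolding e by (simp add: m_def)
    qed
  qed
  ultimately show ?thesis using eq mixing by metis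
qed

end

section \<open>Preimage counts\<close>

text \<open>After division by the total every term q lies in [0, 1], where q \<le> q^s, and the
  normalised terms sum to 1.\<close>

lemma powr_sum_le:
  fixes x :: "'i \<Rightarrow> real"
  assumes "finite S" "\<And>i. i \<in> S \<Longrightarrow> 0 \<le> x i" "0 \<le> s" "s \<le> 1"
  shows "(\<Sum>i\<in>S. x i) powr s \<le> (\<Sum>i\<in>S. x i powr s)"
proof (cases "(\<Sum>i\<in>S. x i) = 0")
  case False
  define t where "t = (\<Sum>i\<in>S. x i)"
  have t: "t > 0" using False assms sum_nonneg[of S x] by (simp add: t_def less_le)
  have "x i / t \<le> x i powr s / t powr s" if i: "i \<in> S" for i
  proof (cases "x i = 0")
    case False
    then have xi: "0 < x i" using assms(2)[OF i] by simp
    have "x i \<le> t" unfolding t_def by (rule member_le_sum) (use i assms in auto)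
    then have "(x i / t) powr 1 \<le> (x i / t) powr s"
      using xi t assms by (intro powr_mono') auto
    then show ?thesis using xi t by (simp add: powr_divide)
  qed simp
  then have "(\<Sum>i\<in>S. x i / t) \<le> (\<Sum>i\<in>S. x i powr s / t powr s)" by (rule sum_mono)
  then have "1 \<le> (\<Sum>i\<in>S. x i powr s) / t powr s"
    using t by (simp add: sum_divide_distrib[symmetric] t_def[symmetric])
  then show ?thesis using t by (simp add: t_def[symmetric] le_divide_eq)
next
  case True
  have "0 \<le> (\<Sum>i\<in>S. x i powr s)" by (rule sum_nonneg) simp
  then show ?thesis unfolding True by simp
qed

text \<open>Pairs of words of length m are finite in number, so one gap p exceeds all their mixing
  times and serves all points and all k, l. As m bounds the lengths of forbidden words, overlaps of
  m letters make a glued sequence legal.\<close>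

lemma mixing_SFT_gap:
  fixes X :: "(nat \<Rightarrow> 'a::finite) set"
  assumes sft: "shift_of_finite_type X" and mix: "topologically_mixing X"
  obtains p where "\<And>x x' k l. x \<in> X \<Longrightarrow> x' \<in> X \<Longrightarrow>
    \<exists>z\<in>X. block z 0 k = block x 0 k \<and> block z (k + p) l = block x' 0 l"
proof -
  interpret shift_space X
    by unfold_locales (use sft in \<open>simp add: shift_of_finite_type_def\<close>)
  obtain F where F: "finite F" "X = {x. \<forall>w\<in>F. \<not> occurs_in w x}"
    using sft by (auto simp: shift_of_finite_type_def)
  obtain m where m: "\<And>w. w \<in> F \<Longrightarrow> length w \<le> m"
    using finite_imageI[OF F(1), of length] by (auto simp: finite_nat_set_iff_bounded_le)
  have "\<exists>N. cylinder X s \<noteq> {} \<and> cylinder X t \<noteq> {} \<longrightarrow>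
      (\<forall>n\<ge>N. cylinder X s \<inter> (shift_map ^^ n) -` cylinder X t \<noteq> {})" for s t
    using mix[unfolded topologically_mixing_def, rule_format, of "cylinder X s" "cylinder X t"]
      openin_cyl_alg[OF cylinder_in_cyl_alg[of X s]] openin_cyl_alg[OF cylinder_in_cyl_alg[of X t]] by auto
  then have "\<forall>st. \<exists>N. cylinder X (fst st) \<noteq> {} \<and> cylinder X (snd st) \<noteq> {} \<longrightarrow>
      (\<forall>n\<ge>N. cylinder X (fst st) \<inter> (shift_map ^^ n) -` cylinder X (snd st) \<noteq> {})" by simp
  from choice[OF this] obtain N where N': "\<forall>st. cylinder X (fst st) \<noteq> {} \<and> cylinder X (snd st) \<noteq> {} \<longrightarrow>
      (\<forall>n\<ge>N st. cylinder X (fst st) \<inter> (shift_map ^^ n) -` cylinder X (snd st) \<noteq> {})" ..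
  have N: "cylinder X s \<inter> (shift_map ^^ n) -` cylinder X t \<noteq> {}"
    if "cylinder X s \<noteq> {}" "cylinder X t \<noteq> {}" "n \<ge> N (s, t)" for s t n
    using spec[OF N', of "(s, t)"] that by simp
  define p where "p = Max (N ` (words m \<times> words m))"
  have p: "N (s, t) \<le> p" if "s \<in> words m" "t \<in> words m" for s t
    unfolding p_def by (rule Max_ge) (use that in auto)
  show thesis
  proof (rule that)
    fix x x' k l assume x: "x \<in> X" and x': "x' \<in> X"
    \<comment> \<open>The bridge \<open>z\<close> is to begin with the m letters of \<open>x\<close>
      that follow the prefix of length k, and to carry the initial m letters of \<open>x'\<close> at
      position p.\<close>
    define s t where "s = block x k m" and "t = block x' 0 m"
    have "(shift_map ^^ k) x \<in> cylinder X s"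
      using funpow_shift_in[OF x] by (simp add: cylinder_iff s_def block_shift)
    moreover have "x' \<in> cylinder X t" using x' by (simp add: cylinder_iff t_def)
    moreover have "N (s, t) \<le> p" by (rule p) (simp_all add: s_def t_def)
    ultimately obtain z where z: "z \<in> cylinder X s" "(shift_map ^^ p) z \<in> cylinder X t"
      using N[of s t p] by blast
    have zx: "z j = x (k + j)" if "j < m" for j
      using z(1) that by (auto simp: cylinder_iff s_def block_eq_iff)
    have zx': "z (p + j) = x' j" if "j < m" for j
      using z(2) that by (auto simp: cylinder_iff t_def block_shift block_eq_iff)
    define q where "q i = (if i < k then x i else if i < k + p + m then z (i - k) else x' (i - (k + p)))" for i
    have q1: "q i = x i" if "i < k + m" for i
      using zx[of "i - k"] that by (auto simp: q_def)
    have q2: "q i = z (i - k)" if "k \<le> i" "i < k + p + m" for i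
      using that by (simp add: q_def)
    have q3: "q i = x' (i - (k + p))" if "k + p \<le> i" for i
      using zx'[of "i - (k + p)"] that by (auto simp: q_def)
    have "\<not> occurs_in w q" if w: "w \<in> F" for w
    proof
      assume "occurs_in w q"
      then obtain i where i: "block q i (length w) = w" by (auto simp: occurs_in_def)
      have no: "block y j (length w) \<noteq> w" if "y \<in> X" for y j
        using that F(2) w by (auto simp: occurs_in_def)
      \<comment> \<open>The copies of \<open>x\<close>, \<open>z\<close> and \<open>x'\<close>
        inside \<open>q\<close> overlap in m letters, so a window of length at most m that starts in
        one of these ranges lies in a single copy.\<close>
      consider "i < k" | "k \<le> i" "i < k + p" | "k + p \<le> i" by linarith
      then show False
      proof cases
        case 1
        then have "block q i (length w) = block x i (length w)"
          unfolding block_eq_iff using m[OF w] by (auto intro!: q1)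
        then have "block x i (length w) = w" using i by argo
        then show False using no[OF x] by blast
      next
        case 2
        then have "block q i (length w) = block z (i - k) (length w)"
          unfolding block_eq_iff using m[OF w] by (auto simp: q2)
        then have "block z (i - k) (length w) = w" using i by argo
        then show False using no z(1) by (auto simp: cylinder_def)
      next
        case 3
        then have "block q i (length w) = block x' (i - (k + p)) (length w)"
          unfolding block_eq_iff by (auto simp: q3)
        then have "block x' (i - (k + p)) (length w) = w" using i by argo
        then show False using no[OF x'] by blast
      qed
    qed
    then have "q \<in> X" using F(2) by simp
    moreover have "block q 0 k = block x 0 k" by (auto simp: block_eq_iff q1)
    moreover have "block q (k + p) l = block x' 0 l" by (auto simp: block_eq_iff q3)
    ultimately show "\<exists>z\<in>X. block z 0 k = block x 0 k \<and> block z (k + p) l = block x' 0 l" by blast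
  qed
qed

locale one_block_factor =
  fixes X :: "(nat \<Rightarrow> 'a::finite) set" and Y :: "(nat \<Rightarrow> 'b::finite) set"
    and \<pi> :: "(nat \<Rightarrow> 'a) \<Rightarrow> (nat \<Rightarrow> 'b)"
  assumes sub_X: "subshift X" and factor: "factor_map X Y \<pi>" and ob: "one_block X \<pi>"
begin

sublocale X: shift_space X by unfold_locales (rule sub_X)

lemma \<pi>_shift: "x \<in> X \<Longrightarrow> \<pi> ((shift_map ^^ i) x) = (shift_map ^^ i) (\<pi> x)"
proof (induction i)
  case (Suc i)
  have "\<forall>x\<in>X. \<pi> (shift_map x) = shift_map (\<pi> x)" using factor by (simp add: factor_map_def)
  then show ?case using Suc X.funpow_shift_in[OF Suc.prems, of i] by simp
qed simp

lemma image_\<pi>: "\<pi> ` X = Y"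
  using factor by (simp add: factor_map_def)

lemma \<pi>_block_cong:
  assumes "x \<in> X" "x' \<in> X" "block x 0 n = block x' 0 n"
  shows "block (\<pi> x) 0 n = block (\<pi> x') 0 n"
  using assms(3) ob[unfolded one_block_def, rule_format, OF assms(1,2)] by (simp add: block_eq_iff)

text \<open>X is shift invariant and \<pi> commutes with the shift, so any occurrence can be moved
  to position 0.\<close>

lemma word_preimages_eq:
  "word_preimages X \<pi> v = {block x 0 (length v) |x. x \<in> X \<and> block (\<pi> x) 0 (length v) = v}"
proof -
  have "\<exists>x'\<in>X. w = block x' 0 (length v) \<and> block (\<pi> x') 0 (length v) = v"
    if "x \<in> X" "w = block x i (length v)" "block (\<pi> x) i (length v) = v" for x i w
    using X.funpow_shift_in[OF that(1), of i] \<pi>_shift[OF that(1), of i] that(2,3)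
    by (intro bexI[of _ "(shift_map ^^ i) x"]) (simp_all add: block_shift)
  then show ?thesis unfolding word_preimages_def by blast
qed

lemma word_preimages_subset: "word_preimages X \<pi> v \<subseteq> words (length v)"
  by (auto simp: word_preimages_eq)

lemma finite_word_preimages: "finite (word_preimages X \<pi> v)"
  by (rule finite_subset[OF word_preimages_subset finite_words])

lemma word_preimages_Nil: "word_preimages X \<pi> [] = {[]}"
  using sub_X by (auto simp: word_preimages_eq subshift_def)

lemma word_preimages_empty_iff: "word_preimages X \<pi> v = {} \<longleftrightarrow> cylinder Y v = {}"
proof -
  have "cylinder Y v = {} \<longleftrightarrow> (\<forall>x\<in>X. block (\<pi> x) 0 (length v) \<noteq> v)"
    unfolding cylinder_def image_\<pi>[symmetric] by blast
  then show ?thesis unfolding word_preimages_eq by blast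
qed

lemma card_word_preimages_append:
  "card (word_preimages X \<pi> (u @ v)) \<le> card (word_preimages X \<pi> u) * card (word_preimages X \<pi> v)"
proof -
  let ?f = "\<lambda>w. (take (length u) w, drop (length u) w)"
  have "inj_on ?f (word_preimages X \<pi> (u @ v))" by (rule inj_onI) (metis append_take_drop_id prod.inject)
  moreover have "?f ` word_preimages X \<pi> (u @ v) \<subseteq> word_preimages X \<pi> u \<times> word_preimages X \<pi> v"
  proof
    fix st assume "st \<in> ?f ` word_preimages X \<pi> (u @ v)"
    then obtain x where x: "x \<in> X" "block (\<pi> x) 0 (length u + length v) = u @ v"
      and st: "st = ?f (block x 0 (length u + length v))"
      by (auto simp: word_preimages_eq)
    have "block (\<pi> x) 0 (length u) = u" "block (\<pi> x) (length u) (length v) = v"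
      using x(2) block_add[of "\<pi> x" 0 "length u" "length v"] by auto
    moreover have "st = (block x 0 (length u), block x (length u) (length v))"
      by (simp add: st block_add)
    ultimately show "st \<in> word_preimages X \<pi> u \<times> word_preimages X \<pi> v"
      using x(1) unfolding word_preimages_def by auto
  qed
  ultimately have "card (word_preimages X \<pi> (u @ v)) \<le> card (word_preimages X \<pi> u \<times> word_preimages X \<pi> v)"
    by (intro card_inj_on_le) (auto simp: finite_word_preimages)
  then show ?thesis by (simp add: card_cartesian_product)
qed

text \<open>Every pair of preimages of \<open>u\<close> and \<open>v\<close> is joined by a point of
  X, whose middle block has some image \<open>w\<close>. Which \<open>w\<close> occurs depends on
  the pair, so reading off the two ends is onto only from the union over all
  \<open>w\<close>.\<close>

lemma card_word_preimages_gap: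
  assumes gap: "\<And>x x' k l. x \<in> X \<Longrightarrow> x' \<in> X \<Longrightarrow>
    \<exists>z\<in>X. block z 0 k = block x 0 k \<and> block z (k + p) l = block x' 0 l"
  shows "card (word_preimages X \<pi> u) * card (word_preimages X \<pi> v)
    \<le> (\<Sum>w\<in>words p. card (word_preimages X \<pi> (u @ w @ v)))"
proof -
  let ?U = "\<Union>w\<in>words p. word_preimages X \<pi> (u @ w @ v)"
  let ?f = "\<lambda>w. (take (length u) w, drop (length u + p) w)"
  have "word_preimages X \<pi> u \<times> word_preimages X \<pi> v \<subseteq> ?f ` ?U"
  proof clarify
    fix s t assume "s \<in> word_preimages X \<pi> u" "t \<in> word_preimages X \<pi> v"
    then obtain x x' where x: "x \<in> X" "s = block x 0 (length u)" "block (\<pi> x) 0 (length u) = u"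
      and x': "x' \<in> X" "t = block x' 0 (length v)" "block (\<pi> x') 0 (length v) = v"
      by (auto simp: word_preimages_eq)
    obtain z where z: "z \<in> X" "block z 0 (length u) = s" "block z (length u + p) (length v) = t"
      using gap[OF x(1) x'(1), of "length u" "length v"] x(2) x'(2) by blast
    have split: "block y 0 (length u + (p + length v)) =
        block y 0 (length u) @ block y (length u) p @ block y (length u + p) (length v)" for y :: "nat \<Rightarrow> 'z"
      by (simp add: block_add)
    have "block (\<pi> z) 0 (length u) = u"
      using \<pi>_block_cong[OF z(1) x(1)] z(2) x by simp
    moreover have "block (\<pi> z) (length u + p) (length v) = v"
    proof -
      let ?z = "(shift_map ^^ (length u + p)) z"
      have "block ?z 0 (length v) = block x' 0 (length v)"
        using z(3) x'(2) by (simp add: block_shift)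
      then have "block (\<pi> ?z) 0 (length v) = v"
        using \<pi>_block_cong[OF X.funpow_shift_in[OF z(1)] x'(1)] x'(3) by metis
      then show ?thesis by (simp add: \<pi>_shift[OF z(1)] block_shift)
    qed
    ultimately have "block (\<pi> z) 0 (length (u @ block (\<pi> z) (length u) p @ v)) = u @ block (\<pi> z) (length u) p @ v"
      using split[of "\<pi> z"] by simp
    then have "block z 0 (length (u @ block (\<pi> z) (length u) p @ v)) \<in> word_preimages X \<pi> (u @ block (\<pi> z) (length u) p @ v)"
      unfolding word_preimages_eq using z(1) by blast
    then have "block z 0 (length u + (p + length v)) \<in> ?U"
      using block_in_words[of "\<pi> z" "length u" p] by (auto simp: add.assoc)
    moreover have "(s, t) = ?f (block z 0 (length u + (p + length v)))"
    proof -
      have "length s = length u" using x(2) by simp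
      then show ?thesis using split[of z] z by simp
    qed
    ultimately show "(s, t) \<in> ?f ` ?U" by (rule rev_image_eqI)
  qed
  moreover have "finite ?U" by (simp add: finite_word_preimages)
  ultimately have "card (word_preimages X \<pi> u \<times> word_preimages X \<pi> v) \<le> card ?U"
    by (intro surj_card_le)
  also have "\<dots> \<le> (\<Sum>w\<in>words p. card (word_preimages X \<pi> (u @ w @ v)))"
    by (rule card_UN_le) simp
  finally show ?thesis by (simp add: card_cartesian_product)
qed

definition weight :: "real \<Rightarrow> 'b list \<Rightarrow> real" where
  "weight s v = real (card (word_preimages X \<pi> v)) powr s"

text \<open>\<open>0 powr s\<close> is 0 for every s, so the power has the same support as the
  count.\<close>

lemma weight_eq_0_iff: "weight s v = 0 \<longleftrightarrow> cylinder Y v = {}"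
  by (simp add: weight_def word_preimages_empty_iff[symmetric] finite_word_preimages)

text \<open>Monotonicity of powers transfers submultiplicativity from the counts, and subadditivity
  of t^s for s \<le> 1 moves the power inside the sum over gap words.\<close>

lemma word_weight_weight:
  assumes gap: "\<And>x x' k l. x \<in> X \<Longrightarrow> x' \<in> X \<Longrightarrow>
    \<exists>z\<in>X. block z 0 k = block x 0 k \<and> block z (k + p) l = block x' 0 l"
    and s: "0 \<le> s" "s \<le> 1"
  shows "word_weight (weight s) p"
proof
  show "weight s [] = 1" by (simp add: weight_def word_preimages_Nil)
  show "1 \<le> weight s w" if "weight s w \<noteq> 0" for w
  proof -
    have "card (word_preimages X \<pi> w) \<noteq> 0" using that by (auto simp: weight_def)
    then have "1 \<le> real (card (word_preimages X \<pi> w))" by linarith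
    then show ?thesis unfolding weight_def using s by (intro ge_one_powr_ge_zero)
  qed
  show "weight s (u @ v) \<le> weight s u * weight s v" for u v
  proof -
    have "real (card (word_preimages X \<pi> (u @ v))) \<le> real (card (word_preimages X \<pi> u)) * real (card (word_preimages X \<pi> v))"
      using card_word_preimages_append[of u v] by (metis of_nat_le_iff of_nat_mult)
    then have "weight s (u @ v) \<le> (real (card (word_preimages X \<pi> u)) * real (card (word_preimages X \<pi> v))) powr s"
      unfolding weight_def using s by (intro powr_mono2) auto
    then show ?thesis by (simp add: weight_def powr_mult)
  qed
  show "weight s u * weight s v \<le> (\<Sum>w\<in>words p. weight s (u @ w @ v))" for u v
  proof -
    have "weight s u * weight s v = (real (card (word_preimages X \<pi> u) * card (word_preimages X \<pi> v))) powr s"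
      by (simp add: weight_def powr_mult)
    also have "\<dots> \<le> (\<Sum>w\<in>words p. real (card (word_preimages X \<pi> (u @ w @ v)))) powr s"
      using card_word_preimages_gap[of p u v] gap s
      by (intro powr_mono2) (auto simp: of_nat_sum[symmetric] simp del: of_nat_sum of_nat_mult)
    also have "\<dots> \<le> (\<Sum>w\<in>words p. weight s (u @ w @ v))"
      unfolding weight_def using s by (intro powr_sum_le) auto
    finally show ?thesis .
  qed
  show "\<exists>w\<in>words n. weight s w \<noteq> 0" for n
  proof -
    obtain x where "x \<in> X" using sub_X by (auto simp: subshift_def)
    then have "\<pi> x \<in> cylinder Y (block (\<pi> x) 0 n)" using image_\<pi> by (auto simp: cylinder_iff)
    then have "weight s (block (\<pi> x) 0 n) \<noteq> 0" using weight_eq_0_iff by blast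
    then show ?thesis by (intro bexI[of _ "block (\<pi> x) 0 n"]) simp_all
  qed
qed

end

theorem proposition4p10:
  fixes X :: "(nat \<Rightarrow> 'a::finite) set"
    and Y :: "(nat \<Rightarrow> 'b::finite) set"
    and \<pi> :: "(nat \<Rightarrow> 'a) \<Rightarrow> (nat \<Rightarrow> 'b)"
    and \<alpha> :: real
    and \<phi> :: "nat \<Rightarrow> (nat \<Rightarrow> 'b) \<Rightarrow> real"
  assumes "shift_of_finite_type X" and "topologically_mixing X"
    and "shift_of_finite_type Y" and "topologically_mixing Y"
    and "factor_map X Y \<pi>" and "one_block X \<pi>"
    and "\<alpha> > 0"
    and "\<And>n y. n \<ge> 1 \<Longrightarrow> y \<in> Y \<Longrightarrow>
           \<phi> n y = ln (real (card (word_preimages X \<pi> (block y 0 n))) powr (1 / (\<alpha> + 1)))"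
  shows "(\<exists>!\<mu>. equilibrium_state Y \<phi> \<mu>) \<and>
         (\<forall>\<mu>. equilibrium_state Y \<phi> \<mu> \<longrightarrow> gibbs_measure Y \<phi> \<mu> \<and> mixing \<mu> shift_map)"
proof -
  interpret one_block_factor X Y \<pi>
    by unfold_locales (use assms in \<open>simp_all add: shift_of_finite_type_def\<close>)
  define s where "s = 1 / (\<alpha> + 1)"
  \<comment> \<open>Positivity of \<alpha> puts the exponent into the range where powers are
    subadditive.\<close>
  have s: "0 \<le> s" "s \<le> 1" using assms(7) by (simp_all add: s_def)
  obtain p where p: "\<And>x x' k l. x \<in> X \<Longrightarrow> x' \<in> X \<Longrightarrow>
      \<exists>z\<in>X. block z 0 k = block x 0 k \<and> block z (k + p) l = block x' 0 l"
    using mixing_SFT_gap[OF assms(1,2)] by blast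
  interpret word_weight "weight s" p by (rule word_weight_weight[OF p s])
  interpret weighted_shift Y "weight s" p \<phi>
  proof
    show "subshift Y" using assms(3) by (simp add: shift_of_finite_type_def)
    show "cylinder Y w = {} \<longleftrightarrow> weight s w = 0" for w by (simp add: weight_eq_0_iff)
    show "\<phi> n y = ln (weight s (block y 0 n))" if "n \<ge> 1" "y \<in> Y" for n y
      using assms(8)[OF that] by (simp add: weight_def s_def)
  qed
  show ?thesis by (rule unique_equilibrium_state)
qed

end
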